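(* Let $G$ be a Cayley graph of an infinite, finitely generated group with respect to a finite generating set, and let $\mu$ be a non-atomic probability measure supported on $[0,\infty)$ with finite mean. Then for every $x\in G$ the maximal level sizes of the geodesic trees have infinite expectation: \[ \widehat{\mathbf E}\big[w(\widehat T(x))\big]=\overline{\mathbf E}\big[w(\overline T(x))\big]=\infty . \]
   Context: Cayley graph: vertices are the group elements, and $x,y$ are neighbors iff $y=xs$ for some $s$ in a fixed finite symmetric generating set not containing the identity. $\mathbb Z_+=\{0,1,2,\dots\}$. Directed graph $\widehat G$: vertex set $G\times\mathbb Z_+$; there is a directed edge from $(y,n+1)$ to $(x,n)$ for every $n\ge 0$ and every pair of neighbors $x,y$ in $G$; no other edges. Paths in $\widehat G$ are directed. Undirected graph $\overline G$: vertex set $G\times\mathbb Z_+$; $(x,m)$ and $(y,n)$ are joined by an edge iff either $x,y$ are neighbors in $G$ and $m=n\ge 1$, or $x=y$ and $|m-n|=1$. (There are no edges inside level $0$.) $G$ is identified with level $0$, i.e. with $\{(x,0):x\in G\}$. The edges of $\widehat G$ (resp. $\overline G$) carry i.i.d. weights $\omega(e)$ with law $\mu$; the product measure is $\widehat{\mathbf P}$ (resp. $\overline{\mathbf P}$), with expectation $\widehat{\mathbf E}$ (resp. $\overline{\mathbf E}$). For a (directed, in the case of $\widehat G$) path $\gamma$ put $\lambda(\gamma)=\sum_{e\in\gamma}\omega(e)$; the passage time $d_\omega(u,v)$ is the infimum of $\lambda(\gamma)$ over paths $\gamma$ from $u$ to $v$ ($\infty$ if there is none), and $d_\omega(u,G)=\inf_{x\in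 G}d_\omega(u,(x,0))$. Since $\mu$ has no atoms, almost surely each vertex $u$ has a unique path (geodesic) to $G$ with weight $d_\omega(u,G)$. For $x\in G$, the tree $T(x)$ ($\widehat T(x)$ in $\widehat G$, $\overline T(x)$ in $\overline G$) is the union of all geodesics from vertices $u$ to $G$ that end at $(x,0)$. For a set of vertices $S\subset G\times\mathbb Z_+$: $w_n(S)=|S\cap G_n|$ with $G_n=G\times\{n\}$, and $w(S)=\max_{n\ge0}w_n(S)$. *)

theory Defs
  imports "HOL-Probability.Probability" "HOL-Algebra.Generated_Groups"
begin

subsection \<open>First-passage percolation on a graph\<close>

text \<open>
  A graph is given by a vertex set \<open>V\<close>, an edge set \<open>E\<close> and a labelling \<open>l\<close> that names
  the edge traversed when stepping from \<open>u\<close> to \<open>v\<close>; the step is allowed iff \<open>l u v \<in> E\<close>.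
  Directed graphs use \<open>l u v = (u, v)\<close>, undirected graphs use \<open>l u v = {u, v}\<close>.
  Paths are lists of pairwise distinct vertices; a single vertex is a path without edges.
\<close>

definition fpp_path :: "'v set \<Rightarrow> 'e set \<Rightarrow> ('v \<Rightarrow> 'v \<Rightarrow> 'e) \<Rightarrow> 'v list \<Rightarrow> bool" where
  "fpp_path V E l p \<longleftrightarrow>
     p \<noteq> [] \<and> set p \<subseteq> V \<and> distinct p \<and> successively (\<lambda>u v. l u v \<in> E) p"

definition path_weight :: "('v \<Rightarrow> 'v \<Rightarrow> 'e) \<Rightarrow> ('e \<Rightarrow> real) \<Rightarrow> 'v list \<Rightarrow> real" where
  "path_weight l \<omega> p = sum_list (map2 (\<lambda>u v. \<omega> (l u v)) (butlast p) (tl p))"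

text \<open>Passage times are \<open>\<infinity>\<close> if there is no path, as the infimum of the empty set.\<close>

definition passage_time ::
    "'v set \<Rightarrow> 'e set \<Rightarrow> ('v \<Rightarrow> 'v \<Rightarrow> 'e) \<Rightarrow> ('e \<Rightarrow> real) \<Rightarrow> 'v \<Rightarrow> 'v \<Rightarrow> ereal" where
  "passage_time V E l \<omega> u v =
     (INF p\<in>{p. fpp_path V E l p \<and> hd p = u \<and> last p = v}. ereal (path_weight l \<omega> p))"

definition passage_time_to ::
    "'v set \<Rightarrow> 'e set \<Rightarrow> ('v \<Rightarrow> 'v \<Rightarrow> 'e) \<Rightarrow> ('e \<Rightarrow> real) \<Rightarrow> 'v \<Rightarrow> 'v set \<Rightarrow> ereal" where
  "passage_time_to V E l \<omega> u A = (INF a\<in>A. passage_time V E l \<omega> u a)"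

definition geodesic_to ::
    "'v set \<Rightarrow> 'e set \<Rightarrow> ('v \<Rightarrow> 'v \<Rightarrow> 'e) \<Rightarrow> ('e \<Rightarrow> real) \<Rightarrow> 'v set \<Rightarrow> 'v list \<Rightarrow> bool" where
  "geodesic_to V E l \<omega> A p \<longleftrightarrow>
     fpp_path V E l p \<and> last p \<in> A \<and>
     ereal (path_weight l \<omega> p) = passage_time_to V E l \<omega> (hd p) A"

text \<open>
  The vertex set of the union of all geodesics to \<open>A\<close> ending at \<open>r\<close>. It is defined for every
  \<open>\<omega>\<close>; existence and uniqueness of geodesics, which hold almost surely, are not built in.
\<close>

definition geodesic_tree ::
    "'v set \<Rightarrow> 'e set \<Rightarrow> ('v \<Rightarrow> 'v \<Rightarrow> 'e) \<Rightarrow> ('e \<Rightarrow> real) \<Rightarrow> 'v set \<Rightarrow> 'v \<Rightarrow> 'v set" where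
  "geodesic_tree V E l \<omega> A r = \<Union>{set p | p. geodesic_to V E l \<omega> A p \<and> last p = r}"


subsection \<open>The Cayley graph and the graphs over it\<close>

definition symmetric_generating_set :: "('a, 'b) monoid_scheme \<Rightarrow> 'a set \<Rightarrow> bool" where
  "symmetric_generating_set G S \<longleftrightarrow>
     finite S \<and> S \<subseteq> carrier G \<and> (\<forall>s\<in>S. inv\<^bsub>G\<^esub> s \<in> S) \<and> \<one>\<^bsub>G\<^esub> \<notin> S \<and> generate G S = carrier G"

definition cayley_nbr :: "('a, 'b) monoid_scheme \<Rightarrow> 'a set \<Rightarrow> 'a \<Rightarrow> 'a \<Rightarrow> bool" where
  "cayley_nbr G S x y \<longleftrightarrow> x \<in> carrier G \<and> y \<in> carrier G \<and> (\<exists>s\<in>S. y = x \<otimes>\<^bsub>G\<^esub> s)"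

definition level :: "('a, 'b) monoid_scheme \<Rightarrow> nat \<Rightarrow> ('a \<times> nat) set" where
  "level G n = carrier G \<times> {n}"

definition level_vertices :: "('a, 'b) monoid_scheme \<Rightarrow> ('a \<times> nat) set" where
  "level_vertices G = carrier G \<times> UNIV"

definition hat_edges ::
    "('a, 'b) monoid_scheme \<Rightarrow> 'a set \<Rightarrow> (('a \<times> nat) \<times> ('a \<times> nat)) set" where
  "hat_edges G S = {((y, n + 1), (x, n)) | x y n. cayley_nbr G S x y}"

definition bar_edges :: "('a, 'b) monoid_scheme \<Rightarrow> 'a set \<Rightarrow> ('a \<times> nat) set set" where
  "bar_edges G S = {{(x, m), (y, n)} | x y m n. x \<in> carrier G \<and> y \<in> carrier G \<and>
     (cayley_nbr G S x y \<and> m = n \<and> n \<ge> 1 \<or> x = y \<and> \<bar>int m - int n\<bar> = 1)}"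

definition hat_measure ::
    "('a, 'b) monoid_scheme \<Rightarrow> 'a set \<Rightarrow> real measure \<Rightarrow>
     (('a \<times> nat) \<times> ('a \<times> nat) \<Rightarrow> real) measure" where
  "hat_measure G S \<mu> = Pi\<^sub>M (hat_edges G S) (\<lambda>_. \<mu>)"

definition bar_measure ::
    "('a, 'b) monoid_scheme \<Rightarrow> 'a set \<Rightarrow> real measure \<Rightarrow> (('a \<times> nat) set \<Rightarrow> real) measure" where
  "bar_measure G S \<mu> = Pi\<^sub>M (bar_edges G S) (\<lambda>_. \<mu>)"

definition hat_tree ::
    "('a, 'b) monoid_scheme \<Rightarrow> 'a set \<Rightarrow> (('a \<times> nat) \<times> ('a \<times> nat) \<Rightarrow> real) \<Rightarrow>
     'a \<Rightarrow> ('a \<times> nat) set" where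
  "hat_tree G S \<omega> x =
     geodesic_tree (level_vertices G) (hat_edges G S) Pair \<omega> (level G 0) (x, 0)"

definition bar_tree ::
    "('a, 'b) monoid_scheme \<Rightarrow> 'a set \<Rightarrow> (('a \<times> nat) set \<Rightarrow> real) \<Rightarrow>
     'a \<Rightarrow> ('a \<times> nat) set" where
  "bar_tree G S \<omega> x =
     geodesic_tree (level_vertices G) (bar_edges G S) (\<lambda>u v. {u, v}) \<omega> (level G 0) (x, 0)"

text \<open>
  Cardinalities are taken in \<open>[0,\<infinity>]\<close> via counting measure, so that an infinite level has
  size \<open>\<infinity>\<close> (not \<open>0\<close>, as with \<^const>\<open>card\<close>); likewise the maximum over all levels is a
  supremum in \<open>[0,\<infinity>]\<close>.
\<close>

definition level_size :: "('a, 'b) monoid_scheme \<Rightarrow> nat \<Rightarrow> ('a \<times> nat) set \<Rightarrow> ennreal" where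
  "level_size G n T = emeasure (count_space UNIV) (T \<inter> level G n)"

definition max_level_size :: "('a, 'b) monoid_scheme \<Rightarrow> ('a \<times> nat) set \<Rightarrow> ennreal" where
  "max_level_size G T = (SUP n. level_size G n T)"

end

theory Submission
  imports Defs
begin

text \<open>
  By invariance under left translations and uniqueness of geodesics, \<open>w\<^sub>n(T(x))\<close> has mean 1 for every
  \<open>n\<close>. So if the maximal level size had finite mean, dominated convergence would exclude that the tree
  \<open>T(x)\<close> is almost surely finite. It remains to see that the tree is almost surely finite, for which
  only mean level sizes at most 1 are needed: if it reaches all levels with probability \<open>\<delta> > 0\<close>, then
  with probability at least \<open>\<delta> / 2\<close> it meets a given level in at most \<open>K\<close> vertices and is
  locally well behaved. Changing boundedly many weights just above that level kills the tree within a bounded number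
  of levels, at the price of a constant factor in probability. But the probability that the tree reaches level
  \<open>n\<close> and then dies within a bounded number of levels tends to 0.

  In the directed graph the weights of the tree edges in \<open>M\<close> consecutive levels are raised. No other
  geodesic is affected, a path through these levels gains at least a constant times \<open>M\<close>, and leaving
  the tree costs a bounded amount because the mean passage times \<open>h\<^sub>n\<close> satisfy
  \<open>h\<^sub>n \<le> h\<^sub>n\<^sub>+\<^sub>J + 1\<close> for infinitely many \<open>n\<close>; this is where the finite mean enters.

  In the undirected graph geodesics may go up and down, so the tree is replaced by that of the graph
  truncated at level \<open>n\<close>, which does not depend on the weights above. Let \<open>A\<close> be its set of
  vertices at level \<open>n\<close>. Edges in the columns over \<open>A\<close> are made heavy, columns next to
  \<open>A\<close> light.
\<close>

subsection \<open>Walks, paths and geodesics\<close>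

text \<open>The edges to be changed depend on the configuration, whereas resampling at a controlled
  cost works only for a fixed finite set of edges. So events are split by the finite set
  \<open>A\<close> in which the tree meets level \<open>n\<close>. The pieces are disjoint, and the
  change preserves \<open>A\<close>, so the estimates for the pieces add up with the same factor. A
  bound \<open>K\<close> for \<open>card A\<close> bounds the number of changed edges, and thereby
  the factor. In the directed graph the raised set is not determined by \<open>A\<close>, only
  confined to a finite cone above \<open>A\<close>; its loss in the union bound is the 2 in
  \<open>q / 2\<close>. A detour needs a way out of the tree. Since the Cayley graph is infinite and
  connected, \<open>2 * K\<close> steps lead from any point to more than \<open>K\<close> points,
  and a path of at most \<open>K\<close> edges leaves any set of \<open>K\<close> points. In the
  directed graph the cost of such a detour is controlled only on average, through the means
  \<open>h\<close>; in the undirected graph light columns are created for it by the change itself.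
  Full and truncated graphs are instances of one locale with the same edge set, hence live on the
  same probability space, and mass transport gives mean level size 1 for all of them.\<close>

definition fpp_walk :: "'v set \<Rightarrow> 'e set \<Rightarrow> ('v \<Rightarrow> 'v \<Rightarrow> 'e) \<Rightarrow> 'v list \<Rightarrow> bool" where
  "fpp_walk V E l p \<longleftrightarrow> p \<noteq> [] \<and> set p \<subseteq> V \<and> successively (\<lambda>u v. l u v \<in> E) p"

definition path_edges :: "('v \<Rightarrow> 'v \<Rightarrow> 'e) \<Rightarrow> 'v list \<Rightarrow> 'e list" where
  "path_edges l p = map2 l (butlast p) (tl p)"

lemma path_edges_simps [simp]:
  "path_edges l [] = []" "path_edges l [u] = []"
  "path_edges l (u # v # p) = l u v # path_edges l (v # p)"
  by (simp_all add: path_edges_def)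

lemma path_weight_edges: "path_weight l \<omega> p = sum_list (map \<omega> (path_edges l p))"
  by (simp add: path_weight_def path_edges_def split_def comp_def)

lemma path_weight_simps [simp]:
  "path_weight l \<omega> [] = 0" "path_weight l \<omega> [u] = 0"
  "path_weight l \<omega> (u # v # p) = \<omega> (l u v) + path_weight l \<omega> (v # p)"
  by (simp_all add: path_weight_edges)

lemma path_edges_append:
  "p \<noteq> [] \<Longrightarrow> q \<noteq> [] \<Longrightarrow>
   path_edges l (p @ q) = path_edges l p @ l (last p) (hd q) # path_edges l q"
proof (induction p)
  case (Cons a p)
  then show ?case by (cases p; cases q) auto
qed simp

lemma path_edges_append': "path_edges l (p @ u # q) = path_edges l (p @ [u]) @ path_edges l (u # q)"
  by (cases "p = []") (simp_all add: path_edges_append)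

lemma path_weight_append:
  "p \<noteq> [] \<Longrightarrow> q \<noteq> [] \<Longrightarrow>
   path_weight l \<omega> (p @ q) = path_weight l \<omega> p + \<omega> (l (last p) (hd q)) + path_weight l \<omega> q"
  by (simp add: path_weight_edges path_edges_append)

lemma length_path_edges: "length (path_edges l p) = length p - 1"
  by (simp add: path_edges_def)

lemma path_edges_in: "successively (\<lambda>u v. l u v \<in> E) p \<Longrightarrow> set (path_edges l p) \<subseteq> E"
  by (induction p rule: induct_list012) auto

lemma path_weight_append':
  "path_weight l \<omega> (p @ u # q) = path_weight l \<omega> (p @ [u]) + path_weight l \<omega> (u # q)"
  by (cases "p = []") (simp_all add: path_weight_append)

lemma fpp_walk_simps:
  "fpp_walk V E l [u] \<longleftrightarrow> u \<in> V"
  "fpp_walk V E l (u # v # p) \<longleftrightarrow> u \<in> V \<and> l u v \<in> E \<and> fpp_walk V E l (v # p)"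
  by (auto simp: fpp_walk_def)

lemma fpp_walk_append:
  "p \<noteq> [] \<Longrightarrow> q \<noteq> [] \<Longrightarrow>
   fpp_walk V E l (p @ q) \<longleftrightarrow> fpp_walk V E l p \<and> l (last p) (hd q) \<in> E \<and> fpp_walk V E l q"
  by (auto simp: fpp_walk_def successively_append_iff)

lemma fpp_walk_append':
  "fpp_walk V E l (p @ u # q) \<longleftrightarrow> fpp_walk V E l (p @ [u]) \<and> fpp_walk V E l (u # q)"
  by (auto simp: fpp_walk_def successively_append_iff)

lemma fpp_path_walk: "fpp_path V E l p \<Longrightarrow> fpp_walk V E l p"
  by (simp add: fpp_path_def fpp_walk_def)

lemma fpp_path_iff_walk: "fpp_path V E l p \<longleftrightarrow> fpp_walk V E l p \<and> distinct p"
  by (auto simp: fpp_path_def fpp_walk_def)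

lemma path_weight_nonneg:
  assumes "\<forall>e\<in>E. 0 \<le> \<omega> e" "fpp_walk V E l p"
  shows "0 \<le> path_weight l \<omega> p"
proof -
  have "set (path_edges l p) \<subseteq> E" using assms(2) by (intro path_edges_in) (simp add: fpp_walk_def)
  then show ?thesis using assms(1) unfolding path_weight_edges by (intro sum_list_nonneg) auto
qed

lemma path_weight_mono:
  assumes "\<forall>e\<in>E. \<omega> e \<le> \<omega>' e" "fpp_walk V E l p"
  shows "path_weight l \<omega> p \<le> path_weight l \<omega>' p"
  unfolding path_weight_edges using assms path_edges_in[of l E p]
  by (intro sum_list_mono) (auto simp: fpp_walk_def)

lemma path_weight_cong:
  assumes "\<And>e. e \<in> set (path_edges l p) \<Longrightarrow> \<omega> e = \<omega>' e"
  shows "path_weight l \<omega> p = path_weight l \<omega>' p"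
  unfolding path_weight_edges using assms by (metis (mono_tags, lifting) map_eq_conv)

lemma path_edgesE:
  assumes "e \<in> set (path_edges l p)"
  obtains p1 u v p2 where "p = p1 @ u # v # p2" "e = l u v"
  using assms
proof (induction p arbitrary: thesis rule: induct_list012)
  case (3 x y zs)
  then consider "e = l x y" | "e \<in> set (path_edges l (y # zs))" by auto
  then show ?case
  proof cases
    case 1 then show ?thesis using 3(3)[of "[]" x y zs] by simp
  next
    case 2
    show ?thesis
      by (rule 3(2)[OF _ 2], rule 3(3)[of "x # _"]) auto
  qed
qed auto

text \<open>Walks can be concatenated, paths cannot. Competitors are therefore built as walks and
  turned into paths here; cutting out a loop does not increase the weight because weights are
  nonnegative.\<close>

lemma loop_erase:
  assumes nn: "\<forall>e\<in>E. 0 \<le> \<omega> e" and w: "fpp_walk V E l p"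
  shows "\<exists>q. fpp_path V E l q \<and> hd q = hd p \<and> last q = last p \<and> set q \<subseteq> set p \<and>
    path_weight l \<omega> q \<le> path_weight l \<omega> p"
  using w
proof (induction p rule: induct_list012)
  case 1 then show ?case by (simp add: fpp_walk_def)
next
  case (2 u)
  then show ?case by (intro exI[of _ "[u]"]) (auto simp: fpp_walk_def fpp_path_def)
next
  case (3 u v p)
  then have uv: "u \<in> V" "l u v \<in> E" and w: "fpp_walk V E l (v # p)"
    by (auto simp: fpp_walk_simps)
  from 3(2)[OF w] obtain q where q: "fpp_path V E l q" "hd q = v" "last q = last (v # p)"
    "set q \<subseteq> set (v # p)" "path_weight l \<omega> q \<le> path_weight l \<omega> (v # p)" by auto
  have q0: "q \<noteq> []" using q(1) by (simp add: fpp_path_def)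
  then obtain q' where q': "q = v # q'" using q(2) by (cases q) auto
  show ?case
  proof (cases "u \<in> set q")
    case False
    then show ?thesis using q uv q0 unfolding q'
      by (intro exI[of _ "u # v # q'"]) (auto simp: fpp_path_def)
  next
    case True
    then obtain a b where ab: "q = a @ u # b" by (meson split_list)
    have "path_weight l \<omega> (u # b) \<le> path_weight l \<omega> q"
      using path_weight_append'[of l \<omega> a u b] path_weight_nonneg[OF nn, where p="a @ [u]"]
        fpp_path_walk[OF q(1)] unfolding ab fpp_walk_append'[of _ _ _ a u b] by auto
    moreover have "fpp_path V E l (u # b)"
      using q(1) unfolding ab fpp_path_iff_walk fpp_walk_append'[of _ _ _ a u b] by auto
    ultimately show ?thesis using q ab bspec[OF nn uv(2)]
      by (intro exI[of _ "u # b"]) auto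
  qed
qed

text \<open>The nested infima range over all paths from the start to \<open>A\<close>. Comparing
  with each competitor separately avoids \<open>ereal\<close> and exhibits the event as a countable
  intersection.\<close>

lemma geodesic_to_iff:
  "geodesic_to V E l \<omega> A p \<longleftrightarrow> fpp_path V E l p \<and> last p \<in> A \<and>
    (\<forall>q. fpp_path V E l q \<and> hd q = hd p \<and> last q \<in> A \<longrightarrow> path_weight l \<omega> p \<le> path_weight l \<omega> q)"
proof -
  have *: "passage_time_to V E l \<omega> u A =
    (INF q\<in>{q. fpp_path V E l q \<and> hd q = u \<and> last q \<in> A}. ereal (path_weight l \<omega> q))" for u
    unfolding passage_time_to_def passage_time_def
    by (intro antisym INF_greatest; force intro!: INF_lower2 INF_lower)
  show ?thesis
    unfolding geodesic_to_def *
  proof (intro conj_cong refl)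
    assume "fpp_path V E l p" "last p \<in> A"
    then show "(ereal (path_weight l \<omega> p) = (INF q\<in>{q. fpp_path V E l q \<and> hd q = hd p \<and> last q \<in> A}.
        ereal (path_weight l \<omega> q))) = (\<forall>q. fpp_path V E l q \<and> hd q = hd p \<and> last q \<in> A \<longrightarrow>
        path_weight l \<omega> p \<le> path_weight l \<omega> q)"
      apply (intro iffI)
       apply (metis (mono_tags, lifting) INF_lower ereal_less_eq(3) mem_Collect_eq)
      apply (intro antisym INF_greatest INF_lower; auto intro: INF_lower)
      done
  qed
qed

lemma geodesic_to_le_walk:
  assumes "\<forall>e\<in>E. 0 \<le> \<omega> e" "geodesic_to V E l \<omega> A p"
    "fpp_walk V E l q" "hd q = hd p" "last q \<in> A"
  shows "path_weight l \<omega> p \<le> path_weight l \<omega> q"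
  using loop_erase[OF assms(1) assms(3)] assms(2,4,5) by (fastforce simp: geodesic_to_iff)

lemma geodesic_to_suffix:
  assumes nn: "\<forall>e\<in>E. 0 \<le> \<omega> e" and g: "geodesic_to V E l \<omega> A (p1 @ p2)" and "p2 \<noteq> []"
  shows "geodesic_to V E l \<omega> A p2"
proof (cases "p1 = []")
  case False
  note ne = False \<open>p2 \<noteq> []\<close>
  have w: "fpp_walk V E l p1" "l (last p1) (hd p2) \<in> E" "fpp_walk V E l p2"
    using g ne by (auto simp: geodesic_to_iff fpp_path_iff_walk fpp_walk_append)
  show ?thesis unfolding geodesic_to_iff
  proof (intro conjI allI impI)
    show "fpp_path V E l p2" "last p2 \<in> A"
      using g ne by (auto simp: geodesic_to_iff fpp_path_iff_walk fpp_walk_append)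
    fix q assume q: "fpp_path V E l q \<and> hd q = hd p2 \<and> last q \<in> A"
    then have "q \<noteq> []" by (simp add: fpp_path_def)
    have "path_weight l \<omega> (p1 @ p2) \<le> path_weight l \<omega> (p1 @ q)"
      using q w ne \<open>q \<noteq> []\<close>
      by (intro geodesic_to_le_walk[OF nn g]) (auto simp: fpp_walk_append fpp_path_iff_walk)
    then show "path_weight l \<omega> p2 \<le> path_weight l \<omega> q"
      using ne \<open>q \<noteq> []\<close> q by (simp add: path_weight_append)
  qed
qed (use g in simp)

text \<open>Cut and paste: putting \<open>t\<close> in place of \<open>s\<close> keeps both ends,
  and the weights of the remaining pieces cancel.\<close>

lemma geodesic_to_segment:
  assumes nn: "\<forall>e\<in>E. 0 \<le> \<omega> e" and g: "geodesic_to V E l \<omega> A (p1 @ s @ p2)" and "s \<noteq> []"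
    and t: "fpp_walk V E l t" "hd t = hd s" "last t = last s"
  shows "path_weight l \<omega> s \<le> path_weight l \<omega> t"
proof -
  have g2: "geodesic_to V E l \<omega> A (s @ p2)" using geodesic_to_suffix[OF nn g] \<open>s \<noteq> []\<close> by simp
  have "t \<noteq> []" using t by (simp add: fpp_walk_def)
  show ?thesis
  proof (cases "p2 = []")
    case True
    then show ?thesis using geodesic_to_le_walk[OF nn g2 t(1)] t g2 by (simp add: geodesic_to_iff)
  next
    case False
    have "path_weight l \<omega> (s @ p2) \<le> path_weight l \<omega> (t @ p2)"
      using False \<open>s \<noteq> []\<close> \<open>t \<noteq> []\<close> t g2
      by (intro geodesic_to_le_walk[OF nn g2]) (auto simp: fpp_walk_append geodesic_to_iff fpp_path_iff_walk)
    then show ?thesis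
      using False \<open>s \<noteq> []\<close> \<open>t \<noteq> []\<close> t by (simp add: path_weight_append)
  qed
qed

text \<open>Suffixes of geodesics are geodesics, so a vertex on a geodesic is the start of another
  one with the same end.\<close>

lemma geodesic_tree_iff:
  assumes nn: "\<forall>e\<in>E. 0 \<le> \<omega> e"
  shows "u \<in> geodesic_tree V E l \<omega> A r \<longleftrightarrow> (\<exists>p. geodesic_to V E l \<omega> A p \<and> hd p = u \<and> last p = r)"
proof
  assume "u \<in> geodesic_tree V E l \<omega> A r"
  then obtain p where p: "geodesic_to V E l \<omega> A p" "last p = r" "u \<in> set p"
    by (auto simp: geodesic_tree_def)
  then obtain a b where "p = a @ u # b" by (meson split_list)
  then show "\<exists>p. geodesic_to V E l \<omega> A p \<and> hd p = u \<and> last p = r"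
    using geodesic_to_suffix[OF nn, where ?p1.0=a and ?p2.0="u # b"] p by (intro exI[of _ "u # b"]) auto
next
  assume "\<exists>p. geodesic_to V E l \<omega> A p \<and> hd p = u \<and> last p = r"
  then obtain p where p: "geodesic_to V E l \<omega> A p" "hd p = u" "last p = r" by blast
  then have "u \<in> set p" by (auto simp: geodesic_to_iff fpp_path_def)
  with p show "u \<in> geodesic_tree V E l \<omega> A r" by (auto simp: geodesic_tree_def)
qed

lemma geodesic_tree_walkI:
  assumes nn: "\<forall>e\<in>E. 0 \<le> \<omega> e"
    and p: "fpp_walk V E l p" "hd p = u" "last p = r" "r \<in> A"
    and min: "\<And>q. fpp_path V E l q \<Longrightarrow> hd q = u \<Longrightarrow> last q \<in> A \<Longrightarrow> path_weight l \<omega> p \<le> path_weight l \<omega> q"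
  shows "u \<in> geodesic_tree V E l \<omega> A r"
  unfolding geodesic_tree_iff[OF nn]
proof -
  obtain q where "fpp_path V E l q" "hd q = hd p" "last q = last p"
    and le: "path_weight l \<omega> q \<le> path_weight l \<omega> p"
    using loop_erase[OF nn p(1)] by blast
  with p have q: "fpp_path V E l q" "hd q = u" "last q = r" by simp_all
  have "geodesic_to V E l \<omega> A q"
    unfolding geodesic_to_iff
  proof (intro conjI allI impI)
    fix t assume "fpp_path V E l t \<and> hd t = hd q \<and> last t \<in> A"
    then show "path_weight l \<omega> q \<le> path_weight l \<omega> t" using le min[of t] q by simp
  qed (use q p in auto)
  with q show "\<exists>p. geodesic_to V E l \<omega> A p \<and> hd p = u \<and> last p = r" by blast
qed

lemma geodesic_in_tree:
  assumes "geodesic_to V E l \<omega> A p"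
  shows "set p \<subseteq> geodesic_tree V E l \<omega> A (last p)"
  using assms by (auto simp: geodesic_tree_def)

text \<open>Rerouting at \<open>v\<close>: the tail of \<open>p\<close> after \<open>v\<close> is
  replaced by a geodesic from \<open>v\<close> to \<open>r\<close>, which is at most as
  heavy.\<close>

lemma geodesic_meets_tree:
  assumes nn: "\<forall>e\<in>E. 0 \<le> \<omega> e" and g: "geodesic_to V E l \<omega> A p"
    and v: "v \<in> set p" "v \<in> geodesic_tree V E l \<omega> A r"
  shows "hd p \<in> geodesic_tree V E l \<omega> A r"
proof -
  obtain a b where ab: "p = a @ v # b" using v by (meson split_list)
  obtain q where q: "geodesic_to V E l \<omega> A q" "hd q = v" "last q = r"
    using v(2) geodesic_tree_iff[of E \<omega> v V l A r] nn by blast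
  have gb: "geodesic_to V E l \<omega> A (v # b)"
    using geodesic_to_suffix[OF nn, where ?p1.0=a and ?p2.0="v # b"] g ab by auto
  obtain q' where q': "q = v # q'" using q by (cases q) (auto simp: geodesic_to_iff fpp_path_def)
  have wp: "fpp_walk V E l (a @ v # b)" "fpp_walk V E l (v # q')"
    using g q q' ab by (auto simp: geodesic_to_iff fpp_path_iff_walk)
  have le: "path_weight l \<omega> (v # q') \<le> path_weight l \<omega> (v # b)"
    using gb q q' by (auto simp: geodesic_to_iff)
  show ?thesis
  proof (rule geodesic_tree_walkI[OF nn])
    show "fpp_walk V E l (a @ q)" using wp q'
      unfolding q' fpp_walk_append'[of _ _ _ a v b] fpp_walk_append'[of _ _ _ a v q'] by auto
    show "hd (a @ q) = hd p" using ab q' by (cases a) auto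
    show "last (a @ q) = r" "r \<in> A" using q q' by (auto simp: geodesic_to_iff)
    fix t assume "fpp_path V E l t" "hd t = hd p" "last t \<in> A"
    then have "path_weight l \<omega> p \<le> path_weight l \<omega> t" using g by (auto simp: geodesic_to_iff)
    moreover have "path_weight l \<omega> (a @ q) \<le> path_weight l \<omega> p"
      using le unfolding ab q' path_weight_append'[of _ _ a v b] path_weight_append'[of _ _ a v q'] by simp
    ultimately show "path_weight l \<omega> (a @ q) \<le> path_weight l \<omega> t" by simp
  qed
qed

text \<open>Geodesics from vertices outside the tree avoid it, so they keep their weight.\<close>

lemma geodesic_tree_raise:
  assumes nn: "\<forall>e\<in>E. 0 \<le> \<omega> e"
    and le: "\<forall>e\<in>E. \<omega> e \<le> \<omega>' e"
    and eq: "\<And>u v. l u v \<in> E \<Longrightarrow> u \<notin> geodesic_tree V E l \<omega> A r \<Longrightarrow>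
               v \<notin> geodesic_tree V E l \<omega> A r \<Longrightarrow> \<omega>' (l u v) = \<omega> (l u v)"
    and p: "geodesic_to V E l \<omega> A p" "hd p \<notin> geodesic_tree V E l \<omega> A r"
  shows "path_weight l \<omega>' p = path_weight l \<omega> p" "hd p \<notin> geodesic_tree V E l \<omega>' A r"
proof -
  have nn': "\<forall>e\<in>E. 0 \<le> \<omega>' e" using nn le order_trans by fastforce
  show *: "path_weight l \<omega>' p = path_weight l \<omega> p"
  proof (rule path_weight_cong)
    fix e assume "e \<in> set (path_edges l p)"
    then obtain a u v b where e: "p = a @ u # v # b" "e = l u v" by (rule path_edgesE)
    then have "l u v \<in> E" using p(1) by (auto simp: geodesic_to_iff fpp_path_def successively_append_iff)
    moreover have "u \<notin> geodesic_tree V E l \<omega> A r" "v \<notin> geodesic_tree V E l \<omega> A r"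
      using geodesic_meets_tree[OF nn p(1)] p(2) e by auto
    ultimately show "\<omega>' e = \<omega> e" using eq e by auto
  qed
  show "hd p \<notin> geodesic_tree V E l \<omega>' A r"
  proof
    assume "hd p \<in> geodesic_tree V E l \<omega>' A r"
    then obtain q where q: "geodesic_to V E l \<omega>' A q" "hd q = hd p" "last q = r"
      using geodesic_tree_iff[of E \<omega>' "hd p" V l A r] nn' by blast
    have qp: "fpp_path V E l q" "r \<in> A" using q by (auto simp: geodesic_to_iff)
    \<comment> \<open>Sandwich: raising increased the weight of \<open>q\<close>, yet
      \<open>q\<close> is at most as heavy as \<open>p\<close> afterwards, and \<open>p\<close> kept
      its weight. So \<open>q\<close> was optimal already for \<omega>.\<close>
    have "path_weight l \<omega> q \<le> path_weight l \<omega>' q"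
      using path_weight_mono[OF le fpp_path_walk[OF qp(1)]] .
    also have "\<dots> \<le> path_weight l \<omega>' p" using q p(1) by (auto simp: geodesic_to_iff)
    also have "\<dots> = path_weight l \<omega> p" by (rule *)
    finally have le': "path_weight l \<omega> q \<le> path_weight l \<omega> p" .
    have "hd p \<in> geodesic_tree V E l \<omega> A r"
    proof (rule geodesic_tree_walkI[OF nn fpp_path_walk[OF qp(1)] q(2) q(3) qp(2)])
      fix t assume "fpp_path V E l t" "hd t = hd p" "last t \<in> A"
      then have "path_weight l \<omega> p \<le> path_weight l \<omega> t" using p(1) by (simp add: geodesic_to_iff)
      with le' show "path_weight l \<omega> q \<le> path_weight l \<omega> t" by simp
    qed
    with p(2) show False by simp
  qed
qed

subsection \<open>Independent edge weights\<close>

locale iid_weights =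
  fixes E :: "'e set" and \<mu> :: "real measure"
  assumes countable_E: "countable E"
    and real_distribution: "real_distribution \<mu>"
    and non_atomic: "emeasure \<mu> {a} = 0"
    and nonneg: "AE t in \<mu>. 0 \<le> t"
begin

sublocale mu: real_distribution \<mu> by (rule real_distribution)

sublocale product_prob_space "\<lambda>_. \<mu>" E by unfold_locales

abbreviation (input) \<P> :: "('e \<Rightarrow> real) measure" where "\<P> \<equiv> Pi\<^sub>M E (\<lambda>_. \<mu>)"

lemma space_\<P>: "space \<P> = E \<rightarrow>\<^sub>E UNIV"
  by (simp add: space_PiM)

lemma measurable_weight [measurable (raw)]: "e \<in> E \<Longrightarrow> (\<lambda>\<omega>. \<omega> e) \<in> borel_measurable \<P>"
  using measurable_component_singleton[of e E "\<lambda>_. \<mu>"] by simp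

lemma measurable_mix:
  "(\<lambda>(\<omega>, \<omega>'). \<lambda>e\<in>E. if e \<in> F then \<omega>' e else \<omega> e) \<in> measurable (\<P> \<Otimes>\<^sub>M \<P>) \<P>"
  unfolding split_def
  by (rule measurable_restrict) (auto intro!: measurable_compose[OF measurable_fst] measurable_compose[OF measurable_snd])

text \<open>Coordinates in \<open>F\<close> are taken from an independent copy. On a cylinder over
  \<open>J\<close> the product over \<open>J\<close> factorises into the parts over
  \<open>J - F\<close> and \<open>J \<inter> F\<close>.\<close>

lemma distr_mix:
  "distr (\<P> \<Otimes>\<^sub>M \<P>) \<P> (\<lambda>(\<omega>, \<omega>'). \<lambda>e\<in>E. if e \<in> F then \<omega>' e else \<omega> e) = \<P>"
proof (rule PiM_eq)
  fix J X assume J: "finite J" "J \<subseteq> E" "\<And>j. j \<in> J \<Longrightarrow> X j \<in> sets \<mu>"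
  let ?f = "\<lambda>(\<omega>, \<omega>'). \<lambda>e\<in>E. if e \<in> F then \<omega>' e else \<omega> e"
  let ?emb = "\<lambda>J. prod_emb E (\<lambda>_. \<mu>) J (\<Pi>\<^sub>E j\<in>J. X j)"
  have "?f -` ?emb J \<inter> space (\<P> \<Otimes>\<^sub>M \<P>) = ?emb (J - F) \<times> ?emb (J \<inter> F)"
    using J(2) by (fastforce simp: space_pair_measure space_PiM prod_emb_def PiE_iff extensional_def)
  then have "emeasure (distr (\<P> \<Otimes>\<^sub>M \<P>) \<P> ?f) (?emb J) = emeasure (\<P> \<Otimes>\<^sub>M \<P>) (?emb (J - F) \<times> ?emb (J \<inter> F))"
    using J by (subst emeasure_distr[OF measurable_mix]) (auto intro!: sets_PiM_I)
  also have "\<dots> = emeasure \<P> (?emb (J - F)) * emeasure \<P> (?emb (J \<inter> F))"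
    using J by (intro P.emeasure_pair_measure_Times sets_PiM_I) auto
  also have "\<dots> = (\<Prod>j\<in>J - F. emeasure \<mu> (X j)) * (\<Prod>j\<in>J \<inter> F. emeasure \<mu> (X j))"
    using J by (subst (1 2) emeasure_PiM_emb) auto
  also have "\<dots> = (\<Prod>j\<in>J. emeasure \<mu> (X j))"
    using J prod.Int_Diff[of J "\<lambda>j. emeasure \<mu> (X j)" F] by (simp add: mult.commute)
  finally show "emeasure (distr (\<P> \<Otimes>\<^sub>M \<P>) \<P> ?f) (?emb J) = (\<Prod>j\<in>J. emeasure \<mu> (X j))" .
qed simp

text \<open>Finite energy: if the first of two independent samples lies in \<open>H\<close> and the
  second one has its weights on \<open>F\<close> in the sets \<open>B e\<close>, their mixture lies
  in \<open>K\<close>; and the mixture is again distributed according to the product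
  measure.\<close>

lemma prob_resample:
  assumes [measurable]: "H \<in> sets \<P>" "K \<in> sets \<P>" and F: "finite F" "F \<subseteq> E"
    and B: "\<And>e. e \<in> F \<Longrightarrow> B e \<in> sets borel"
    and HK: "\<And>\<omega> \<omega>'. \<omega> \<in> H \<Longrightarrow> \<omega>' \<in> space \<P> \<Longrightarrow> (\<And>e. e \<in> E - F \<Longrightarrow> \<omega>' e = \<omega> e) \<Longrightarrow>
      (\<And>e. e \<in> F \<Longrightarrow> \<omega>' e \<in> B e) \<Longrightarrow> \<omega>' \<in> K"
  shows "prob H * (\<Prod>e\<in>F. measure \<mu> (B e)) \<le> prob K"
proof -
  let ?f = "\<lambda>(\<omega>, \<omega>'). \<lambda>e\<in>E. if e \<in> F then \<omega>' e else \<omega> e"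
  let ?B = "{\<omega>\<in>space \<P>. \<forall>e\<in>F. \<omega> e \<in> B e}"
  have eB: "emeasure \<P> ?B = (\<Prod>e\<in>F. emeasure \<mu> (B e))"
    using F B by (intro emeasure_PiM_Collect) auto
  have mB: "?B \<in> sets \<P>"
    using F B by (intro sets.sets_Collect_finite_All) (auto intro!: sets_Collect_single')
  have "emeasure \<P> H * emeasure \<P> ?B = emeasure (\<P> \<Otimes>\<^sub>M \<P>) (H \<times> ?B)"
    using mB by (intro P.emeasure_pair_measure_Times[symmetric]) auto
  also have "\<dots> \<le> emeasure (\<P> \<Otimes>\<^sub>M \<P>) (?f -` K \<inter> space (\<P> \<Otimes>\<^sub>M \<P>))"
  proof (rule emeasure_mono)
    show "?f -` K \<inter> space (\<P> \<Otimes>\<^sub>M \<P>) \<in> sets (\<P> \<Otimes>\<^sub>M \<P>)"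
      using measurable_mix[of F] by (rule measurable_sets) simp
    have "?f (\<omega>, \<omega>') \<in> K" if "\<omega> \<in> H" "\<omega>' \<in> ?B" for \<omega> \<omega>'
      by (rule HK[OF that(1)]) (use that F in \<open>auto simp: space_\<P>\<close>)
    then show "H \<times> ?B \<subseteq> ?f -` K \<inter> space (\<P> \<Otimes>\<^sub>M \<P>)"
      using sets.sets_into_space[OF assms(1)] by (auto simp: space_pair_measure)
  qed
  also have "\<dots> = emeasure \<P> K"
    by (subst (3) distr_mix[of F, symmetric]) (simp add: emeasure_distr[OF measurable_mix])
  finally have "ennreal (prob H) * ennreal (\<Prod>e\<in>F. measure \<mu> (B e)) \<le> ennreal (prob K)"
    unfolding eB by (simp add: mu.emeasure_eq_measure P.emeasure_eq_measure prod_ennreal)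
  then show ?thesis
    by (simp add: ennreal_mult[symmetric] prod_nonneg)
qed

lemma prob_resample_bound:
  assumes H: "H \<in> sets \<P>" "K \<in> sets \<P>" and F: "finite F" "F \<subseteq> E" "card F \<le> N"
    and B: "\<And>e. e \<in> F \<Longrightarrow> B e \<in> sets borel" and q: "0 \<le> q" "q \<le> 1" "\<And>e. e \<in> F \<Longrightarrow> q \<le> measure \<mu> (B e)"
    and HK: "\<And>\<omega> \<omega>'. \<omega> \<in> H \<Longrightarrow> \<omega>' \<in> space \<P> \<Longrightarrow> (\<And>e. e \<in> E - F \<Longrightarrow> \<omega>' e = \<omega> e) \<Longrightarrow>
      (\<And>e. e \<in> F \<Longrightarrow> \<omega>' e \<in> B e) \<Longrightarrow> \<omega>' \<in> K"
  shows "prob H * q ^ N \<le> prob K"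
proof -
  have "q ^ N \<le> q ^ card F" using q F by (intro power_decreasing) auto
  also have "\<dots> = (\<Prod>e\<in>F. q)" by simp
  also have "\<dots> \<le> (\<Prod>e\<in>F. measure \<mu> (B e))" using q by (intro prod_mono) auto
  finally have "prob H * q ^ N \<le> prob H * (\<Prod>e\<in>F. measure \<mu> (B e))"
    by (intro mult_left_mono) auto
  also have "\<dots> \<le> prob K" by (rule prob_resample[OF H F(1,2) B]) (use HK in auto)
  finally show ?thesis .
qed

text \<open>Resample the weight of \<open>e\<close> alone: \<open>g\<close> does not notice, so for
  a frozen first sample it is a constant, which a law without atoms avoids. Fubini
  concludes.\<close>

lemma AE_weight_neq:
  assumes e: "e \<in> E" and [measurable]: "g \<in> borel_measurable \<P>"
    and g: "\<And>\<omega> \<omega>'. (\<And>e'. e' \<noteq> e \<Longrightarrow> \<omega> e' = \<omega>' e') \<Longrightarrow> g \<omega> = g \<omega>'"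
  shows "AE \<omega> in \<P>. \<omega> e \<noteq> g \<omega>"
proof -
  let ?f = "\<lambda>(\<omega>, \<omega>'). \<lambda>e'\<in>E. if e' \<in> {e} then \<omega>' e' else \<omega> e'"
  have [measurable]: "(\<lambda>\<omega>. \<omega> e) \<in> borel_measurable \<P>" using e by measurable
  interpret PP: pair_sigma_finite \<P> \<P> by unfold_locales
  have "AE x in \<P> \<Otimes>\<^sub>M \<P>. snd x e \<noteq> g (fst x)"
  proof (rule PP.AE_pair_measure)
    show "{x \<in> space (\<P> \<Otimes>\<^sub>M \<P>). snd x e \<noteq> g (fst x)} \<in> sets (\<P> \<Otimes>\<^sub>M \<P>)" by measurable
    have "AE t in \<mu>. t \<noteq> c" for c
      using non_atomic[of c] by (intro AE_I[of _ _ "{c}"]) auto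
    then have "AE \<omega>' in \<P>. \<omega>' e \<noteq> c" for c by (rule AE_component[OF e])
    then show "AE \<omega> in \<P>. AE \<omega>' in \<P>. snd (\<omega>, \<omega>') e \<noteq> g (fst (\<omega>, \<omega>'))" by simp
  qed
  moreover have "snd x e \<noteq> g (fst x) \<longleftrightarrow> ?f x e \<noteq> g (?f x)" if "x \<in> space (\<P> \<Otimes>\<^sub>M \<P>)" for x
  proof -
    have "g (fst x) = g (?f x)" using that
      by (intro g) (auto simp: space_pair_measure space_PiM PiE_iff extensional_def split: prod.splits)
    then show ?thesis using e by (auto simp: split_def)
  qed
  ultimately have "AE x in \<P> \<Otimes>\<^sub>M \<P>. ?f x e \<noteq> g (?f x)"
    using AE_cong[of "\<P> \<Otimes>\<^sub>M \<P>" "\<lambda>x. snd x e \<noteq> g (fst x)" "\<lambda>x. ?f x e \<noteq> g (?f x)"] by blast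
  moreover have "{\<omega> \<in> space \<P>. \<omega> e \<noteq> g \<omega>} \<in> sets \<P>"
    by (intro borel_measurable_neq measurable_weight e assms(2))
  ultimately have "AE \<omega> in distr (\<P> \<Otimes>\<^sub>M \<P>) \<P> ?f. \<omega> e \<noteq> g \<omega>"
    by (subst AE_distr_iff[OF measurable_mix]) simp_all
  then show ?thesis by (simp only: distr_mix)
qed

lemma AE_pos: "AE \<omega> in \<P>. \<forall>e\<in>E. 0 < \<omega> e"
proof -
  have "AE t in \<mu>. t \<noteq> 0"
    using non_atomic[of 0] by (intro AE_I[of _ _ "{0}"]) auto
  then have "AE t in \<mu>. 0 < t" using nonneg by eventually_elim auto
  then show ?thesis using countable_E by (auto simp: AE_ball_countable intro: AE_component)
qed

lemma nn_integral_prod_weights: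
  assumes F: "finite F" "F \<subseteq> E" and [measurable]: "f \<in> borel_measurable borel"
  shows "(\<integral>\<^sup>+ \<omega>. (\<Prod>e\<in>F. f (\<omega> e)) \<partial>\<P>) = (\<integral>\<^sup>+ t. f t \<partial>\<mu>) ^ card F"
proof -
  have "(\<integral>\<^sup>+ \<omega>. (\<Prod>e\<in>F. f (\<omega> e)) \<partial>\<P>) = (\<integral>\<^sup>+ \<omega>. (\<Prod>e\<in>F. f (restrict \<omega> F e)) \<partial>\<P>)" by simp
  also have "\<dots> = (\<integral>\<^sup>+ \<omega>. (\<Prod>e\<in>F. f (\<omega> e)) \<partial>distr \<P> (Pi\<^sub>M F (\<lambda>_. \<mu>)) (\<lambda>\<omega>. restrict \<omega> F))"
    by (subst nn_integral_distr) (use F in \<open>auto intro!: measurable_restrict_subset borel_measurable_prod_ennreal\<close>)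
  also have "\<dots> = (\<integral>\<^sup>+ \<omega>. (\<Prod>e\<in>F. f (\<omega> e)) \<partial>Pi\<^sub>M F (\<lambda>_. \<mu>))"
    using F by (simp add: distr_PiM_restrict_finite)
  also have "\<dots> = (\<Prod>e\<in>F. \<integral>\<^sup>+ t. f t \<partial>\<mu>)"
    using F by (intro product_nn_integral_prod) auto
  finally show ?thesis by simp
qed

lemma measurable_shift:
  assumes "\<phi> \<in> E \<rightarrow> E"
  shows "(\<lambda>\<omega>. \<lambda>e\<in>E. \<omega> (\<phi> e)) \<in> measurable \<P> \<P>"
  using assms by (intro measurable_restrict measurable_component_singleton) auto

lemma distr_shift:
  assumes "inj_on \<phi> E" "\<phi> \<in> E \<rightarrow> E"
  shows "distr \<P> \<P> (\<lambda>\<omega>. \<lambda>e\<in>E. \<omega> (\<phi> e)) = \<P>"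
  using distr_PiM_reindex[of E "\<lambda>_. \<mu>" \<phi> E] assms mu.prob_space_axioms by simp

end

subsection \<open>Layered graphs over a group\<close>

definition shift_vertex :: "('a, 'b) monoid_scheme \<Rightarrow> 'a \<Rightarrow> 'a \<times> nat \<Rightarrow> 'a \<times> nat" where
  "shift_vertex G g u = (g \<otimes>\<^bsub>G\<^esub> fst u, snd u)"

text \<open>Common frame for all graphs: \<open>l\<close> is an ordered or unordered pair, and
  \<open>edge_eq\<close> is what both have in common. \<open>L\<close> is \<open>UNIV\<close>, or
  \<open>{..n}\<close> for truncated graphs; it restricts the vertices of paths but leaves
  \<open>E\<close> and the measure alone. \<open>ea\<close> is the action of the group on edges, and
  \<Delta> bounds the number of steps available at a vertex.\<close>

locale layered_fpp = iid_weights E \<mu> + group G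
  for E :: "'e set" and \<mu> and G :: "('a, 'b) monoid_scheme" (structure) +
  fixes L :: "nat set" and l :: "'a \<times> nat \<Rightarrow> 'a \<times> nat \<Rightarrow> 'e" and ea :: "'a \<Rightarrow> 'e \<Rightarrow> 'e" and \<Delta> :: nat
  assumes countable_carrier: "countable (carrier G)"
    and zero_L: "0 \<in> L"
    and edge_eq: "\<And>u v u' v'. l u v = l u' v' \<Longrightarrow> {u, v} = {u', v'}"
    and edge_cases: "\<And>e. e \<in> E \<Longrightarrow> \<exists>u v. fst u \<in> carrier G \<and> fst v \<in> carrier G \<and> e = l u v"
    and degree: "\<And>u. finite {v. l u v \<in> E} \<and> card {v. l u v \<in> E} \<le> \<Delta>"
    and degree_pos: "0 < \<Delta>"
    and ea_l: "\<And>g u v. g \<in> carrier G \<Longrightarrow> fst u \<in> carrier G \<Longrightarrow> fst v \<in> carrier G \<Longrightarrow>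
      ea g (l u v) = l (shift_vertex G g u) (shift_vertex G g v)"
    and ea_E: "\<And>g e. g \<in> carrier G \<Longrightarrow> e \<in> E \<Longrightarrow> ea g e \<in> E"
    and reach_level_0: "\<And>u. u \<in> carrier G \<times> L \<Longrightarrow>
      \<exists>p. fpp_walk (carrier G \<times> L) E l p \<and> hd p = u \<and> snd (last p) = 0"
begin

abbreviation V where "V \<equiv> carrier G \<times> L"
abbreviation act where "act \<equiv> shift_vertex G"
abbreviation A0 where "A0 \<equiv> level G 0"
abbreviation tree where "tree \<omega> x \<equiv> geodesic_tree V E l \<omega> A0 (x, 0)"
abbreviation geod where "geod \<omega> p \<equiv> geodesic_to V E l \<omega> A0 p"
abbreviation pw where "pw \<equiv> path_weight l"

lemma act_simps [simp]: "act g (y, n) = (g \<otimes> y, n)" "snd (act g u) = snd u" "fst (act g u) = g \<otimes> fst u"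
  by (auto simp: shift_vertex_def)

lemma inv_cancel [simp]:
  "g \<in> carrier G \<Longrightarrow> a \<in> carrier G \<Longrightarrow> inv g \<otimes> (g \<otimes> a) = a"
  "g \<in> carrier G \<Longrightarrow> a \<in> carrier G \<Longrightarrow> g \<otimes> (inv g \<otimes> a) = a"
  by (simp_all add: m_assoc[symmetric])

lemma act_inv: "g \<in> carrier G \<Longrightarrow> fst u \<in> carrier G \<Longrightarrow> act g (act (inv g) u) = u"
  "g \<in> carrier G \<Longrightarrow> fst u \<in> carrier G \<Longrightarrow> act (inv g) (act g u) = u"
  by (auto simp: shift_vertex_def m_assoc[symmetric])

lemma ea_inv: "g \<in> carrier G \<Longrightarrow> e \<in> E \<Longrightarrow> ea g (ea (inv g) e) = e"
  "g \<in> carrier G \<Longrightarrow> e \<in> E \<Longrightarrow> ea (inv g) (ea g e) = e"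
proof -
  assume g: "g \<in> carrier G" and "e \<in> E"
  then obtain u v where uv: "fst u \<in> carrier G" "fst v \<in> carrier G" "e = l u v"
    using edge_cases by blast
  then show "ea g (ea (inv g) e) = e" "ea (inv g) (ea g e) = e"
    using g by (simp_all add: ea_l act_inv del: act_simps(1))
qed

lemma edge_act: "g \<in> carrier G \<Longrightarrow> fst u \<in> carrier G \<Longrightarrow> fst v \<in> carrier G \<Longrightarrow>
    l (act g u) (act g v) \<in> E \<longleftrightarrow> l u v \<in> E"
  using ea_E[of g "l u v"] ea_E[of "inv g" "l (act g u) (act g v)"] by (auto simp: ea_l act_inv)

lemma edges_distinct: "distinct p \<Longrightarrow> distinct (path_edges l p)"
proof (induction p rule: induct_list012)
  case (3 u v p)
  have "l u v \<notin> set (path_edges l (v # p))"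
  proof
    assume "l u v \<in> set (path_edges l (v # p))"
    then obtain p1 u' v' p2 where "v # p = p1 @ u' # v' # p2" "l u v = l u' v'" by (rule path_edgesE)
    then have "u \<in> set (v # p)" using edge_eq[of u v u' v'] by auto
    with 3 show False by simp
  qed
  with 3 show ?case by simp
qed auto

lemma countable_V: "countable V"
  using countable_carrier by auto

lemma countable_paths: "countable {p. fpp_path V E l p \<and> P p}"
  by (rule countable_subset[OF _ countable_lists[OF countable_V]]) (auto simp: fpp_path_def)

lemma path_edges_E: "fpp_path V E l p \<Longrightarrow> set (path_edges l p) \<subseteq> E"
  by (intro path_edges_in) (simp add: fpp_path_def)

lemma measurable_pw: "set (path_edges l p) \<subseteq> E \<Longrightarrow> (\<lambda>\<omega>. pw \<omega> p) \<in> borel_measurable \<P>"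
proof (induction p rule: induct_list012)
  case (3 u v p)
  then show ?case by (auto intro!: borel_measurable_add measurable_weight)
qed auto

lemma sets_geod: "{\<omega>\<in>space \<P>. geod \<omega> p} \<in> sets \<P>"
proof (cases "fpp_path V E l p \<and> last p \<in> A0")
  case True
  have "{\<omega>\<in>space \<P>. geod \<omega> p} =
    {\<omega>\<in>space \<P>. \<forall>q\<in>{q. fpp_path V E l q \<and> hd q = hd p \<and> last q \<in> A0}. pw \<omega> p \<le> pw \<omega> q}"
    unfolding geodesic_to_iff using True by simp
  also have "\<dots> \<in> sets \<P>"
  proof (rule sets.sets_Collect_countable_All')
    fix q assume "q \<in> {q. fpp_path V E l q \<and> hd q = hd p \<and> last q \<in> A0}"
    then show "{\<omega>\<in>space \<P>. pw \<omega> p \<le> pw \<omega> q} \<in> sets \<P>"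
      using True by (intro borel_measurable_le measurable_pw path_edges_E) auto
  qed (rule countable_paths)
  finally show ?thesis .
qed (auto simp: geodesic_to_iff)

lemma geod_path: "geod \<omega> p \<Longrightarrow> fpp_path V E l p"
  by (simp add: geodesic_to_def)

lemma sets_tree: "{\<omega>\<in>space \<P>. u \<in> tree \<omega> x} \<in> sets \<P>"
proof -
  have "{\<omega>\<in>space \<P>. u \<in> tree \<omega> x} =
     {\<omega>\<in>space \<P>. \<exists>p\<in>{p. fpp_path V E l p \<and> last p = (x, 0) \<and> u \<in> set p}. geod \<omega> p}"
    using geod_path unfolding geodesic_tree_def by blast
  also have "\<dots> \<in> sets \<P>"
    by (rule sets.sets_Collect_countable_Ex'[OF sets_geod countable_paths])
  finally show ?thesis .
qed

lemma tree_V: "u \<in> tree \<omega> x \<Longrightarrow> u \<in> V"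
  by (auto simp: geodesic_tree_def geodesic_to_iff fpp_path_def)

lemma tree_carrier: "u \<in> tree \<omega> x \<Longrightarrow> x \<in> carrier G"
  by (force simp: geodesic_tree_def geodesic_to_iff level_def)

text \<open>Configurations are pulled back along left multiplication: a path weighs in
  \<open>\<tau> g \<omega>\<close> what its translate by \<open>g\<close> weighs in
  \<omega>.\<close>

definition \<tau> :: "'a \<Rightarrow> ('e \<Rightarrow> real) \<Rightarrow> 'e \<Rightarrow> real" where
  "\<tau> g \<omega> = (\<lambda>e\<in>E. \<omega> (ea g e))"

lemma distr_\<tau>: "g \<in> carrier G \<Longrightarrow> distr \<P> \<P> (\<tau> g) = \<P>"
  unfolding \<tau>_def by (rule distr_shift) (auto intro!: inj_on_inverseI[of _ "ea (inv g)"] ea_inv ea_E)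

lemma measurable_\<tau>: "g \<in> carrier G \<Longrightarrow> \<tau> g \<in> measurable \<P> \<P>"
  unfolding \<tau>_def by (rule measurable_shift) (auto intro: ea_E)

lemma walk_act:
  assumes g: "g \<in> carrier G" and "fst ` set p \<subseteq> carrier G"
  shows "fpp_walk V E l (map (act g) p) \<longleftrightarrow> fpp_walk V E l p"
  using assms(2)
proof (induction p rule: induct_list012)
  case (2 u)
  then show ?case using g by (cases u) (auto simp: fpp_walk_simps)
next
  case (3 u v p)
  then show ?case using edge_act[OF g, of u v] g
    by (cases u) (auto simp: fpp_walk_simps)
qed (auto simp: fpp_walk_def)

lemma inj_act: "g \<in> carrier G \<Longrightarrow> inj_on (act g) (carrier G \<times> UNIV)"
  by (intro inj_on_inverseI[of _ "act (inv g)"]) (auto simp: act_inv)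

lemma path_act:
  assumes g: "g \<in> carrier G" and p: "fst ` set p \<subseteq> carrier G"
  shows "fpp_path V E l (map (act g) p) \<longleftrightarrow> fpp_path V E l p"
proof -
  have "inj_on (act g) (set p)" using p by (intro inj_on_subset[OF inj_act[OF g]]) force
  then show ?thesis using walk_act[OF g p] by (auto simp: fpp_path_iff_walk distinct_map)
qed

lemma pw_\<tau>:
  assumes "g \<in> carrier G" "fst ` set p \<subseteq> carrier G" "set (path_edges l p) \<subseteq> E"
  shows "pw (\<tau> g \<omega>) p = pw \<omega> (map (act g) p)"
  using assms by (induction p rule: induct_list012) (auto simp: \<tau>_def ea_l)

lemma geod_\<tau>:
  assumes g: "g \<in> carrier G" and p: "fst ` set p \<subseteq> carrier G"
  shows "geod (\<tau> g \<omega>) p \<longleftrightarrow> geod \<omega> (map (act g) p)"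
proof (cases "fpp_path V E l p \<and> last p \<in> A0")
  case True
  then have ne: "p \<noteq> []" by (auto simp: fpp_path_def)
  have la: "last (map (act g) q) \<in> A0 \<longleftrightarrow> last q \<in> A0" if "fpp_path V E l q" for q
    using that g last_in_set[of q] fpp_path_def[of V E l q] by (cases "last q") (auto simp: level_def last_map)
  have fV: "fst ` set q \<subseteq> carrier G" if "fpp_path V E l q" for q
    using that by (auto simp: fpp_path_def)
  have pwq: "pw (\<tau> g \<omega>) q = pw \<omega> (map (act g) q)" if "fpp_path V E l q" for q
    using that g path_edges_E fV by (intro pw_\<tau>) auto
  have "(\<forall>q. fpp_path V E l q \<and> hd q = hd p \<and> last q \<in> A0 \<longrightarrow> pw (\<tau> g \<omega>) p \<le> pw (\<tau> g \<omega>) q) \<longleftrightarrow>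
    (\<forall>q. fpp_path V E l q \<and> hd q = act g (hd p) \<and> last q \<in> A0 \<longrightarrow> pw (\<tau> g \<omega>) p \<le> pw \<omega> q)" (is "?L \<longleftrightarrow> ?R")
  proof (intro iffI allI impI)
    fix q assume R: ?R and q: "fpp_path V E l q \<and> hd q = hd p \<and> last q \<in> A0"
    then have "q \<noteq> []" by (auto simp: fpp_path_def)
    then show "pw (\<tau> g \<omega>) p \<le> pw (\<tau> g \<omega>) q"
      using R[rule_format, of "map (act g) q"] q la[of q] path_act[OF g fV[of q]] pwq[of q] by (simp add: hd_map)
  next
    fix q assume Lh: ?L and q: "fpp_path V E l q \<and> hd q = act g (hd p) \<and> last q \<in> A0"
    let ?q = "map (act (inv g)) q"
    have "q \<noteq> []" using q by (auto simp: fpp_path_def)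
    have eq: "map (act g) ?q = q"
      using fV[of q] q g by (auto intro!: map_idI simp: act_inv)
    have f': "fst ` set ?q \<subseteq> carrier G" using fV[of q] q g by auto
    have pq: "fpp_path V E l ?q" using path_act[OF g f'] eq q by simp
    have "fst (hd p) \<in> carrier G" using ne p by (cases p) auto
    then have "hd ?q = hd p" using q \<open>q \<noteq> []\<close> g by (simp add: hd_map act_inv)
    moreover have "last ?q \<in> A0" using la[OF pq] eq q by simp
    ultimately show "pw (\<tau> g \<omega>) p \<le> pw \<omega> q"
      using Lh[rule_format, of ?q] pq pwq[OF pq] eq by simp
  qed
  then show ?thesis
    using True la[of p] path_act[OF g p] pwq[of p] ne by (auto simp: geodesic_to_iff hd_map)
next
  case False
  have "fpp_path V E l p \<Longrightarrow> last (map (act g) p) \<in> A0 \<longleftrightarrow> last p \<in> A0"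
    using g last_in_set[of p] fpp_path_def[of V E l p] by (cases "last p") (auto simp: level_def last_map)
  then show ?thesis using False path_act[OF g p] by (auto simp: geodesic_to_iff)
qed

lemma tree_\<tau>:
  assumes g: "g \<in> carrier G" and u: "fst u \<in> carrier G" and x: "x \<in> carrier G"
  shows "u \<in> tree (\<tau> g \<omega>) x \<longleftrightarrow> act g u \<in> tree \<omega> (g \<otimes> x)"
proof
  assume "u \<in> tree (\<tau> g \<omega>) x"
  then obtain p where p: "geod (\<tau> g \<omega>) p" "last p = (x, 0)" "u \<in> set p" by (auto simp: geodesic_tree_def)
  then have f: "fst ` set p \<subseteq> carrier G" "p \<noteq> []" by (auto simp: geodesic_to_iff fpp_path_def)
  have "geod \<omega> (map (act g) p)" "last (map (act g) p) = (g \<otimes> x, 0)" "act g u \<in> set (map (act g) p)"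
    using p f geod_\<tau>[OF g f(1)] by (auto simp: last_map)
  then show "act g u \<in> tree \<omega> (g \<otimes> x)" unfolding geodesic_tree_def by blast
next
  assume "act g u \<in> tree \<omega> (g \<otimes> x)"
  then obtain q where q: "geod \<omega> q" "last q = (g \<otimes> x, 0)" "act g u \<in> set q" by (auto simp: geodesic_tree_def)
  then have f: "fst ` set q \<subseteq> carrier G" "q \<noteq> []" by (auto simp: geodesic_to_iff fpp_path_def)
  define p where "p = map (act (inv g)) q"
  have eq: "map (act g) p = q" using f g unfolding p_def by (auto intro!: map_idI simp: act_inv)
  have fp: "fst ` set p \<subseteq> carrier G" using f g by (auto simp: p_def)
  have "geod (\<tau> g \<omega>) p" using geod_\<tau>[OF g fp] eq q by simp
  moreover have "last p = (x, 0)" using q f g x by (simp add: p_def last_map m_assoc[symmetric])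
  moreover have "u \<in> set p" using imageI[OF q(3), of "act (inv g)"] g u by (simp add: p_def act_inv)
  ultimately show "u \<in> tree (\<tau> g \<omega>) x" unfolding geodesic_tree_def by blast
qed

end

section \<open>Long paths are heavy: existence of geodesics and uniqueness of their end
  points\<close>

context iid_weights
begin

text \<open>Without atoms the distribution function is continuous; it vanishes at 0 and tends to 1,
  so the intermediate value theorem applies.\<close>

lemma cdf_attains:
  assumes "0 < a" "a < 1"
  shows "\<exists>t>0. measure \<mu> {..t} = a"
proof -
  have cont: "isCont (cdf \<mu>) x" for x
    using non_atomic[of x] by (simp add: mu.isCont_cdf measure_def)
  have "AE t in \<mu>. t \<noteq> 0"
    using non_atomic[of 0] by (intro AE_I[of _ _ "{0}"]) auto
  then have "AE t in \<mu>. t \<notin> {..0}" using nonneg by eventually_elim auto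
  then have 0: "cdf \<mu> 0 = 0"
    by (simp add: cdf_def AE_iff_measurable[OF _ refl] measure_def atMost_def) 
  have "eventually (\<lambda>t. a < cdf \<mu> t) at_top"
    using mu.cdf_lim_at_top_prob assms by (intro order_tendstoD) auto
  then obtain N where N: "\<And>t. N \<le> t \<Longrightarrow> a < cdf \<mu> t" by (auto simp: eventually_at_top_linorder)
  have "\<exists>t\<ge>0. t \<le> max 0 N \<and> cdf \<mu> t = a"
    using N[of "max 0 N"] 0 assms cont
    by (intro IVT') (auto simp: continuous_at_imp_continuous_on)
  then obtain t where t: "0 \<le> t" "cdf \<mu> t = a" by blast
  then have "t \<noteq> 0" using 0 assms by auto
  with t show ?thesis by (intro exI[of _ t]) (auto simp: cdf_def)
qed

end

context layered_fpp
begin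

definition kpaths :: "'a \<times> nat \<Rightarrow> nat \<Rightarrow> ('a \<times> nat) list set" where
  "kpaths u k = {p. fpp_path V E l p \<and> hd p = u \<and> length p = Suc k}"

lemma kpaths_card: "finite (kpaths u k) \<and> card (kpaths u k) \<le> \<Delta> ^ k"
proof (induction k arbitrary: u)
  case 0
  have "kpaths u 0 \<subseteq> {[u]}" by (auto simp: kpaths_def length_Suc_conv)
  then show ?case using finite_subset card_mono[of "{[u]}" "kpaths u 0"] by auto
next
  case (Suc k)
  let ?N = "{v. l u v \<in> E}" and ?U = "\<Union>v\<in>{v. l u v \<in> E}. (#) u ` kpaths v k"
  have sub: "kpaths u (Suc k) \<subseteq> ?U"
  proof
    fix p assume "p \<in> kpaths u (Suc k)"
    then obtain v q where "p = u # v # q" "fpp_path V E l (u # v # q)" "length q = k"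
      by (auto simp: kpaths_def length_Suc_conv)
    then have "v \<in> ?N" "v # q \<in> kpaths v k" "hd p = u"
      by (auto simp: kpaths_def fpp_path_def)
    then show "p \<in> ?U" using \<open>p = u # v # q\<close> by blast
  qed
  have fin: "finite ?U" using degree Suc by auto
  have "card ?U \<le> (\<Sum>v\<in>?N. card ((#) u ` kpaths v k))" using degree by (intro card_UN_le) auto
  also have "\<dots> \<le> (\<Sum>v\<in>?N. \<Delta> ^ k)" using Suc by (intro sum_mono order_trans[OF card_image_le]) auto
  also have "\<dots> \<le> \<Delta> * \<Delta> ^ k" using degree by simp
  finally have "card ?U \<le> \<Delta> ^ Suc k" by simp
  then show ?case using fin sub card_mono[OF fin sub] finite_subset by auto
qed

text \<open>\<open>B\<close> will be a set of small measure. For \<open>B = {..\<delta>}\<close> the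
  negation provides \<open>r\<close> edges heavier than \<delta> on every path of \<open>k\<close>
  edges from \<open>u\<close> (existence of geodesics); for \<open>B = {t0<..}\<close> it provides
  \<open>r\<close> edges of weight at most \<open>t0\<close> (edges that can be raised).\<close>

definition few_edges :: "real set \<Rightarrow> nat \<Rightarrow> nat \<Rightarrow> ('e \<Rightarrow> real) \<Rightarrow> 'a \<times> nat \<Rightarrow> bool" where
  "few_edges B r k \<omega> u \<longleftrightarrow> (\<exists>p\<in>kpaths u k. card {e \<in> set (path_edges l p). \<omega> e \<notin> B} < r)"

lemma sets_few_edges:
  assumes [measurable]: "B \<in> sets borel"
  shows "{\<omega>\<in>space \<P>. few_edges B r k \<omega> u} \<in> sets \<P>"
  unfolding few_edges_def
proof (rule sets.sets_Collect_finite_Ex)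
  fix p assume "p \<in> kpaths u k"
  then have p: "set (path_edges l p) \<subseteq> E" by (auto simp: kpaths_def path_edges_E)
  have *: "card {e \<in> set (path_edges l p). \<omega> e \<notin> B} = (\<Sum>e\<in>set (path_edges l p). if \<omega> e \<in> B then 0 else 1)" for \<omega>
    by (simp add: sum.If_cases Int_def conj_commute)
  have m: "{\<omega>\<in>space \<P>. \<omega> e \<in> B} \<in> sets \<P>" if "e \<in> set (path_edges l p)" for e
    using measurable_sets[OF measurable_weight[of e] assms] p that by (auto simp: vimage_def Int_def conj_commute)
  have "(\<lambda>\<omega>. card {e \<in> set (path_edges l p). \<omega> e \<notin> B}) \<in> measurable \<P> (count_space UNIV)"
    unfolding * by (intro measurable_sum_nat measurable_If measurable_const m) auto
  then have "(\<lambda>\<omega>. card {e \<in> set (path_edges l p). \<omega> e \<notin> B}) -` {..<r} \<inter> space \<P> \<in> sets \<P>"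
    by (rule measurable_sets) simp
  then show "{\<omega>\<in>space \<P>. card {e \<in> set (path_edges l p). \<omega> e \<notin> B} < r} \<in> sets \<P>"
    by (simp add: vimage_def Int_def conj_commute)
qed (use kpaths_card in auto)

text \<open>Exponential Markov inequality with the weight \<open>1\<close> for edges in \<open>B\<close> and \<open>\<theta>\<close> for the others.\<close>

lemma prob_few_edges:
  assumes [measurable]: "B \<in> sets borel" and B: "measure \<mu> B \<le> \<theta>" and \<theta>: "0 < \<theta>" "4 * real \<Delta> * \<theta> \<le> 1"
  shows "prob {\<omega>\<in>space \<P>. few_edges B r k \<omega> u} \<le> (1/2) ^ k / \<theta> ^ r"
proof -
  define f where "f t = (if t \<in> B then 1 else ennreal \<theta>)" for t
  have [measurable]: "f \<in> borel_measurable borel" unfolding f_def by measurable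
  \<comment> \<open>There are at most \<open>\<Delta> ^ k\<close> paths and each product has mean at
    most \<open>(2 * \<theta>) ^ k\<close>, so the mean of \<open>Z\<close> is at most
    \<open>(1/2) ^ k\<close>. One path with fewer than \<open>r\<close> edges outside
    \<open>B\<close> already makes \<open>Z\<close> at least \<open>\<theta> ^ r\<close>.\<close>
  define Z where "Z \<omega> = (\<Sum>p\<in>kpaths u k. \<Prod>e\<in>set (path_edges l p). f (\<omega> e))" for \<omega>
  have "1 \<le> 4 * real \<Delta>" using degree_pos by (cases \<Delta>) auto
  then have \<theta>1: "\<theta> \<le> 1"
    using mult_right_mono[of 1 "4 * real \<Delta>" \<theta>] \<theta> by linarith
  have pE: "set (path_edges l p) \<subseteq> E" "card (set (path_edges l p)) = k" if "p \<in> kpaths u k" for p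
    using that edges_distinct[of p] by (auto simp: kpaths_def path_edges_E fpp_path_def distinct_card length_path_edges dest!: path_edges_in)
  have [measurable]: "Z \<in> borel_measurable \<P>"
    unfolding Z_def using pE by (intro borel_measurable_sum borel_measurable_prod_ennreal measurable_compose[OF measurable_weight]) auto
  have "(\<integral>\<^sup>+ t. f t \<partial>\<mu>) \<le> (\<integral>\<^sup>+ t. indicator B t + ennreal \<theta> \<partial>\<mu>)"
    by (intro nn_integral_mono) (auto simp: f_def indicator_def)
  also have "\<dots> = emeasure \<mu> B + ennreal \<theta>"
    by (subst nn_integral_add) (auto simp: mu.emeasure_space_1[unfolded mu.space_eq_univ])
  also have "\<dots> \<le> ennreal (2 * \<theta>)"
    using B \<theta> by (simp add: mu.emeasure_eq_measure ennreal_plus[symmetric] del: ennreal_plus)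
  finally have f: "(\<integral>\<^sup>+ t. f t \<partial>\<mu>) \<le> ennreal (2 * \<theta>)" .
  have "(\<integral>\<^sup>+ \<omega>. Z \<omega> \<partial>\<P>) = (\<Sum>p\<in>kpaths u k. \<integral>\<^sup>+ \<omega>. (\<Prod>e\<in>set (path_edges l p). f (\<omega> e)) \<partial>\<P>)"
    unfolding Z_def using pE by (intro nn_integral_sum borel_measurable_prod_ennreal measurable_compose[OF measurable_weight]) auto
  also have "\<dots> = (\<Sum>p\<in>kpaths u k. (\<integral>\<^sup>+ t. f t \<partial>\<mu>) ^ k)"
    using pE by (intro sum.cong refl) (simp add: nn_integral_prod_weights)
  also have "\<dots> \<le> (\<Sum>p\<in>kpaths u k. ennreal (2 * \<theta>) ^ k)" by (intro sum_mono power_mono f) auto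
  also have "ennreal (2 * \<theta>) ^ k = ennreal ((2 * \<theta>) ^ k)" using \<theta> by (intro ennreal_power) auto
  also have "(\<Sum>p\<in>kpaths u k. ennreal ((2 * \<theta>) ^ k)) = ennreal (real (card (kpaths u k)) * (2 * \<theta>) ^ k)"
    using \<theta> by (simp only: sum_constant ennreal_of_nat_eq_real_of_nat) (intro ennreal_mult[symmetric], auto)
  also have "\<dots> \<le> ennreal (real (\<Delta> ^ k) * (2 * \<theta>) ^ k)"
    using \<theta> kpaths_card[of u k] by (intro ennreal_leI mult_right_mono) (auto simp del: of_nat_power)
  also have "real (\<Delta> ^ k) * (2 * \<theta>) ^ k = (2 * real \<Delta> * \<theta>) ^ k" by (simp add: power_mult_distrib mult_ac)
  also have "ennreal \<dots> \<le> ennreal ((1/2) ^ k)"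
    using \<theta> by (intro ennreal_leI power_mono) auto
  finally have Z: "(\<integral>\<^sup>+ \<omega>. Z \<omega> \<partial>\<P>) \<le> ennreal ((1/2) ^ k)" .
  have "emeasure \<P> {\<omega>\<in>space \<P>. few_edges B r k \<omega> u} \<le> emeasure \<P> {\<omega>\<in>space \<P>. 1 \<le> ennreal (1 / \<theta> ^ r) * Z \<omega>}"
  proof (rule emeasure_mono)
    show "{\<omega>\<in>space \<P>. few_edges B r k \<omega> u} \<subseteq> {\<omega>\<in>space \<P>. 1 \<le> ennreal (1 / \<theta> ^ r) * Z \<omega>}"
    proof safe
      fix \<omega> assume "few_edges B r k \<omega> u"
      then obtain p where p: "p \<in> kpaths u k" and c: "card {e \<in> set (path_edges l p). \<omega> e \<notin> B} < r"
        by (auto simp: few_edges_def)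
      have "ennreal (\<theta> ^ r) \<le> ennreal (\<theta> ^ card {e \<in> set (path_edges l p). \<omega> e \<notin> B})"
        using c \<theta> \<theta>1 by (intro ennreal_leI power_decreasing) auto
      also have "\<dots> = (\<Prod>e\<in>set (path_edges l p). f (\<omega> e))"
        using \<theta> by (simp add: f_def prod.If_cases Int_def conj_commute ennreal_power Collect_neg_eq[symmetric])
      also have "\<dots> \<le> Z \<omega>"
        unfolding Z_def using p kpaths_card[of u k] by (intro member_le_sum) auto
      finally have "ennreal (1 / \<theta> ^ r) * ennreal (\<theta> ^ r) \<le> ennreal (1 / \<theta> ^ r) * Z \<omega>"
        by (intro mult_left_mono) auto
      then show "1 \<le> ennreal (1 / \<theta> ^ r) * Z \<omega>"
        using \<theta> by (simp add: ennreal_mult[symmetric])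
    qed
    show "{\<omega>\<in>space \<P>. 1 \<le> ennreal (1 / \<theta> ^ r) * Z \<omega>} \<in> sets \<P>" by simp
  qed
  also have "\<dots> \<le> ennreal (1 / \<theta> ^ r) * (\<integral>\<^sup>+ \<omega>. Z \<omega> * indicator (space \<P>) \<omega> \<partial>\<P>)"
    by (intro nn_integral_Markov_inequality) auto
  also have "(\<integral>\<^sup>+ \<omega>. Z \<omega> * indicator (space \<P>) \<omega> \<partial>\<P>) = (\<integral>\<^sup>+ \<omega>. Z \<omega> \<partial>\<P>)"
    by (intro nn_integral_cong) auto
  also have "ennreal (1 / \<theta> ^ r) * \<dots> \<le> ennreal (1 / \<theta> ^ r) * ennreal ((1/2) ^ k)"
    by (intro mult_left_mono Z) auto
  also have "\<dots> = ennreal ((1/2) ^ k / \<theta> ^ r)" using \<theta> by (simp add: ennreal_mult[symmetric])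
  finally show ?thesis using \<theta> by (simp add: P.emeasure_eq_measure)
qed

text \<open>For fixed \<open>r\<close> the bound is geometric in \<open>k\<close>, so Borel-Cantelli
  applies; vertices and values of \<open>r\<close> are countably many.\<close>

lemma AE_few_edges:
  assumes "B \<in> sets borel" "measure \<mu> B \<le> \<theta>" "0 < \<theta>" "4 * real \<Delta> * \<theta> \<le> 1"
  shows "AE \<omega> in \<P>. \<forall>u\<in>V. \<forall>r. \<exists>k0. \<forall>k\<ge>k0. \<not> few_edges B r k \<omega> u"
proof -
  have "AE \<omega> in \<P>. \<exists>k0. \<forall>k\<ge>k0. \<not> few_edges B r k \<omega> u" for u r
  proof -
    have "AE \<omega> in \<P>. eventually (\<lambda>k. \<omega> \<in> space \<P> - {\<omega>\<in>space \<P>. few_edges B r k \<omega> u}) sequentially"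
    proof (rule borel_cantelli_AE1)
      show "summable (\<lambda>k. measure \<P> {\<omega>\<in>space \<P>. few_edges B r k \<omega> u})"
      proof (rule summable_comparison_test'[OF summable_divide[OF summable_geometric]])
        show "norm (1 / 2 :: real) < 1" by simp
        show "norm (measure \<P> {\<omega>\<in>space \<P>. few_edges B r k \<omega> u}) \<le> (1/2) ^ k / \<theta> ^ r" if "0 \<le> k" for k
          using prob_few_edges[OF assms, of r k u] by simp
      qed
    next
      show "{\<omega>\<in>space \<P>. few_edges B r k \<omega> u} \<in> sets \<P>" for k
        by (rule sets_few_edges[OF assms(1)])
      show "emeasure \<P> {\<omega>\<in>space \<P>. few_edges B r k \<omega> u} < \<infinity>" for k
        by (simp add: P.emeasure_eq_measure)
    qed
    then show ?thesis by eventually_elim (auto simp: eventually_sequentially)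
  qed
  then have "\<forall>u\<in>V. AE \<omega> in \<P>. \<forall>r. \<exists>k0. \<forall>k\<ge>k0. \<not> few_edges B r k \<omega> u"
    by (auto simp: AE_all_countable)
  then show ?thesis by (simp only: AE_ball_countable[OF countable_V])
qed

lemma pw_sum: "distinct p \<Longrightarrow> pw \<omega> p = (\<Sum>e\<in>set (path_edges l p). \<omega> e)"
  by (simp add: path_weight_edges edges_distinct sum_list_distinct_conv_sum_set)

text \<open>Long paths contain so many edges heavier than \<delta> that they exceed a fixed
  competitor \<open>q0\<close>. The infimum is thus taken over finitely many paths and is
  attained.\<close>

lemma AE_geod_exists: "AE \<omega> in \<P>. \<forall>u\<in>V. \<exists>p. geod \<omega> p \<and> hd p = u"
proof -
  define \<theta> where "\<theta> = 1 / (4 * real \<Delta>)"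
  have \<theta>: "0 < \<theta>" "4 * real \<Delta> * \<theta> \<le> 1" "\<theta> < 1" using degree_pos by (auto simp: \<theta>_def divide_simps)
  then obtain \<delta> where \<delta>: "0 < \<delta>" "measure \<mu> {..\<delta>} = \<theta>" using cdf_attains by blast
  have "AE \<omega> in \<P>. \<forall>u\<in>V. \<forall>r. \<exists>k0. \<forall>k\<ge>k0. \<not> few_edges {..\<delta>} r k \<omega> u"
    using \<theta> \<delta> by (intro AE_few_edges[of _ \<theta>]) auto
  then show ?thesis using AE_pos
  proof eventually_elim
    case (elim \<omega>)
    have nn: "\<forall>e\<in>E. 0 \<le> \<omega> e" using elim(2) by (simp add: less_imp_le)
    show ?case
    proof
      fix u assume u: "u \<in> V"
      obtain p0 where p0: "fpp_walk V E l p0" "hd p0 = u" "snd (last p0) = 0" using reach_level_0[OF u] by blast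
      obtain q0 where q0: "fpp_path V E l q0" "hd q0 = hd p0" "last q0 = last p0"
        using loop_erase[OF nn p0(1)] by blast
      have "last q0 \<in> V" using q0(1) last_in_set[of q0] by (auto simp: fpp_path_def)
      then have lq: "last q0 \<in> A0" using q0(3) p0(3) by (cases "last q0") (auto simp: level_def)
      obtain r :: nat where r: "pw \<omega> q0 / \<delta> < real r" using reals_Archimedean2 by blast
      then have r: "pw \<omega> q0 < real r * \<delta>" using \<delta> by (simp add: divide_simps)
      obtain k0 where k0: "\<And>k. k0 \<le> k \<Longrightarrow> \<not> few_edges {..\<delta>} r k \<omega> u" using elim(1) u by blast
      have long: "pw \<omega> q0 < pw \<omega> q" if q: "fpp_path V E l q" "hd q = u" "k0 < length q" for q
      proof -
        let ?H = "{e \<in> set (path_edges l q). \<omega> e \<notin> {..\<delta>}}"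
        have "q \<in> kpaths u (length q - 1)" using q by (auto simp: kpaths_def)
        then have "r \<le> card ?H" using k0[of "length q - 1"] q by (auto simp: few_edges_def not_less)
        then have "real r * \<delta> \<le> real (card ?H) * \<delta>" using \<delta> by (intro mult_right_mono) auto
        also have "\<dots> = (\<Sum>e\<in>?H. \<delta>)" by simp
        also have "\<dots> \<le> (\<Sum>e\<in>?H. \<omega> e)" by (intro sum_mono) auto
        also have "\<dots> \<le> (\<Sum>e\<in>set (path_edges l q). \<omega> e)"
          using nn path_edges_E[OF q(1)] by (intro sum_mono2) auto
        also have "\<dots> = pw \<omega> q" using q by (simp add: pw_sum fpp_path_def)
        finally show ?thesis using r by simp
      qed
      define Q where "Q = insert q0 {q. fpp_path V E l q \<and> hd q = u \<and> last q \<in> A0 \<and> length q \<le> k0}"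
      have "Q \<subseteq> insert q0 (\<Union>k<k0. kpaths u k)"
      proof
        fix q assume "q \<in> Q"
        then consider "q = q0" | "fpp_path V E l q" "hd q = u" "length q \<le> k0" by (auto simp: Q_def)
        then show "q \<in> insert q0 (\<Union>k<k0. kpaths u k)"
        proof cases
          case 2
          then have "q \<noteq> []" by (auto simp: fpp_path_def)
          then have "q \<in> kpaths u (length q - 1)" "length q - 1 < k0" using 2 by (cases q; auto simp: kpaths_def)+
          then show ?thesis by blast
        qed simp
      qed
      then have fin: "finite Q" by (rule finite_subset) (use kpaths_card in auto)
      define p where "p = arg_min_on (pw \<omega>) Q"
      have p: "p \<in> Q" "\<And>q. q \<in> Q \<Longrightarrow> pw \<omega> p \<le> pw \<omega> q"
        using arg_min_if_finite[OF fin, of "pw \<omega>"] unfolding p_def by (auto simp: Q_def not_less)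
      then have p': "fpp_path V E l p" "hd p = u" "last p \<in> A0" using q0 p0 lq by (auto simp: Q_def)
      have "pw \<omega> p \<le> pw \<omega> q" if q: "fpp_path V E l q" "hd q = u" "last q \<in> A0" for q
      proof (cases "length q \<le> k0")
        case True then show ?thesis using q p(2)[of q] by (auto simp: Q_def)
      next
        case False then show ?thesis using long[OF q(1,2)] p(2)[of q0] by (auto simp: Q_def)
      qed
      then have "geod \<omega> p" unfolding geodesic_to_iff using p' by auto
      with p' show "\<exists>p. geod \<omega> p \<and> hd p = u" by blast
    qed
  qed
qed

text \<open>The last edge of the first path is not used by the second one, and its weight is independent
  of all others.\<close>

lemma AE_paths_neq:
  assumes p: "fpp_path V E l (p @ [z])" "p \<noteq> []" and q: "fpp_path V E l q"
    and z: "z \<in> A0" "z \<notin> set q"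
  shows "AE \<omega> in \<P>. pw \<omega> (p @ [z]) \<noteq> pw \<omega> q"
proof -
  let ?e = "l (last p) z"
  have edges: "path_edges l (p @ [z]) = path_edges l p @ [?e]" using p(2) by (simp add: path_edges_append)
  have e: "?e \<in> E" using path_edges_E[OF p(1)] edges by auto
  have ep: "?e \<notin> set (path_edges l p)"
    using edges_distinct[of "p @ [z]"] p(1) edges by (auto simp: fpp_path_def)
  have eq: "?e \<notin> set (path_edges l q)"
  proof
    assume "?e \<in> set (path_edges l q)"
    then obtain q1 u v q2 where "q = q1 @ u # v # q2" "?e = l u v" by (rule path_edgesE)
    then show False using z edge_eq[of "last p" z u v] by auto
  qed
  let ?g = "\<lambda>\<omega>. pw \<omega> q - pw \<omega> p"
  have "AE \<omega> in \<P>. \<omega> ?e \<noteq> ?g \<omega>"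
  proof (rule AE_weight_neq[OF e])
    show "?g \<in> borel_measurable \<P>"
      using path_edges_E[OF p(1)] path_edges_E[OF q] edges by (intro borel_measurable_diff measurable_pw) auto
    fix \<omega> \<omega>' :: "'e \<Rightarrow> real" assume *: "\<And>e'. e' \<noteq> ?e \<Longrightarrow> \<omega> e' = \<omega>' e'"
    have "pw \<omega> q = pw \<omega>' q" by (rule path_weight_cong, rule *) (use eq in blast)
    moreover have "pw \<omega> p = pw \<omega>' p" by (rule path_weight_cong, rule *) (use ep in blast)
    ultimately show "?g \<omega> = ?g \<omega>'" by simp
  qed
  then show ?thesis
    by eventually_elim (use p(2) in \<open>auto simp: path_weight_append\<close>)
qed

text \<open>Stopping at \<open>v\<close> is already admissible, and with positive weights every
  further edge would be a strict loss.\<close>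

lemma geod_level0_end:
  assumes pos: "\<forall>e\<in>E. 0 < \<omega> e" and g: "geod \<omega> (p @ v # q)" and v: "v \<in> A0"
  shows "q = []"
proof (rule ccontr)
  assume ne: "q \<noteq> []"
  have nn: "\<forall>e\<in>E. 0 \<le> \<omega> e" using pos by (simp add: less_imp_le)
  have w: "fpp_walk V E l (p @ [v])" "fpp_walk V E l (v # q)"
    using g unfolding geodesic_to_iff fpp_path_iff_walk fpp_walk_append'[of _ _ _ p v q] by auto
  have "pw \<omega> (p @ v # q) \<le> pw \<omega> (p @ [v])"
    using w v by (intro geodesic_to_le_walk[OF nn g]) (cases p; auto)+
  then have "pw \<omega> (v # q) \<le> 0" by (simp add: path_weight_append'[of _ _ p v q])
  moreover obtain w' q' where q': "q = w' # q'" using ne by (cases q) auto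
  moreover have "0 \<le> pw \<omega> q" using w(2) by (intro path_weight_nonneg[OF nn, where V=V]) (simp add: q' fpp_walk_simps)
  moreover have "0 < \<omega> (l v w')" using w(2) pos by (simp add: q' fpp_walk_simps)
  ultimately show False by simp
qed

text \<open>Two geodesics from \<open>u\<close> with different ends have equal weight. The second
  one stops at its first visit to level 0, so it misses the end of the first one; for each of the
  countably many such pairs a tie has probability 0.\<close>

lemma AE_tree_unique: "AE \<omega> in \<P>. \<forall>u x y. u \<in> tree \<omega> x \<longrightarrow> u \<in> tree \<omega> y \<longrightarrow> x = y"
proof -
  define PQ where "PQ = {(p, q). fpp_path V E l p \<and> fpp_path V E l q \<and> 2 \<le> length p \<and> last p \<in> A0 \<and> last p \<notin> set q}"
  have "countable PQ"
  proof (rule countable_subset)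
    show "PQ \<subseteq> lists V \<times> lists V" by (auto simp: PQ_def fpp_path_def)
    show "countable (lists V \<times> lists V)" by (intro countable_SIGMA countable_lists countable_V)
  qed
  moreover have "AE \<omega> in \<P>. pw \<omega> (fst z) \<noteq> pw \<omega> (snd z)" if "z \<in> PQ" for z
  proof -
    obtain p q where z: "z = (p, q)" by (cases z)
    have pq: "fpp_path V E l p" "fpp_path V E l q" "2 \<le> length p" "last p \<in> A0" "last p \<notin> set q"
      using that z by (auto simp: PQ_def)
    then have "p \<noteq> []" by auto
    then have p: "butlast p @ [last p] = p" by simp
    have "length (butlast p) \<noteq> 0" using pq(3) by simp
    then have "butlast p \<noteq> []" by blast
    then show ?thesis using p AE_paths_neq[of "butlast p" "last p" q] pq z by auto
  qed
  ultimately have "AE \<omega> in \<P>. \<forall>z\<in>PQ. pw \<omega> (fst z) \<noteq> pw \<omega> (snd z)" by (simp add: AE_ball_countable)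
  then show ?thesis using AE_pos
  proof eventually_elim
    case (elim \<omega>)
    have nn: "\<forall>e\<in>E. 0 \<le> \<omega> e" using elim(2) by (simp add: less_imp_le)
    show ?case
    proof (intro allI impI, rule ccontr)
      fix u x y assume "u \<in> tree \<omega> x" "u \<in> tree \<omega> y" and xy: "x \<noteq> y"
      then obtain p q where p: "geod \<omega> p" "hd p = u" "last p = (x, 0)" and q: "geod \<omega> q" "hd q = u" "last q = (y, 0)"
        unfolding geodesic_tree_iff[OF nn] by blast
      have ne: "p \<noteq> []" "q \<noteq> []" using geod_path[OF p(1)] geod_path[OF q(1)] by (auto simp: fpp_path_def)
      have xA: "(x, 0) \<in> A0" using p by (auto simp: geodesic_to_iff)
      have nq: "(x, 0) \<notin> set q"
      proof
        assume "(x, 0) \<in> set q"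
        then obtain a b where "q = a @ (x, 0) # b" by (meson split_list)
        then show False using geod_level0_end[OF elim(2), of a "(x, 0)" b] q xA xy by auto
      qed
      have "2 \<le> length p"
      proof (rule ccontr)
        assume "\<not> 2 \<le> length p"
        then obtain v where "p = [v]" using ne by (cases p; cases "tl p") auto
        then have "hd q = (x, 0)" using p q by simp
        then show False using nq hd_in_set[OF ne(2)] by simp
      qed
      then have "(p, q) \<in> PQ" using p q xA nq geod_path by (auto simp: PQ_def)
      then have "pw \<omega> p \<noteq> pw \<omega> q" using elim(1) by force
      moreover have "pw \<omega> p \<le> pw \<omega> q" "pw \<omega> q \<le> pw \<omega> p"
        using p q geod_path unfolding geodesic_to_iff by auto
      ultimately show False by simp
    qed
  qed
qed

text \<open>The almost sure properties on which the deterministic arguments rest. Uniqueness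
  concerns the end point of geodesics, which is exactly disjointness of the trees.\<close>

definition good :: "('e \<Rightarrow> real) \<Rightarrow> bool" where
  "good \<omega> \<longleftrightarrow> (\<forall>e\<in>E. 0 < \<omega> e) \<and> (\<forall>u\<in>V. \<exists>p. geod \<omega> p \<and> hd p = u) \<and>
     (\<forall>u x y. u \<in> tree \<omega> x \<longrightarrow> u \<in> tree \<omega> y \<longrightarrow> x = y)"

lemma AE_good: "AE \<omega> in \<P>. good \<omega>"
  using AE_pos AE_geod_exists AE_tree_unique by eventually_elim (simp add: good_def)

lemma good_nonneg: "good \<omega> \<Longrightarrow> \<forall>e\<in>E. 0 \<le> \<omega> e"
  by (simp add: good_def less_imp_le)

lemma good_geod: "good \<omega> \<Longrightarrow> u \<in> V \<Longrightarrow> \<exists>p. geod \<omega> p \<and> hd p = u"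
  unfolding good_def by (elim conjE) (rule bspec)

lemma good_in_tree: "good \<omega> \<Longrightarrow> u \<in> V \<Longrightarrow> \<exists>z\<in>carrier G. u \<in> tree \<omega> z"
proof -
  assume g: "good \<omega>" and u: "u \<in> V"
  from good_geod[OF g u] obtain p where p: "geod \<omega> p" "hd p = u" by blast
  then have "last p \<in> A0" by (simp add: geodesic_to_iff)
  then obtain z where z: "z \<in> carrier G" "last p = (z, 0)" by (auto simp: level_def)
  have "u \<in> tree \<omega> z" using p z by (subst geodesic_tree_iff[OF good_nonneg[OF g]]) auto
  with z show "\<exists>z\<in>carrier G. u \<in> tree \<omega> z" by blast
qed

section \<open>Mass transport and the mean size of a level\<close>

lemma level_size_eq:
  "level_size G n T = (\<integral>\<^sup>+ y. indicator T (y, n) \<partial>count_space (carrier G))"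
proof -
  have bij: "bij_betw (\<lambda>y. (y, n)) (carrier G) (level G n)"
    by (rule bij_betw_imageI) (auto simp: level_def inj_on_def)
  have "(\<integral>\<^sup>+ y. indicator T (y, n) \<partial>count_space (carrier G)) = (\<integral>\<^sup>+ u. indicator T u \<partial>count_space (level G n))"
    using nn_integral_bij_count_space[OF bij, where f = "indicator T"] .
  also have "\<dots> = (\<integral>\<^sup>+ u. indicator (T \<inter> level G n) u \<partial>count_space UNIV)"
    unfolding indicator_inter_arith by (rule nn_integral_count_space_indicator) (simp add: NO_MATCH_def)
  also have "\<dots> = level_size G n T" unfolding level_size_def by (rule nn_integral_indicator) simp
  finally show ?thesis by (rule sym)
qed

text \<open>Translation by \<open>inv y\<close> takes \<open>(y, n)\<close> to
  \<open>(\<one>, n)\<close> and the root \<open>x\<close> to \<open>inv y \<otimes> x\<close>, and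
  this root runs through the whole group bijectively. The invariant property \<open>Q\<close> allows
  counting only selected vertices of the tree.\<close>

lemma mass_transport:
  assumes mQ: "\<And>u. {\<omega>\<in>space \<P>. Q \<omega> u} \<in> sets \<P>"
    and Q: "\<And>g \<omega> u. g \<in> carrier G \<Longrightarrow> \<omega> \<in> space \<P> \<Longrightarrow> u \<in> V \<Longrightarrow> Q (\<tau> g \<omega>) u \<longleftrightarrow> Q \<omega> (act g u)"
    and n: "n \<in> L" and x: "x \<in> carrier G"
  shows "(\<integral>\<^sup>+ \<omega>. \<integral>\<^sup>+ y. indicator {\<omega>\<in>space \<P>. (y, n) \<in> tree \<omega> x \<and> Q \<omega> (y, n)} \<omega> \<partial>count_space (carrier G) \<partial>\<P>) =
    (\<integral>\<^sup>+ \<omega>. \<integral>\<^sup>+ z. indicator {\<omega>\<in>space \<P>. (\<one>, n) \<in> tree \<omega> z \<and> Q \<omega> (\<one>, n)} \<omega> \<partial>count_space (carrier G) \<partial>\<P>)"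
proof -
  define S where "S u x = {\<omega>\<in>space \<P>. u \<in> tree \<omega> x \<and> Q \<omega> u}" for u x
  have S [measurable]: "S u x \<in> sets \<P>" for u x
    unfolding S_def by (intro sets.sets_Collect_conj sets_tree mQ)
  have inv: "emeasure \<P> (S (y, n) x) = emeasure \<P> (S (\<one>, n) (inv y \<otimes> x))" if y: "y \<in> carrier G" for y
  proof -
    have "\<tau> (inv y) \<omega> \<in> S (y, n) x \<longleftrightarrow> \<omega> \<in> S (\<one>, n) (inv y \<otimes> x)" if "\<omega> \<in> space \<P>" for \<omega>
      using measurable_space[OF measurable_\<tau>[of "inv y"] that] y x n that
        tree_\<tau>[of "inv y" "(y, n)" x \<omega>] Q[of "inv y" \<omega> "(y, n)"]
      by (simp add: S_def)
    moreover have "S (\<one>, n) (inv y \<otimes> x) \<subseteq> space \<P>" unfolding S_def by (rule Collect_restrict)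
    ultimately have "\<tau> (inv y) -` S (y, n) x \<inter> space \<P> = S (\<one>, n) (inv y \<otimes> x)" by blast
    then show ?thesis
      using emeasure_distr[OF measurable_\<tau>[of "inv y"] S[of "(y, n)" x]] y by (simp add: distr_\<tau>)
  qed
  have bij: "bij_betw (\<lambda>y. inv y \<otimes> x) (carrier G) (carrier G)"
    using x by (intro bij_betw_byWitness[where f' = "\<lambda>z. x \<otimes> inv z"]) (auto simp: inv_mult_group m_assoc)
  have "(\<integral>\<^sup>+ \<omega>. \<integral>\<^sup>+ y. indicator (S (y, n) x) \<omega> \<partial>count_space (carrier G) \<partial>\<P>) =
      (\<integral>\<^sup>+ y. emeasure \<P> (S (y, n) x) \<partial>count_space (carrier G))"
    by (subst nn_integral_count_space_nn_integral) (auto simp: countable_carrier)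
  also have "\<dots> = (\<integral>\<^sup>+ y. emeasure \<P> (S (\<one>, n) (inv y \<otimes> x)) \<partial>count_space (carrier G))"
    by (intro nn_integral_cong inv) simp
  also have "\<dots> = (\<integral>\<^sup>+ z. emeasure \<P> (S (\<one>, n) z) \<partial>count_space (carrier G))"
    by (rule nn_integral_bij_count_space[OF bij])
  also have "\<dots> = (\<integral>\<^sup>+ \<omega>. \<integral>\<^sup>+ z. indicator (S (\<one>, n) z) \<omega> \<partial>count_space (carrier G) \<partial>\<P>)"
    by (subst nn_integral_count_space_nn_integral) (auto simp: countable_carrier)
  finally show ?thesis by (simp only: S_def)
qed

text \<open>Trees are almost surely disjoint, so the transported sum has at most one nonzero
  term.\<close>

lemma mass_transport_le:
  assumes mQ: "\<And>u. {\<omega>\<in>space \<P>. Q \<omega> u} \<in> sets \<P>"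
    and Q: "\<And>g \<omega> u. g \<in> carrier G \<Longrightarrow> \<omega> \<in> space \<P> \<Longrightarrow> u \<in> V \<Longrightarrow> Q (\<tau> g \<omega>) u \<longleftrightarrow> Q \<omega> (act g u)"
    and n: "n \<in> L" and x: "x \<in> carrier G"
  shows "(\<integral>\<^sup>+ \<omega>. \<integral>\<^sup>+ y. indicator {\<omega>\<in>space \<P>. (y, n) \<in> tree \<omega> x \<and> Q \<omega> (y, n)} \<omega> \<partial>count_space (carrier G) \<partial>\<P>)
     \<le> emeasure \<P> {\<omega>\<in>space \<P>. Q \<omega> (\<one>, n)}"
proof -
  have "AE \<omega> in \<P>. (\<integral>\<^sup>+ z. indicator {\<omega>\<in>space \<P>. (\<one>, n) \<in> tree \<omega> z \<and> Q \<omega> (\<one>, n)} \<omega> \<partial>count_space (carrier G))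
      \<le> indicator {\<omega>\<in>space \<P>. Q \<omega> (\<one>, n)} \<omega>"
    using AE_good
  proof eventually_elim
    case (elim \<omega>)
    then obtain z0 where z0: "\<And>z. (\<one>, n) \<in> tree \<omega> z \<Longrightarrow> z = z0" unfolding good_def by metis
    have "(\<integral>\<^sup>+ z. indicator {\<omega>\<in>space \<P>. (\<one>, n) \<in> tree \<omega> z \<and> Q \<omega> (\<one>, n)} \<omega> \<partial>count_space (carrier G))
       \<le> (\<integral>\<^sup>+ z. indicator {\<omega>\<in>space \<P>. Q \<omega> (\<one>, n)} \<omega> * indicator {z0} z \<partial>count_space UNIV)"
      by (subst nn_integral_count_space_indicator)
         (auto intro!: nn_integral_mono simp: NO_MATCH_def indicator_def dest: z0)
    also have "\<dots> = indicator {\<omega>\<in>space \<P>. Q \<omega> (\<one>, n)} \<omega>"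
      by (simp add: nn_integral_cmult_indicator)
    finally show ?case .
  qed
  then have "(\<integral>\<^sup>+ \<omega>. \<integral>\<^sup>+ z. indicator {\<omega>\<in>space \<P>. (\<one>, n) \<in> tree \<omega> z \<and> Q \<omega> (\<one>, n)} \<omega> \<partial>count_space (carrier G) \<partial>\<P>)
    \<le> (\<integral>\<^sup>+ \<omega>. indicator {\<omega>\<in>space \<P>. Q \<omega> (\<one>, n)} \<omega> \<partial>\<P>)"
    by (rule nn_integral_mono_AE)
  then show ?thesis using mass_transport[OF assms] mQ by simp
qed

text \<open>A union bound over a random set without loss: mass transport bounds the expected number
  of tree vertices at level \<open>n\<close> with property \<open>Q\<close> by the probability of
  \<open>Q\<close> at one vertex. Rare local defects are thus rare on a whole level of the
  tree.\<close>

lemma prob_tree_Q_le: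
  assumes mQ: "\<And>u. {\<omega>\<in>space \<P>. Q \<omega> u} \<in> sets \<P>"
    and Q: "\<And>g \<omega> u. g \<in> carrier G \<Longrightarrow> \<omega> \<in> space \<P> \<Longrightarrow> u \<in> V \<Longrightarrow> Q (\<tau> g \<omega>) u \<longleftrightarrow> Q \<omega> (act g u)"
    and n: "n \<in> L" and x: "x \<in> carrier G"
  shows "prob {\<omega>\<in>space \<P>. \<exists>y\<in>carrier G. (y, n) \<in> tree \<omega> x \<and> Q \<omega> (y, n)} \<le> prob {\<omega>\<in>space \<P>. Q \<omega> (\<one>, n)}"
proof -
  let ?S = "\<lambda>y. {\<omega>\<in>space \<P>. (y, n) \<in> tree \<omega> x \<and> Q \<omega> (y, n)}"
  let ?X = "{\<omega>\<in>space \<P>. \<exists>y\<in>carrier G. (y, n) \<in> tree \<omega> x \<and> Q \<omega> (y, n)}"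
  have X: "?X \<in> sets \<P>"
    by (intro sets.sets_Collect_countable_Ex' sets.sets_Collect_conj sets_tree mQ countable_carrier)
  have "emeasure \<P> ?X = (\<integral>\<^sup>+ \<omega>. indicator ?X \<omega> \<partial>\<P>)" using X by simp
  also have "\<dots> \<le> (\<integral>\<^sup>+ \<omega>. \<integral>\<^sup>+ y. indicator (?S y) \<omega> \<partial>count_space (carrier G) \<partial>\<P>)"
  proof (rule nn_integral_mono)
    fix \<omega>
    show "indicator ?X \<omega> \<le> (\<integral>\<^sup>+ y. indicator (?S y) \<omega> \<partial>count_space (carrier G))"
    proof (cases "\<omega> \<in> ?X")
      case True
      then obtain y where y: "y \<in> carrier G" "\<omega> \<in> ?S y" by auto
      have "1 = (\<integral>\<^sup>+ y'. indicator {y} y' \<partial>count_space (carrier G))" using y by simp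
      also have "\<dots> \<le> (\<integral>\<^sup>+ y. indicator (?S y) \<omega> \<partial>count_space (carrier G))"
        using y by (intro nn_integral_mono) (auto simp: indicator_def)
      finally show ?thesis using True by simp
    qed simp
  qed
  also have "\<dots> \<le> emeasure \<P> {\<omega>\<in>space \<P>. Q \<omega> (\<one>, n)}" by (rule mass_transport_le[OF assms])
  finally show ?thesis by (simp add: P.emeasure_eq_measure)
qed

text \<open>After transport the trees containing \<open>(\<one>, n)\<close> are counted: at least
  one since geodesics exist, at most one since their ends are unique.\<close>

lemma nn_integral_level_size:
  assumes n: "n \<in> L" and x: "x \<in> carrier G"
  shows "(\<integral>\<^sup>+ \<omega>. level_size G n (tree \<omega> x) \<partial>\<P>) = 1"
proof -
  have eq: "(\<integral>\<^sup>+ \<omega>. level_size G n (tree \<omega> x) \<partial>\<P>) =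
     (\<integral>\<^sup>+ \<omega>. \<integral>\<^sup>+ y. indicator {\<omega>\<in>space \<P>. (y, n) \<in> tree \<omega> x \<and> True} \<omega> \<partial>count_space (carrier G) \<partial>\<P>)"
    by (intro nn_integral_cong) (auto simp: level_size_eq indicator_def)
  have "AE \<omega> in \<P>. 1 \<le> (\<integral>\<^sup>+ z. indicator {\<omega>\<in>space \<P>. (\<one>, n) \<in> tree \<omega> z \<and> True} \<omega> \<partial>count_space (carrier G))"
    using AE_good AE_space
  proof eventually_elim
    case (elim \<omega>)
    then obtain z where z: "z \<in> carrier G" "(\<one>, n) \<in> tree \<omega> z" using good_in_tree[of \<omega> "(\<one>, n)"] n by auto
    have "1 = (\<integral>\<^sup>+ z'. indicator {z} z' \<partial>count_space (carrier G))" using z by simp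
    also have "\<dots> \<le> (\<integral>\<^sup>+ z. indicator {\<omega>\<in>space \<P>. (\<one>, n) \<in> tree \<omega> z \<and> True} \<omega> \<partial>count_space (carrier G))"
      using z elim(2) by (intro nn_integral_mono) (auto simp: indicator_def)
    finally show ?case .
  qed
  then have "(\<integral>\<^sup>+ \<omega>. 1 \<partial>\<P>) \<le> (\<integral>\<^sup>+ \<omega>. \<integral>\<^sup>+ z. indicator {\<omega>\<in>space \<P>. (\<one>, n) \<in> tree \<omega> z \<and> True} \<omega> \<partial>count_space (carrier G) \<partial>\<P>)"
    by (rule nn_integral_mono_AE)
  moreover have "(\<integral>\<^sup>+ \<omega>. level_size G n (tree \<omega> x) \<partial>\<P>) \<le> 1"
    unfolding eq using mass_transport_le[of "\<lambda>_ _. True" n x] n x P.emeasure_space_1 by simp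
  ultimately show ?thesis
    unfolding eq using mass_transport[of "\<lambda>_ _. True" n x] n x P.emeasure_space_1 by (intro antisym) auto
qed

lemma measurable_level_size: "(\<lambda>\<omega>. level_size G n (tree \<omega> x)) \<in> borel_measurable \<P>"
proof -
  interpret sigma_finite_measure "count_space (carrier G)"
    by (rule sigma_finite_measure_count_space_countable[OF countable_carrier])
  have "(\<lambda>\<omega>. \<integral>\<^sup>+ y. indicator {\<omega>\<in>space \<P>. (y, n) \<in> tree \<omega> x} \<omega> \<partial>count_space (carrier G)) \<in> borel_measurable \<P>"
  proof (intro borel_measurable_nn_integral)
    have m: "(\<lambda>\<omega>. indicator {\<omega>\<in>space \<P>. (y, n) \<in> tree \<omega> x} \<omega> :: ennreal) \<in> borel_measurable \<P>" for y
      by (intro borel_measurable_indicator sets_tree)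
    have "(\<lambda>z. indicator {\<omega>\<in>space \<P>. (snd z, n) \<in> tree \<omega> x} (fst z) :: ennreal) \<in>
        borel_measurable (\<P> \<Otimes>\<^sub>M count_space (carrier G))"
      by (rule measurable_compose_countable'[where g = snd and I = "carrier G",
            OF measurable_compose[OF measurable_fst m] measurable_snd countable_carrier])
    then show "(\<lambda>(\<omega>, y). indicator {\<omega>\<in>space \<P>. (y, n) \<in> tree \<omega> x} \<omega> :: ennreal) \<in>
        borel_measurable (\<P> \<Otimes>\<^sub>M count_space (carrier G))"
      by (simp only: split_def)
  qed
  also have "?this \<longleftrightarrow> ?thesis"
    by (intro measurable_cong) (simp add: level_size_eq indicator_def cong: nn_integral_cong)
  finally show ?thesis .
qed

lemma prob_level_size_le:
  assumes n: "n \<in> L" and x: "x \<in> carrier G" and K: "0 < K"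
  shows "prob {\<omega>\<in>space \<P>. \<not> level_size G n (tree \<omega> x) \<le> of_nat K} \<le> 1 / real K"
proof -
  have [measurable]: "(\<lambda>\<omega>. level_size G n (tree \<omega> x)) \<in> borel_measurable \<P>" by (rule measurable_level_size)
  have "emeasure \<P> {\<omega>\<in>space \<P>. \<not> level_size G n (tree \<omega> x) \<le> of_nat K} \<le>
    emeasure \<P> {\<omega>\<in>space \<P>. 1 \<le> ennreal (1 / real K) * level_size G n (tree \<omega> x)}"
  proof (rule emeasure_mono)
    show "{\<omega>\<in>space \<P>. \<not> level_size G n (tree \<omega> x) \<le> of_nat K} \<subseteq> {\<omega>\<in>space \<P>. 1 \<le> ennreal (1 / real K) * level_size G n (tree \<omega> x)}"
    proof safe
      fix \<omega> assume "\<not> level_size G n (tree \<omega> x) \<le> of_nat K"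
      then have "ennreal (1 / real K) * of_nat K \<le> ennreal (1 / real K) * level_size G n (tree \<omega> x)"
        by (intro mult_left_mono) auto
      then show "1 \<le> ennreal (1 / real K) * level_size G n (tree \<omega> x)"
        using K by (simp add: ennreal_of_nat_eq_real_of_nat ennreal_mult[symmetric])
    qed
  qed measurable
  also have "\<dots> \<le> ennreal (1 / real K) * (\<integral>\<^sup>+ \<omega>. level_size G n (tree \<omega> x) * indicator (space \<P>) \<omega> \<partial>\<P>)"
    by (intro nn_integral_Markov_inequality) auto
  also have "(\<integral>\<^sup>+ \<omega>. level_size G n (tree \<omega> x) * indicator (space \<P>) \<omega> \<partial>\<P>) = 1"
    unfolding nn_integral_level_size[OF n x, symmetric] by (intro nn_integral_cong) auto
  finally show ?thesis by (simp add: P.emeasure_eq_measure)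
qed

text \<open>Every level of the tree has mean size 1, so a finite mean of the maximum and almost sure
  finiteness of the tree would contradict dominated convergence.\<close>

lemma nn_integral_max_level_size:
  assumes L: "L = UNIV" and x: "x \<in> carrier G"
    and fin: "AE \<omega> in \<P>. \<exists>n0. \<forall>n\<ge>n0. \<forall>y. (y, n) \<notin> tree \<omega> x"
  shows "(\<integral>\<^sup>+ \<omega>. max_level_size G (tree \<omega> x) \<partial>\<P>) = \<infinity>"
proof (rule ccontr)
  assume "(\<integral>\<^sup>+ \<omega>. max_level_size G (tree \<omega> x) \<partial>\<P>) \<noteq> \<infinity>"
  then have lt: "(\<integral>\<^sup>+ \<omega>. max_level_size G (tree \<omega> x) \<partial>\<P>) < \<infinity>" by (simp add: less_top)
  have "(\<lambda>n. \<integral>\<^sup>+ \<omega>. level_size G n (tree \<omega> x) \<partial>\<P>) \<longlonglongrightarrow> (\<integral>\<^sup>+ \<omega>. 0 \<partial>\<P>)"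
  proof (rule nn_integral_dominated_convergence[OF _ _ _ _ lt])
    show "(\<lambda>\<omega>. max_level_size G (tree \<omega> x)) \<in> borel_measurable \<P>"
      unfolding max_level_size_def by (intro borel_measurable_SUP measurable_level_size) auto
    show "AE \<omega> in \<P>. level_size G n (tree \<omega> x) \<le> max_level_size G (tree \<omega> x)" for n
      unfolding max_level_size_def by (intro AE_I2 SUP_upper) simp
    show "AE \<omega> in \<P>. (\<lambda>n. level_size G n (tree \<omega> x)) \<longlonglongrightarrow> 0"
      using fin
    proof eventually_elim
      case (elim \<omega>)
      then obtain n0 where n0: "\<And>n y. n0 \<le> n \<Longrightarrow> (y, n) \<notin> tree \<omega> x" by blast
      have "level_size G n (tree \<omega> x) = 0" if "n0 \<le> n" for n
        using n0[OF that] by (simp add: level_size_eq)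
      then show ?case by (intro tendsto_eventually) (auto simp: eventually_sequentially)
    qed
  qed (auto intro: measurable_level_size)
  then have "(\<lambda>n::nat. 1 :: ennreal) \<longlonglongrightarrow> 0" using nn_integral_level_size[OF _ x] L by simp
  then show False by (simp add: LIMSEQ_const_iff)
qed

end

section \<open>Vanishing probabilities, disjoint decompositions, passage times to level 0\<close>

context iid_weights
begin

lemma prob_tendsto_0:
  assumes X: "\<And>n. X n \<in> sets \<P>" and ev: "AE \<omega> in \<P>. \<exists>n0. \<forall>n\<ge>n0. \<omega> \<notin> X n"
  shows "(\<lambda>n. prob (X n)) \<longlonglongrightarrow> 0"
proof -
  have "(\<lambda>n. \<integral>\<^sup>+ \<omega>. indicator (X n) \<omega> \<partial>\<P>) \<longlonglongrightarrow> (\<integral>\<^sup>+ \<omega>. 0 \<partial>\<P>)"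
  proof (rule nn_integral_dominated_convergence[where w = "\<lambda>_. 1"])
    show "AE \<omega> in \<P>. (\<lambda>n. indicator (X n) \<omega> :: ennreal) \<longlonglongrightarrow> 0"
      using ev
    proof eventually_elim
      case (elim \<omega>)
      then obtain n0 where "\<And>n. n0 \<le> n \<Longrightarrow> \<omega> \<notin> X n" by blast
      then show ?case
        by (intro tendsto_eventually eventually_sequentiallyI[of n0]) (simp add: indicator_def)
    qed
  qed (use X P.emeasure_space_1 in \<open>auto simp: indicator_def\<close>)
  then have "(\<lambda>n. emeasure \<P> (X n)) \<longlonglongrightarrow> 0" using X by simp
  then have "(\<lambda>n. ennreal (prob (X n))) \<longlonglongrightarrow> ennreal 0" by (simp add: P.emeasure_eq_measure)
  then show ?thesis by (subst (asm) tendsto_ennreal_iff) auto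
qed

text \<open>The index will be the set met by the tree at level \<open>n\<close>. Disjointness on
  both sides preserves the factor \<open>c\<close> although there are infinitely many
  indices.\<close>

lemma prob_UN_le:
  assumes I: "countable I" and X: "\<And>i. i \<in> I \<Longrightarrow> X i \<in> sets \<P>" and Y: "\<And>i. i \<in> I \<Longrightarrow> Y i \<in> sets \<P>"
    and d: "disjoint_family_on X I" "disjoint_family_on Y I"
    and c: "0 \<le> c" "\<And>i. i \<in> I \<Longrightarrow> prob (X i) * c \<le> prob (Y i)"
  shows "prob (\<Union>i\<in>I. X i) * c \<le> prob (\<Union>i\<in>I. Y i)"
proof -
  have "emeasure \<P> (\<Union>i\<in>I. X i) * ennreal c = (\<integral>\<^sup>+ i. emeasure \<P> (X i) \<partial>count_space I) * ennreal c"
    using I X d by (subst emeasure_UN_countable) auto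
  also have "\<dots> = (\<integral>\<^sup>+ i. emeasure \<P> (X i) * ennreal c \<partial>count_space I)"
    by (rule nn_integral_multc[symmetric]) simp
  also have "\<dots> \<le> (\<integral>\<^sup>+ i. emeasure \<P> (Y i) \<partial>count_space I)"
    using c by (intro nn_integral_mono) (simp add: P.emeasure_eq_measure ennreal_mult[symmetric])
  also have "\<dots> = emeasure \<P> (\<Union>i\<in>I. Y i)"
    using I Y d by (subst emeasure_UN_countable) auto
  finally show ?thesis using c by (simp add: P.emeasure_eq_measure ennreal_mult[symmetric])
qed

end

text \<open>A discrete intermediate value theorem: levels may rise arbitrarily but fall by at most 1
  per step.\<close>

lemma level_crossing:
  assumes "successively (\<lambda>u v. snd u \<le> Suc (snd v)) p" "p \<noteq> []" "n \<le> snd (hd p)" "snd (last p) \<le> n"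
  shows "\<exists>v\<in>set p. snd v = (n::nat)"
  using assms
proof (induction p rule: induct_list012)
  case (3 u v p)
  show ?case
  proof (cases "snd u = n")
    case False
    then have "\<exists>w\<in>set (v # p). snd w = n" using 3 by (intro "3.IH"(2)) auto
    then show ?thesis by auto
  qed auto
qed auto

context layered_fpp
begin

lemma sets_good: "{\<omega>\<in>space \<P>. good \<omega>} \<in> sets \<P>"
proof -
  have "good \<omega> \<longleftrightarrow> (\<forall>e\<in>E. 0 < \<omega> e) \<and> (\<forall>u\<in>V. \<exists>p\<in>{p. fpp_path V E l p \<and> hd p = u}. geod \<omega> p) \<and>
     (\<forall>u\<in>V. \<forall>x\<in>carrier G. \<forall>y\<in>carrier G. \<not> (u \<in> tree \<omega> x \<and> u \<in> tree \<omega> y \<and> x \<noteq> y))" for \<omega>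
    unfolding good_def using tree_V tree_carrier geod_path by (intro conj_cong refl iffI) (blast)+
  moreover have "{\<omega>\<in>space \<P>. 0 < \<omega> e} \<in> sets \<P>" if "e \<in> E" for e
    by (intro borel_measurable_less measurable_weight that) auto
  ultimately show ?thesis
    using countable_E countable_V countable_carrier countable_paths
    by (simp only:)
      (intro sets.sets_Collect_conj sets.sets_Collect_countable_All' sets.sets_Collect_countable_Ex' sets_geod
        sets.sets_Collect_neg sets_tree sets.sets_Collect_const; assumption?)
qed

definition paths_to_0 :: "'a \<times> nat \<Rightarrow> ('a \<times> nat) list set" where
  "paths_to_0 u = {q. fpp_path V E l q \<and> hd q = u \<and> last q \<in> A0}"

text \<open>The passage time to level 0, in \<open>ennreal\<close> so that its mean always makes
  sense. Negative path weights, which have probability 0, count as 0.\<close>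

definition dn :: "('e \<Rightarrow> real) \<Rightarrow> 'a \<times> nat \<Rightarrow> ennreal" where
  "dn \<omega> u = (INF q\<in>paths_to_0 u. ennreal (pw \<omega> q))"

lemma kpaths_act:
  assumes "g \<in> carrier G" "fst u \<in> carrier G"
  shows "kpaths (act g u) k = map (act g) ` kpaths u k"
proof -
  have *: "map (act h) q \<in> kpaths (act h v) k" if "h \<in> carrier G" "q \<in> kpaths v k" for h q v
  proof -
    have "fst ` set q \<subseteq> carrier G" "q \<noteq> []" using that by (auto simp: kpaths_def fpp_path_def)
    then show ?thesis using that path_act[of h q] by (auto simp: kpaths_def hd_map)
  qed
  show ?thesis
  proof (intro equalityI subsetI)
    fix q assume q: "q \<in> kpaths (act g u) k"
    have "map (act (inv g)) q \<in> kpaths u k" using *[OF _ q, of "inv g"] assms by (simp add: act_inv)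
    moreover have "map (act g) (map (act (inv g)) q) = q"
      using q assms by (auto intro!: map_idI simp: kpaths_def fpp_path_def act_inv)
    ultimately show "q \<in> map (act g) ` kpaths u k" by (metis imageI)
  next
    fix q assume "q \<in> map (act g) ` kpaths u k"
    then show "q \<in> kpaths (act g u) k" using * assms by blast
  qed
qed

lemma paths_to_0_act:
  assumes "g \<in> carrier G" "fst u \<in> carrier G"
  shows "paths_to_0 (act g u) = map (act g) ` paths_to_0 u"
proof -
  have eq: "paths_to_0 v = (\<Union>k. {q \<in> kpaths v k. snd (last q) = 0})" for v
  proof (intro equalityI subsetI)
    fix q assume "q \<in> paths_to_0 v"
    then have "q \<in> kpaths v (length q - 1)" "snd (last q) = 0"
      by (auto simp: paths_to_0_def kpaths_def fpp_path_def level_def)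
    then show "q \<in> (\<Union>k. {q \<in> kpaths v k. snd (last q) = 0})" by blast
  next
    fix q assume "q \<in> (\<Union>k. {q \<in> kpaths v k. snd (last q) = 0})"
    then have q: "fpp_path V E l q" "hd q = v" "snd (last q) = 0" by (auto simp: kpaths_def)
    then have "last q \<in> V" using last_in_set[of q] by (auto simp: fpp_path_def)
    then show "q \<in> paths_to_0 v" using q by (cases "last q") (auto simp: paths_to_0_def level_def)
  qed
  have "{q \<in> map (act g) ` kpaths u k. snd (last q) = 0} = map (act g) ` {q \<in> kpaths u k. snd (last q) = 0}" for k
    by (auto simp: kpaths_def fpp_path_def last_map)
  then show ?thesis unfolding eq kpaths_act[OF assms] by (simp only: image_UN)
qed

lemma dn_\<tau>:
  assumes "g \<in> carrier G" "fst u \<in> carrier G"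
  shows "dn (\<tau> g \<omega>) u = dn \<omega> (act g u)"
proof -
  have "pw (\<tau> g \<omega>) q = pw \<omega> (map (act g) q)" if "q \<in> paths_to_0 u" for q
    using that assms path_edges_E by (intro pw_\<tau>) (auto simp: paths_to_0_def fpp_path_def)
  then show ?thesis unfolding dn_def paths_to_0_act[OF assms] by (simp add: image_image)
qed

lemma measurable_dn: "(\<lambda>\<omega>. dn \<omega> u) \<in> borel_measurable \<P>"
  unfolding dn_def
proof (rule borel_measurable_INF)
  show "countable (paths_to_0 u)" unfolding paths_to_0_def by (rule countable_paths)
  show "(\<lambda>\<omega>. ennreal (pw \<omega> q)) \<in> borel_measurable \<P>" if "q \<in> paths_to_0 u" for q
    using that by (intro measurable_compose[OF measurable_pw measurable_ennreal] path_edges_E) (simp add: paths_to_0_def)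
qed

lemma few_edges_\<tau>:
  assumes g: "g \<in> carrier G" and u: "fst u \<in> carrier G"
  shows "few_edges B r k (\<tau> g \<omega>) u \<longleftrightarrow> few_edges B r k \<omega> (act g u)"
proof -
  have "card {e \<in> set (path_edges l p). \<tau> g \<omega> e \<notin> B} = card {e \<in> set (path_edges l (map (act g) p)). \<omega> e \<notin> B}"
    if "p \<in> kpaths u k" for p
  proof -
    have p: "fpp_path V E l p" "fst ` set p \<subseteq> carrier G" using that by (auto simp: kpaths_def fpp_path_def)
    have "set (path_edges l (map (act g) p)) = ea g ` set (path_edges l p)"
      using p(2) g by (induction p rule: induct_list012) (auto simp: ea_l)
    then have "{e \<in> set (path_edges l (map (act g) p)). \<omega> e \<notin> B} = ea g ` {e \<in> set (path_edges l p). \<tau> g \<omega> e \<notin> B}"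
      using path_edges_E[OF p(1)] by (auto simp: \<tau>_def)
    moreover have "inj_on (ea g) {e \<in> set (path_edges l p). \<tau> g \<omega> e \<notin> B}"
      using path_edges_E[OF p(1)] g by (intro inj_on_inverseI[of _ "ea (inv g)"]) (auto simp: ea_inv)
    ultimately show ?thesis by (simp add: card_image)
  qed
  then show ?thesis unfolding few_edges_def kpaths_act[OF g u] by simp
qed

lemma dn_geod:
  assumes p: "geod \<omega> p" "hd p = u"
  shows "dn \<omega> u = ennreal (pw \<omega> p)"
  unfolding dn_def using p
  by (intro antisym INF_greatest INF_lower ennreal_leI) (auto simp: paths_to_0_def geodesic_to_iff)

lemma prob_tree_few_edges:
  assumes B: "B \<in> sets borel" "measure \<mu> B \<le> \<theta>" "0 < \<theta>" "4 * real \<Delta> * \<theta> \<le> 1"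
    and n: "n \<in> L" and x: "x \<in> carrier G"
  shows "prob {\<omega>\<in>space \<P>. \<exists>y\<in>carrier G. (y, n) \<in> tree \<omega> x \<and> few_edges B r k \<omega> (y, n)} \<le> (1/2) ^ k / \<theta> ^ r"
  using prob_tree_Q_le[of "\<lambda>\<omega> u. few_edges B r k \<omega> u", OF sets_few_edges[OF B(1)] few_edges_\<tau> n x]
    prob_few_edges[OF B, of r k "(\<one>, n)"] by fastforce

lemma level_size_le:
  assumes "level_size G n T \<le> of_nat K"
  shows "finite {y\<in>carrier G. (y, n) \<in> T} \<and> card {y\<in>carrier G. (y, n) \<in> T} \<le> K"
proof -
  have eq: "T \<inter> level G n = (\<lambda>y. (y, n)) ` {y\<in>carrier G. (y, n) \<in> T}" by (auto simp: level_def)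
  have fin: "finite (T \<inter> level G n)"
  proof (rule ccontr)
    assume "infinite (T \<inter> level G n)"
    then have "level_size G n T = \<infinity>" by (simp add: level_size_def)
    then have "(\<infinity> :: ennreal) \<le> of_nat K" using assms by simp
    then show False by (simp add: top_unique)
  qed
  then have "card (T \<inter> level G n) \<le> K" using assms by (simp add: level_size_def)
  moreover have inj: "inj_on (\<lambda>y. (y, n)) {y\<in>carrier G. (y, n) \<in> T}" by (auto simp: inj_on_def)
  ultimately show ?thesis using fin unfolding eq by (auto simp: card_image finite_image_iff)
qed

lemma sets_level_size_le: "{\<omega>\<in>space \<P>. level_size G n (tree \<omega> x) \<le> of_nat K} \<in> sets \<P>"
  by (intro borel_measurable_le measurable_level_size) auto

lemma sets_tree_level_eq: "{\<omega>\<in>space \<P>. {y\<in>carrier G. (y, n) \<in> tree \<omega> x} = A} \<in> sets \<P>"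
proof (cases "A \<subseteq> carrier G")
  case True
  then have "{\<omega>\<in>space \<P>. {y\<in>carrier G. (y, n) \<in> tree \<omega> x} = A} =
     {\<omega>\<in>space \<P>. \<forall>y\<in>carrier G. (y, n) \<in> tree \<omega> x \<longleftrightarrow> y \<in> A}" by blast
  also have "\<dots> = {\<omega>\<in>space \<P>. \<forall>y\<in>carrier G. ((y, n) \<in> tree \<omega> x \<and> y \<in> A) \<or> (\<not> (y, n) \<in> tree \<omega> x \<and> y \<notin> A)}" by blast
  also have "\<dots> \<in> sets \<P>"
    by (intro sets.sets_Collect_countable_All' sets.sets_Collect_conj sets.sets_Collect_disj sets.sets_Collect_neg
       sets_tree countable_carrier sets.sets_Collect_const)
  finally show ?thesis .
next
  case False
  then have "{\<omega>\<in>space \<P>. {y\<in>carrier G. (y, n) \<in> tree \<omega> x} = A} = {}" by blast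
  then show ?thesis by (simp only: sets.empty_sets)
qed

lemma sets_reach: "{\<omega>\<in>space \<P>. \<exists>y\<in>carrier G. (y, n) \<in> tree \<omega> x} \<in> sets \<P>"
  by (intro sets.sets_Collect_countable_Ex' sets_tree countable_carrier)

text \<open>The geodesic from \<open>u\<close> to the root cannot skip level \<open>n\<close>, and
  all its vertices belong to the tree.\<close>

lemma tree_lower:
  assumes step: "\<And>u v. l u v \<in> E \<Longrightarrow> snd u \<le> Suc (snd v)" and u: "u \<in> tree \<omega> x" and n: "n \<le> snd u"
  shows "\<exists>y\<in>carrier G. (y, n) \<in> tree \<omega> x"
proof -
  obtain p where p: "geod \<omega> p" "last p = (x, 0)" "u \<in> set p" using u by (auto simp: geodesic_tree_def)
  then obtain a b where ab: "p = a @ u # b" by (meson split_list)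
  have "successively (\<lambda>u v. l u v \<in> E) (u # b)"
    using geod_path[OF p(1)] unfolding ab fpp_path_def successively_append_iff by simp
  then have "successively (\<lambda>u v. snd u \<le> Suc (snd v)) (u # b)"
    by (rule successively_mono) (use step in auto)
  moreover have "last (u # b) = (x, 0)" using p(2) ab by simp
  ultimately have "\<exists>v\<in>set (u # b). snd v = n" using n by (intro level_crossing) simp_all
  then obtain v where v: "v \<in> set (u # b)" "snd v = n" by blast
  then have "v \<in> tree \<omega> x" using geodesic_in_tree[OF p(1)] p(2) ab by auto
  then show ?thesis using v tree_V[of v \<omega> x] by (cases v) auto
qed

end

subsection \<open>Cayley graphs\<close>

locale cayley_fpp = group G for G :: "('a, 'b) monoid_scheme" (structure) +
  fixes S :: "'a set" and \<mu> :: "real measure"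
  assumes infinite_carrier: "infinite (carrier G)"
    and generating: "symmetric_generating_set G S"
    and real_distribution_mu: "real_distribution \<mu>"
    and non_atomic_mu: "\<And>a. emeasure \<mu> {a} = 0"
    and nonneg_mu: "AE t in \<mu>. 0 \<le> t"
begin

abbreviation nbr where "nbr \<equiv> cayley_nbr G S"

definition nb :: "'a set \<Rightarrow> 'a set" where "nb A = {y. \<exists>x\<in>A. nbr x y}"

lemma generators: "finite S" "S \<subseteq> carrier G" "s \<in> S \<Longrightarrow> inv s \<in> S" "generate G S = carrier G"
  using generating by (auto simp: symmetric_generating_set_def)

lemma nbr_carrier: "nbr x y \<Longrightarrow> x \<in> carrier G" "nbr x y \<Longrightarrow> y \<in> carrier G"
  by (auto simp: cayley_nbr_def)

lemma nbr_sym: "nbr x y \<Longrightarrow> nbr y x"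
  using generators unfolding cayley_nbr_def by (metis inv_closed inv_solve_right' m_assoc r_inv r_one subsetD)

lemma nbr_mult: "g \<in> carrier G \<Longrightarrow> nbr x y \<Longrightarrow> nbr (g \<otimes> x) (g \<otimes> y)"
  using generators(2) unfolding cayley_nbr_def by (auto simp: m_assoc subset_iff)

lemma nbr_set: "x \<in> carrier G \<Longrightarrow> {y. nbr x y} = (\<lambda>s. x \<otimes> s) ` S"
  using generators(2) by (auto simp: cayley_nbr_def)

lemma nbr_finite: "finite {y. nbr x y} \<and> card {y. nbr x y} \<le> card S"
proof (cases "x \<in> carrier G")
  case True
  then show ?thesis using generators(1) by (simp add: nbr_set card_image_le)
qed (auto simp: cayley_nbr_def)

lemma nb_eq: "nb A = (\<Union>x\<in>A. {y. nbr x y})"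
  by (auto simp: nb_def)

lemma nb_finite: "finite A \<Longrightarrow> finite (nb A) \<and> card (nb A) \<le> card S * card A"
proof -
  assume A: "finite A"
  have "card (nb A) \<le> (\<Sum>x\<in>A. card {y. nbr x y})" unfolding nb_eq by (rule card_UN_le[OF A])
  also have "\<dots> \<le> (\<Sum>x\<in>A. card S)" using nbr_finite by (intro sum_mono) auto
  finally show ?thesis using A nbr_finite by (simp add: nb_eq mult.commute)
qed

lemma nb_pow_finite: "finite A \<Longrightarrow> finite ((nb ^^ j) A) \<and> card ((nb ^^ j) A) \<le> card S ^ j * card A"
proof (induction j)
  case (Suc j)
  then have IH: "finite ((nb ^^ j) A)" "card ((nb ^^ j) A) \<le> card S ^ j * card A" by auto
  have "card (nb ((nb ^^ j) A)) \<le> card S * (card S ^ j * card A)"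
    using nb_finite[OF IH(1)] mult_le_mono2[OF IH(2), of "card S"] by linarith
  then show ?case using nb_finite[OF IH(1)] by (simp add: mult.assoc)
qed simp

lemma nb_carrier: "nb A \<subseteq> carrier G"
  by (auto simp: nb_def nbr_carrier)

lemma connected:
  assumes "x \<in> carrier G" "y \<in> carrier G"
  shows "nbr\<^sup>*\<^sup>* x y"
proof -
  have *: "\<forall>x\<in>carrier G. nbr\<^sup>*\<^sup>* x (x \<otimes> g)" if "g \<in> generate G S" for g
    using that
  proof (induction rule: generate.induct)
    case one
    then show ?case by simp
  next
    case (incl h)
    then show ?case using generators by (auto simp: cayley_nbr_def subset_iff intro!: r_into_rtranclp)
  next
    case (inv h)
    then show ?case using generators by (auto simp: cayley_nbr_def subset_iff intro!: r_into_rtranclp)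
  next
    case (eng h1 h2)
    then have "h1 \<in> carrier G" "h2 \<in> carrier G" using generators(4) by auto
    then show ?case using eng.IH by (metis m_assoc m_closed rtranclp_trans)
  qed
  have "nbr\<^sup>*\<^sup>* x (x \<otimes> (inv x \<otimes> y))" using *[of "inv x \<otimes> y"] assms generators(4) by auto
  moreover have "x \<otimes> (inv x \<otimes> y) = y" using assms by (simp add: m_assoc[symmetric])
  ultimately show ?thesis by simp
qed

lemma countable_carrier: "countable (carrier G)"
proof -
  have "carrier G \<subseteq> (\<Union>j. (nb ^^ j) {\<one>})"
  proof
    fix y assume "y \<in> carrier G"
    then have "nbr\<^sup>*\<^sup>* \<one> y" by (simp add: connected)
    then show "y \<in> (\<Union>j. (nb ^^ j) {\<one>})"
    proof (induction rule: rtranclp_induct)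
      case base
      then show ?case by (auto intro!: exI[of _ 0])
    next
      case (step y z)
      then obtain j where "y \<in> (nb ^^ j) {\<one>}" by auto
      then have "z \<in> (nb ^^ Suc j) {\<one>}" using step by (auto simp: nb_def)
      then show ?case by blast
    qed
  qed
  moreover have "countable (\<Union>j. (nb ^^ j) {\<one>})"
    using nb_pow_finite[of "{\<one>}"] by (intro countable_UN) (auto intro: countable_finite)
  ultimately show ?thesis by (rule countable_subset)
qed

text \<open>By connectedness a nonempty set closed under neighbours is the whole group, which is
  infinite.\<close>

lemma not_closed:
  assumes "finite A" "A \<noteq> {}" "A \<subseteq> carrier G"
  shows "\<not> nb A \<subseteq> A"
proof
  assume closed: "nb A \<subseteq> A"
  obtain a where a: "a \<in> A" using assms by blast
  have "carrier G \<subseteq> A"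
  proof
    fix y assume "y \<in> carrier G"
    then have "nbr\<^sup>*\<^sup>* a y" using a assms by (intro connected) auto
    then show "y \<in> A" by (induction rule: rtranclp_induct) (use a closed in \<open>auto simp: nb_def\<close>)
  qed
  then show False using assms infinite_carrier finite_subset by blast
qed

lemma S_nonempty: "S \<noteq> {}"
  using not_closed[of "{\<one>}"] by (auto simp: nb_def cayley_nbr_def)

lemma card_S_pos: "0 < card S"
  using S_nonempty generators(1) by (simp add: card_gt_0_iff)

lemma nb_nb_superset: "A \<subseteq> carrier G \<Longrightarrow> A \<subseteq> nb (nb A)"
proof
  fix a assume "A \<subseteq> carrier G" "a \<in> A"
  moreover obtain s where "s \<in> S" using S_nonempty by blast
  ultimately have "nbr a (a \<otimes> s)" using generators(2) by (auto simp: cayley_nbr_def)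
  then show "a \<in> nb (nb A)" using nbr_sym \<open>a \<in> A\<close> unfolding nb_def by blast
qed

text \<open>Steps are taken in pairs because one step may abandon all current points (bipartite
  case), while going forth and back keeps them. If a pair of steps added nothing,
  \<open>?Y \<union> nb ?Y\<close> would be finite and closed under neighbours.\<close>

lemma card_nb_pow: "y \<in> carrier G \<Longrightarrow> finite ((nb ^^ (2 * j)) {y}) \<and> Suc j \<le> card ((nb ^^ (2 * j)) {y})"
proof (induction j)
  case (Suc j)
  let ?Y = "(nb ^^ (2 * j)) {y}"
  have Y: "finite ?Y" "Suc j \<le> card ?Y" using Suc by auto
  have YG: "?Y \<subseteq> carrier G" using Suc(2) nb_carrier by (cases j) auto
  have sub: "?Y \<subseteq> nb (nb ?Y)" by (rule nb_nb_superset[OF YG])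
  have fin: "finite (nb (nb ?Y))" using nb_finite Y(1) by blast
  have "?Y \<noteq> nb (nb ?Y)"
  proof
    assume eq: "?Y = nb (nb ?Y)"
    have "nb (?Y \<union> nb ?Y) = nb ?Y \<union> nb (nb ?Y)" by (auto simp: nb_def)
    then have "nb (?Y \<union> nb ?Y) \<subseteq> ?Y \<union> nb ?Y" using eq by blast
    moreover have "?Y \<noteq> {}" using Y(2) by force
    moreover have "finite (?Y \<union> nb ?Y)" using Y(1) nb_finite[OF Y(1)] by blast
    moreover have "?Y \<union> nb ?Y \<subseteq> carrier G" using YG nb_carrier by blast
    ultimately show False using not_closed[of "?Y \<union> nb ?Y"] by blast
  qed
  then have "card ?Y < card (nb (nb ?Y))" using sub fin by (intro psubset_card_mono) auto
  then show ?case using fin Y by simp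
qed simp

lemma walk_exists: "nbr\<^sup>*\<^sup>* a z \<Longrightarrow> \<exists>g. g \<noteq> [] \<and> hd g = a \<and> last g = z \<and> successively nbr g"
proof (induction rule: converse_rtranclp_induct)
  case base
  then show ?case by (intro exI[of _ "[z]"]) simp
next
  case (step y y')
  then obtain g where "g \<noteq> []" "hd g = y'" "last g = z" "successively nbr g" by blast
  then show ?case using step by (intro exI[of _ "y # g"]) (auto simp: successively_Cons)
qed

end

subsection \<open>The directed graph\<close>

context cayley_fpp
begin

lemma hat_edge_iff: "(u, v) \<in> hat_edges G S \<longleftrightarrow> snd u = Suc (snd v) \<and> nbr (fst v) (fst u)"
  by (cases u; cases v) (auto simp: hat_edges_def)

lemma countable_hat_edges: "countable (hat_edges G S)"
proof (rule countable_subset)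
  show "hat_edges G S \<subseteq> (carrier G \<times> UNIV) \<times> (carrier G \<times> UNIV)"
    by (auto simp: hat_edges_def nbr_carrier)
qed (intro countable_SIGMA countable_carrier; simp)

sublocale hat: iid_weights "hat_edges G S" \<mu>
  using countable_hat_edges real_distribution_mu non_atomic_mu nonneg_mu by (rule iid_weights.intro)

text \<open>Edges point downwards, so only the neighbours one level below count for the degree bound
  \<open>card S\<close>; a vertex of level 0 has no outgoing edge.\<close>

sublocale hat: layered_fpp "hat_edges G S" \<mu> G UNIV Pair
  "\<lambda>g (u, v). (shift_vertex G g u, shift_vertex G g v)" "card S"
proof unfold_locales
  show "countable (carrier G)" by (rule countable_carrier)
  show "0 < card S" by (rule card_S_pos)
  show "finite {v. (u, v) \<in> hat_edges G S} \<and> card {v. (u, v) \<in> hat_edges G S} \<le> card S" for u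
  proof -
    have "{v. (u, v) \<in> hat_edges G S} \<subseteq> (\<lambda>y. (y, snd u - 1)) ` {y. nbr (fst u) y}"
    proof
      fix v assume "v \<in> {v. (u, v) \<in> hat_edges G S}"
      then have v: "snd u = Suc (snd v)" "nbr (fst v) (fst u)" by (simp_all add: hat_edge_iff)
      then show "v \<in> (\<lambda>y. (y, snd u - 1)) ` {y. nbr (fst u) y}"
        using nbr_sym[OF v(2)] by (intro image_eqI[of _ _ "fst v"]) auto
    qed
    moreover have fin: "finite ((\<lambda>y. (y, snd u - 1)) ` {y. nbr (fst u) y})" using nbr_finite by blast
    ultimately have "finite {v. (u, v) \<in> hat_edges G S}"
      "card {v. (u, v) \<in> hat_edges G S} \<le> card ((\<lambda>y. (y, snd u - 1)) ` {y. nbr (fst u) y})"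
      by (rule finite_subset, intro card_mono)
    moreover have "card ((\<lambda>y. (y, snd u - 1)) ` {y. nbr (fst u) y}) \<le> card S"
      using nbr_finite[of "fst u"] card_image_le le_trans by blast
    ultimately show ?thesis by linarith
  qed
  show "(case (u, v) of (u, v) \<Rightarrow> (shift_vertex G g u, shift_vertex G g v)) = (shift_vertex G g u, shift_vertex G g v)" for g u v
    by simp
  show "(case e of (u, v) \<Rightarrow> (shift_vertex G g u, shift_vertex G g v)) \<in> hat_edges G S"
    if "g \<in> carrier G" "e \<in> hat_edges G S" for g e
    using that nbr_mult[OF that(1), of "fst (snd e)" "fst (fst e)"]
    by (cases e) (simp add: hat_edge_iff shift_vertex_def)
  show "\<exists>u v. fst u \<in> carrier G \<and> fst v \<in> carrier G \<and> e = (u, v)" if "e \<in> hat_edges G S" for e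
  proof -
    obtain u v where e: "e = (u, v)" by (cases e)
    then have "nbr (fst v) (fst u)" using that by (simp add: hat_edge_iff)
    then show ?thesis using e nbr_carrier by blast
  qed
  show "\<exists>p. fpp_walk (carrier G \<times> UNIV) (hat_edges G S) Pair p \<and> hd p = u \<and> snd (last p) = 0"
    if uV: "u \<in> carrier G \<times> UNIV" for u
  proof -
    obtain y n where u: "u = (y, n)" "y \<in> carrier G" using uV by (cases u) auto
    have "\<exists>p. fpp_walk (carrier G \<times> UNIV) (hat_edges G S) Pair p \<and> hd p = (y, n) \<and> snd (last p) = 0"
      using u(2)
    proof (induction n arbitrary: y)
      case 0
      then show ?case by (intro exI[of _ "[(y, 0)]"]) (simp add: fpp_walk_simps)
    next
      case (Suc n)
      obtain s where "s \<in> S" using S_nonempty by blast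
      then have nb: "nbr y (y \<otimes> s)" using Suc(2) generators(2) by (auto simp: cayley_nbr_def)
      then obtain p where p: "fpp_walk (carrier G \<times> UNIV) (hat_edges G S) Pair p"
         "hd p = (y \<otimes> s, n)" "snd (last p) = 0" using Suc.IH nbr_carrier by blast
      then obtain p' where p': "p = (y \<otimes> s, n) # p'" by (cases p) (auto simp: fpp_walk_def)
      then show ?case using p nb Suc(2) nbr_sym[OF nb]
        by (intro exI[of _ "(y, Suc n) # p"]) (auto simp: fpp_walk_simps hat_edge_iff)
    qed
    then show ?thesis using u by simp
  qed
qed auto

abbreviation hwalk where "hwalk \<equiv> fpp_walk (carrier G \<times> UNIV) (hat_edges G S) Pair"

lemma hwalk_level: "hwalk (a @ v # b) \<Longrightarrow> snd v + length a = snd (hd (a @ v # b))"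
proof (induction a)
  case (Cons u a)
  then have "hwalk (a @ v # b)" "snd u = Suc (snd (hd (a @ v # b)))"
    by (cases a; auto simp: fpp_walk_simps hat_edge_iff)+
  then show ?case using Cons.IH by simp
qed simp

lemma hwalk_level_last: "hwalk p \<Longrightarrow> snd (last p) + length p = Suc (snd (hd p))"
proof -
  assume w: "hwalk p"
  then have ne: "p \<noteq> []" by (simp add: fpp_walk_def)
  then have p: "butlast p @ [last p] = p" by simp
  have "snd (last p) + length (butlast p) = snd (hd p)"
    using hwalk_level[of "butlast p" "last p" "[]"] w unfolding p by blast
  then show ?thesis using ne by (cases p) auto
qed

text \<open>Each step lowers the level by exactly 1, so no vertex can recur.\<close>

lemma hwalk_path: "hwalk p \<Longrightarrow> fpp_path (carrier G \<times> UNIV) (hat_edges G S) Pair p"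
proof -
  assume w: "hwalk p"
  have "distinct p"
  proof (rule ccontr)
    assume "\<not> distinct p"
    then obtain a v b c where p: "p = a @ [v] @ b @ [v] @ c" by (auto dest!: not_distinct_decomp)
    have "snd v + length a = snd (hd p)" using hwalk_level[of a v "b @ v # c"] w p by simp
    moreover have "snd v + length (a @ v # b) = snd (hd p)"
      using hwalk_level[of "a @ v # b" v c] w p by simp
    ultimately show False by simp
  qed
  with w show ?thesis by (simp add: fpp_path_iff_walk)
qed

lemma hwalk_edge:
  assumes "hwalk p" "(u, v) \<in> set (path_edges Pair p)"
  shows "u \<in> set p" "v \<in> set p" "snd v < snd (hd p)" "snd (last p) \<le> snd v"
proof -
  obtain a u' v' b where p: "p = a @ u' # v' # b" "(u, v) = (u', v')" using assms(2) by (rule path_edgesE)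
  then show "u \<in> set p" "v \<in> set p" by auto
  have 1: "snd v + length (a @ [u]) = snd (hd p)" using hwalk_level[of "a @ [u]" v b] assms(1) p by simp
  then show "snd v < snd (hd p)" by simp
  have "snd (last p) + length p = Suc (snd (hd p))" by (rule hwalk_level_last[OF assms(1)])
  then show "snd (last p) \<le> snd v" using 1 p by simp
qed

lemma hpath_nb:
  "y \<in> carrier G \<Longrightarrow> z \<in> (nb ^^ j) {y} \<Longrightarrow> \<exists>\<pi>\<in>hat.kpaths (y, k + j) j. last \<pi> = (z, k)"
proof (induction j arbitrary: z k)
  case 0
  then show ?case by (intro bexI[of _ "[(y, k)]"]) (auto simp: hat.kpaths_def fpp_path_def)
next
  case (Suc j)
  then have "z \<in> nb ((nb ^^ j) {y})" by simp
  then obtain w where w: "w \<in> (nb ^^ j) {y}" "nbr w z" unfolding nb_def[of "(nb ^^ j) {y}"] by blast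
  obtain \<pi> where \<pi>: "\<pi> \<in> hat.kpaths (y, Suc k + j) j" "last \<pi> = (w, Suc k)"
    using Suc.IH[OF Suc.prems(1) w(1), of "Suc k"] by blast
  then have ne: "\<pi> \<noteq> []" and hw: "hwalk \<pi>" by (auto simp: hat.kpaths_def fpp_path_iff_walk fpp_walk_def)
  have "hwalk (\<pi> @ [(z, k)])"
    using ne hw \<pi>(2) w(2) nbr_carrier nbr_sym[OF w(2)] by (auto simp: fpp_walk_append fpp_walk_simps hat_edge_iff)
  then have "\<pi> @ [(z, k)] \<in> hat.kpaths (y, k + Suc j) (Suc j)"
    using \<pi> ne hwalk_path by (auto simp: hat.kpaths_def)
  then show ?case by (intro bexI[of _ "\<pi> @ [(z, k)]"]) auto
qed

text \<open>Walks only descend, so geodesics from level \<open>n\<close> or below use only edges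
  whose lower end is below level \<open>n\<close>.\<close>

lemma hat_tree_cong:
  assumes nn: "\<forall>e\<in>hat_edges G S. 0 \<le> \<omega> e" "\<forall>e\<in>hat_edges G S. 0 \<le> \<omega>' e"
    and eq: "\<And>u v. (u, v) \<in> hat_edges G S \<Longrightarrow> snd v < n \<Longrightarrow> \<omega>' (u, v) = \<omega> (u, v)"
    and u: "snd u \<le> n"
  shows "u \<in> hat.tree \<omega>' x \<longleftrightarrow> u \<in> hat.tree \<omega> x"
proof -
  have pw: "path_weight Pair \<omega>' p = path_weight Pair \<omega> p"
    if p: "fpp_path (carrier G \<times> UNIV) (hat_edges G S) Pair p" "hd p = u" for p
  proof (rule path_weight_cong)
    fix e assume e: "e \<in> set (path_edges Pair p)"
    then have "e \<in> hat_edges G S" using hat.path_edges_E[OF p(1)] by blast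
    moreover have "snd (snd e) < n"
      using hwalk_edge(3)[OF fpp_path_walk[OF p(1)], of "fst e" "snd e"] e p(2) u by simp
    ultimately show "\<omega>' e = \<omega> e" using eq[of "fst e" "snd e"] by simp
  qed
  have "hat.geod \<omega>' p \<longleftrightarrow> hat.geod \<omega> p" if "hd p = u" for p
    using pw that by (auto simp: geodesic_to_iff)
  then show ?thesis unfolding geodesic_tree_iff[OF nn(1)] geodesic_tree_iff[OF nn(2)] by blast
qed

text \<open>The first \<open>J\<close> steps of a descent are prescribed by \<pi> and the rest is
  optimal; this is to cost at most \<open>D\<close> more than the optimum, whatever \<pi> is. The
  comparison is written with sums since subtraction in \<open>ennreal\<close> truncates.\<close>

definition hat_bad :: "real \<Rightarrow> nat \<Rightarrow> (('a \<times> nat) \<times> ('a \<times> nat) \<Rightarrow> real) \<Rightarrow> 'a \<times> nat \<Rightarrow> bool" where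
  "hat_bad D J \<omega> u \<longleftrightarrow> (\<exists>\<pi>\<in>hat.kpaths u J.
     hat.dn \<omega> u + ennreal D < ennreal (path_weight Pair \<omega> \<pi>) + hat.dn \<omega> (last \<pi>))"

text \<open>The edges to be raised above \<open>t1\<close>. Both ends lie in the tree, so geodesics
  from outside are not affected; the weight is at most \<open>t0\<close>, so each raise gains at
  least \<open>t1 - t0\<close>.\<close>

definition low_tree_edges :: "(('a \<times> nat) \<times> ('a \<times> nat) \<Rightarrow> real) \<Rightarrow> 'a \<Rightarrow> nat \<Rightarrow> nat \<Rightarrow> real \<Rightarrow>
    (('a \<times> nat) \<times> ('a \<times> nat)) set" where
  "low_tree_edges \<omega> x n M t0 = {(u, v) \<in> hat_edges G S. u \<in> hat.tree \<omega> x \<and> v \<in> hat.tree \<omega> x \<and>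
     n \<le> snd v \<and> snd v < n + M \<and> \<omega> (u, v) \<le> t0}"

text \<open>A geodesic starting outside the tree avoids it and keeps its weight while others only
  get heavier. Hence no vertex can join the tree of \<open>x\<close>.\<close>

lemma hat_raise:
  assumes good: "hat.good \<omega>" and t: "0 \<le> t0" "t0 < t1"
    and F: "F = low_tree_edges \<omega> x n M t0"
    and eq: "\<forall>e\<in>hat_edges G S - F. \<omega>' e = \<omega> e" and raised: "\<forall>e\<in>F. t1 < \<omega>' e"
  shows "\<forall>e\<in>hat_edges G S. \<omega> e \<le> \<omega>' e" "\<forall>e\<in>hat_edges G S. 0 \<le> \<omega>' e"
    "hat.tree \<omega>' x \<subseteq> hat.tree \<omega> x"
    "\<And>q. hat.geod \<omega> q \<Longrightarrow> hd q \<notin> hat.tree \<omega> x \<Longrightarrow> path_weight Pair \<omega>' q = path_weight Pair \<omega> q"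
proof -
  note nn = hat.good_nonneg[OF good]
  show le: "\<forall>e\<in>hat_edges G S. \<omega> e \<le> \<omega>' e"
  proof
    fix e assume e: "e \<in> hat_edges G S"
    show "\<omega> e \<le> \<omega>' e"
    proof (cases "e \<in> F")
      case True
      then show ?thesis using bspec[OF raised True] t by (cases e) (auto simp: F low_tree_edges_def)
    qed (use eq e in auto)
  qed
  with nn show "\<forall>e\<in>hat_edges G S. 0 \<le> \<omega>' e" by fastforce
  have eq': "\<omega>' (u, v) = \<omega> (u, v)"
    if "(u, v) \<in> hat_edges G S" "u \<notin> hat.tree \<omega> x" "v \<notin> hat.tree \<omega> x" for u v
    using that by (intro bspec[OF eq]) (auto simp: F low_tree_edges_def)
  show "path_weight Pair \<omega>' q = path_weight Pair \<omega> q" if "hat.geod \<omega> q" "hd q \<notin> hat.tree \<omega> x" for q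
    by (rule geodesic_tree_raise(1)[OF nn le _ that]) (rule eq')
  have out: "hd q \<notin> hat.tree \<omega>' x" if "hat.geod \<omega> q" "hd q \<notin> hat.tree \<omega> x" for q
    by (rule geodesic_tree_raise(2)[OF nn le _ that]) (rule eq')
  show "hat.tree \<omega>' x \<subseteq> hat.tree \<omega> x"
  proof
    fix u assume u: "u \<in> hat.tree \<omega>' x"
    show "u \<in> hat.tree \<omega> x"
    proof (rule ccontr)
      assume nu: "u \<notin> hat.tree \<omega> x"
      obtain q where q: "hat.geod \<omega> q" "hd q = u" using hat.good_geod[OF good hat.tree_V[OF u]] by blast
      have "hd q \<notin> hat.tree \<omega>' x" by (rule out[OF q(1)]) (simp add: q(2) nu)
      with u q show False by simp
    qed
  qed
qed

text \<open>
  After raising, a geodesic from level \<open>n + M + J\<close> to \<open>x\<close> has gained at least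
  \<open>r (t1 - t0)\<close>, whereas leaving the old tree above level \<open>n + M\<close> costs at most \<open>D\<close>.
\<close>

lemma hat_tree_cut_off:
  assumes good: "hat.good \<omega>" and t: "0 \<le> t0" "t0 < t1" and D: "0 \<le> D" "D < real r * (t1 - t0)"
    and F: "F = low_tree_edges \<omega> x n M t0"
    and eq: "\<forall>e\<in>hat_edges G S - F. \<omega>' e = \<omega> e" and raised: "\<forall>e\<in>F. t1 < \<omega>' e"
    and K: "finite {z\<in>carrier G. (z, n + M) \<in> hat.tree \<omega> x}" "card {z\<in>carrier G. (z, n + M) \<in> hat.tree \<omega> x} \<le> K"
    and J: "J = 2 * K"
    and nbad: "\<And>y. y \<in> carrier G \<Longrightarrow> (y, n + M + J) \<in> hat.tree \<omega> x \<Longrightarrow> \<not> hat_bad D J \<omega> (y, n + M + J)"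
    and nfew: "\<And>y. y \<in> carrier G \<Longrightarrow> (y, n + M + J) \<in> hat.tree \<omega> x \<Longrightarrow>
      \<not> hat.few_edges {t0<..} (r + J) (J + M) \<omega> (y, n + M + J)"
  shows "(y, n + M + J) \<notin> hat.tree \<omega>' x"
proof
  assume y': "(y, n + M + J) \<in> hat.tree \<omega>' x"
  note nn = hat.good_nonneg[OF good]
  note raise = hat_raise[OF good t F eq raised]
  have y: "y \<in> carrier G" "(y, n + M + J) \<in> hat.tree \<omega> x"
    using hat.tree_V[OF y'] raise(3) y' by auto
  \<comment> \<open>This is the reason for \<open>J = 2 * K\<close>: at least \<open>K + 1\<close>
    vertices of level \<open>n + M\<close> can be reached from \<open>(y, n + M + J)\<close>, and at
    most \<open>K\<close> of them are in the tree.\<close>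
  have "\<exists>z\<in>(nb ^^ J) {y}. (z, n + M) \<notin> hat.tree \<omega> x"
  proof (rule ccontr)
    assume no: "\<not> ?thesis"
    have "(nb ^^ J) {y} \<subseteq> carrier G" using y(1) nb_carrier by (cases J) auto
    then have "(nb ^^ J) {y} \<subseteq> {z\<in>carrier G. (z, n + M) \<in> hat.tree \<omega> x}" using no by blast
    from card_mono[OF K(1) this] have "card ((nb ^^ J) {y}) \<le> K" using K(2) by simp
    then show False using card_nb_pow[OF y(1), of K] J by simp
  qed
  then obtain z where z: "z \<in> (nb ^^ J) {y}" "(z, n + M) \<notin> hat.tree \<omega> x" by blast
  obtain \<pi> where \<pi>: "\<pi> \<in> hat.kpaths (y, n + M + J) J" "last \<pi> = (z, n + M)"
    using hpath_nb[OF y(1) z(1)] by blast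
  have \<pi>p: "hwalk \<pi>" "hd \<pi> = (y, n + M + J)" "\<pi> \<noteq> []"
    using \<pi>(1) by (auto simp: hat.kpaths_def fpp_path_iff_walk fpp_walk_def)
  have zV: "(z, n + M) \<in> carrier G \<times> UNIV"
    using \<pi>p(1,3) \<pi>(2) last_in_set[of \<pi>] by (auto simp: fpp_walk_def)
  obtain q where q: "hat.geod \<omega> q" "hd q = (z, n + M)" using hat.good_geod[OF good zV] by blast
  have qw: "hwalk q" "last q \<in> level G 0" using q(1) by (auto simp: geodesic_to_iff fpp_path_walk)
  obtain q' where q': "q = (z, n + M) # q'" using q(2) qw(1) by (cases q) (auto simp: fpp_walk_def)
  define \<pi>' where "\<pi>' = butlast \<pi>"
  have \<pi>': "\<pi> = \<pi>' @ [(z, n + M)]" using append_butlast_last_id[OF \<pi>p(3)] \<pi>(2) by (simp add: \<pi>'_def)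
  obtain p where p: "hat.geod \<omega>' p" "hd p = (y, n + M + J)" "last p = (x, 0)"
    using y' unfolding geodesic_tree_iff[OF raise(2)] by blast
  have pw: "hwalk p" "p \<noteq> []" using p(1) by (auto simp: geodesic_to_iff fpp_path_walk fpp_path_def)
  have pT: "set p \<subseteq> hat.tree \<omega> x" using geodesic_in_tree[OF p(1)] p(3) raise(3) by auto
  \<comment> \<open>The geodesic before the change is the benchmark: the detour costs at most
    \<open>D\<close> more than \<open>p0\<close> under \<omega>, and \<open>p0\<close> is at most as
    heavy as \<open>p\<close> there.\<close>
  obtain p0 where p0: "hat.geod \<omega> p0" "hd p0 = (y, n + M + J)" using hat.good_geod[OF good, of "(y, n + M + J)"] y by auto
  have pp: "fpp_path (carrier G \<times> UNIV) (hat_edges G S) Pair p" "last p \<in> level G 0"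
    using p(1) by (auto simp: geodesic_to_iff)
  have p0p: "path_weight Pair \<omega> p0 \<le> path_weight Pair \<omega> p"
    using p0 p(2) pp by (simp add: geodesic_to_iff)
  have "\<not> hat.dn \<omega> (y, n + M + J) + ennreal D < ennreal (path_weight Pair \<omega> \<pi>) + hat.dn \<omega> (last \<pi>)"
    using nbad[OF y] \<pi>(1) unfolding hat_bad_def by blast
  then have "ennreal (path_weight Pair \<omega> \<pi>) + ennreal (path_weight Pair \<omega> q) \<le> ennreal (path_weight Pair \<omega> p0) + ennreal D"
    using hat.dn_geod[OF p0] hat.dn_geod[OF q] \<pi>(2) by (simp add: not_less)
  moreover have n0: "0 \<le> path_weight Pair \<omega> \<pi>" "0 \<le> path_weight Pair \<omega> q" "0 \<le> path_weight Pair \<omega> p0"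
    using \<pi>p(1) qw(1) fpp_path_walk[OF hat.geod_path[OF p0(1)]] by (auto intro!: path_weight_nonneg[OF nn])
  ultimately have alt: "path_weight Pair \<omega> \<pi> + path_weight Pair \<omega> q \<le> path_weight Pair \<omega> p0 + D"
    using D by (simp add: ennreal_plus[symmetric] del: ennreal_plus)
  \<comment> \<open>The detour keeps its weight: \<pi> stays at level \<open>n + M\<close> or above,
    where nothing is raised, and \<open>q\<close> starts outside the old tree.\<close>
  have w\<pi>: "path_weight Pair \<omega>' \<pi> = path_weight Pair \<omega> \<pi>"
  proof (rule path_weight_cong)
    fix e assume e: "e \<in> set (path_edges Pair \<pi>)"
    obtain u v where uv: "e = (u, v)" by (cases e)
    have "n + M \<le> snd v" using hwalk_edge(4)[OF \<pi>p(1)] e uv \<pi>(2) by fastforce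
    then have "e \<notin> F" by (simp add: F low_tree_edges_def uv)
    moreover have "e \<in> hat_edges G S" using e \<pi>(1) hat.path_edges_E by (auto simp: hat.kpaths_def)
    ultimately show "\<omega>' e = \<omega> e" using eq by blast
  qed
  have "hwalk (\<pi>' @ (z, n + M) # q')"
    using \<pi>p(1) qw(1) fpp_walk_append'[of _ _ Pair \<pi>' "(z, n + M)" q'] by (simp add: \<pi>' q')
  moreover have "hd (\<pi>' @ (z, n + M) # q') = (y, n + M + J)" using \<pi>p(2) \<pi>' by (cases \<pi>') auto
  moreover have "last (\<pi>' @ (z, n + M) # q') \<in> level G 0" using qw(2) q' by simp
  ultimately have "path_weight Pair \<omega>' p \<le> path_weight Pair \<omega>' (\<pi>' @ (z, n + M) # q')"
    using p(2) by (intro geodesic_to_le_walk[OF raise(2) p(1)]) simp_all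
  also have "\<dots> = path_weight Pair \<omega>' \<pi> + path_weight Pair \<omega>' q"
    unfolding \<pi>' q' by (rule path_weight_append')
  also have "\<dots> = path_weight Pair \<omega> \<pi> + path_weight Pair \<omega> q"
    using w\<pi> raise(4)[OF q(1)] q(2) z(2) by simp
  finally have up: "path_weight Pair \<omega>' p \<le> path_weight Pair \<omega> p + D" using alt p0p by simp
  have lp: "length p = n + M + J + 1" using hwalk_level_last[OF pw(1)] p by simp
  \<comment> \<open>The part of \<open>p\<close> between the levels \<open>n + M + J\<close> and
    \<open>n\<close>, which consists of \<open>J + M\<close> edges.\<close>
  define p1 where "p1 = take (Suc (J + M)) p"
  define p2 where "p2 = drop (Suc (J + M)) p"
  have p12: "p = p1 @ p2" by (simp add: p1_def p2_def)
  have l1: "length p1 = Suc (J + M)" using lp by (simp add: p1_def)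
  then have p1ne: "p1 \<noteq> []" by auto
  have h1: "hd p1 = (y, n + M + J)" using p(2) p1ne by (simp add: p12)
  have w1: "hwalk p1" using pw(1) p1ne by (auto simp: p12 fpp_walk_def successively_append_iff)
  have last1: "snd (last p1) = n" using hwalk_level_last[OF w1] h1 l1 by simp
  have "p1 \<in> hat.kpaths (y, n + M + J) (J + M)" using h1 l1 hwalk_path[OF w1] by (simp add: hat.kpaths_def)
  define H where "H = {e \<in> set (path_edges Pair p1). \<omega> e \<notin> {t0<..}}"
  have cH: "r + J \<le> card H"
    using nfew[OF y] \<open>p1 \<in> _\<close> unfolding hat.few_edges_def H_def by (auto simp: not_less)
  define H1 where "H1 = {e \<in> H. snd (snd e) < n + M}"
  \<comment> \<open>Light edges above level \<open>n + M\<close> are not raised. They are among the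
    first \<open>J\<close> edges, which is why \<open>r + J\<close> light edges were demanded in
    order to keep \<open>r\<close>.\<close>
  have "H - H1 \<subseteq> set (path_edges Pair (take (Suc J) p1))"
  proof
    fix e assume e: "e \<in> H - H1"
    define a u b where "a = take J p1" and "u = p1 ! J" and "b = drop (Suc J) p1"
    then have a: "p1 = a @ u # b" "length a = J" using id_take_nth_drop[of J p1] l1 by auto
    have tk: "take (Suc J) p1 = a @ [u]" using a by simp
    have "e \<in> set (path_edges Pair (a @ [u])) \<or> e \<in> set (path_edges Pair (u # b))"
      using e unfolding H_def a path_edges_append'[of Pair a u b] by auto
    moreover have "e \<notin> set (path_edges Pair (u # b))"
    proof
      assume "e \<in> set (path_edges Pair (u # b))"
      moreover have "hwalk (u # b)" using w1 unfolding a fpp_walk_append'[of _ _ Pair a u b] by blast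
      ultimately have "snd (snd e) < snd u" using hwalk_edge(3)[of "u # b" "fst e" "snd e"] by simp
      moreover have "snd u + J = n + M + J" using hwalk_level[of a u b] w1 a h1 by simp
      ultimately show False using e by (auto simp: H1_def)
    qed
    ultimately show "e \<in> set (path_edges Pair (take (Suc J) p1))" using tk by auto
  qed
  then have "card (H - H1) \<le> card (set (path_edges Pair (take (Suc J) p1)))" by (intro card_mono) auto
  also have "\<dots> \<le> length (path_edges Pair (take (Suc J) p1))" by (rule card_length)
  also have "\<dots> \<le> J" by (simp add: length_path_edges)
  finally have "card (H - H1) \<le> J" .
  moreover have "finite H" by (simp add: H_def)
  then have "card H = card H1 + card (H - H1)"
    using card_Diff_subset[of H1 H] card_mono[of H H1] by (auto simp: H1_def)
  ultimately have cH1: "r \<le> card H1" using cH by simp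
  have H1F: "H1 \<subseteq> F"
  proof
    fix e assume e: "e \<in> H1"
    obtain u v where uv: "e = (u, v)" by (cases e)
    have ep: "(u, v) \<in> set (path_edges Pair p1)" "\<omega> (u, v) \<le> t0" "snd v < n + M" using e uv by (auto simp: H1_def H_def)
    have "u \<in> set p" "v \<in> set p" using hwalk_edge(1,2)[OF w1 ep(1)] p12 by auto
    moreover have "n \<le> snd v" using hwalk_edge(4)[OF w1 ep(1)] last1 by simp
    moreover have "(u, v) \<in> hat_edges G S" using hat.path_edges_E[OF hwalk_path[OF w1]] ep(1) by blast
    ultimately show "e \<in> F" using pT ep unfolding F low_tree_edges_def uv by auto
  qed
  have H1p: "H1 \<subseteq> set (path_edges Pair p)"
  proof -
    have "set (path_edges Pair p1) \<subseteq> set (path_edges Pair p)"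
      by (cases "p2 = []") (use p1ne in \<open>auto simp: p12 path_edges_append\<close>)
    then show ?thesis by (auto simp: H1_def H_def)
  qed
  have dp: "distinct p" using pp(1) by (simp add: fpp_path_def)
  have "real r * (t1 - t0) \<le> real (card H1) * (t1 - t0)" using cH1 t by (intro mult_right_mono) auto
  also have "\<dots> = (\<Sum>e\<in>H1. t1 - t0)" by simp
  also have "\<dots> \<le> (\<Sum>e\<in>H1. \<omega>' e - \<omega> e)"
  proof (rule sum_mono)
    fix e assume e: "e \<in> H1"
    then have "e \<in> F" using H1F by blast
    then have "t1 < \<omega>' e" using raised by blast
    moreover have "\<omega> e \<le> t0" using e by (simp add: H1_def H_def)
    ultimately show "t1 - t0 \<le> \<omega>' e - \<omega> e" by simp
  qed
  also have "\<dots> \<le> (\<Sum>e\<in>set (path_edges Pair p). \<omega>' e - \<omega> e)"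
    using raise(1) hat.path_edges_E[OF pp(1)] H1p by (intro sum_mono2) auto
  also have "\<dots> = path_weight Pair \<omega>' p - path_weight Pair \<omega> p"
    by (simp add: hat.pw_sum[OF dp] sum_subtractf)
  also have "\<dots> \<le> D" using up by simp
  finally show False using D by simp
qed

end

section \<open>Moments of passage times and the cost of detours\<close>

lemma ennreal_add_le: "ennreal (a + b) \<le> ennreal a + ennreal b"
proof -
  have "ennreal (a + b) \<le> ennreal (max 0 a + max 0 b)" by (intro ennreal_leI) auto
  also have "\<dots> = ennreal (max 0 a) + ennreal (max 0 b)" by (intro ennreal_plus) auto
  finally show ?thesis by simp
qed

context iid_weights
begin

lemma cdf_gt: "measure \<mu> {t<..} = 1 - measure \<mu> {..t}"
  using mu.prob_compl[of "{..t}"] by (simp add: Compl_eq_Diff_UNIV[symmetric])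

text \<open>Quantiles at \<open>1 - a\<close>, \<open>1 - a / 2\<close> and
  \<open>1 - a / 4\<close>. In the directed graph weights above \<open>t0\<close> are rare and those
  above \<open>t1\<close> are the raised ones; in the undirected graph heavy weights must also be
  bounded, so they are drawn from the window \<open>{t1<..t2}\<close>.\<close>

lemma upper_quantiles:
  assumes "0 < a" "a < 1"
  shows "\<exists>t0 t1 t2. 0 < t0 \<and> t0 < t1 \<and> t1 < t2 \<and> measure \<mu> {t0<..} = a \<and> 0 < measure \<mu> {t1<..} \<and>
     0 < measure \<mu> {t1<..t2}"
proof -
  obtain t0 t1 t2 where t: "0 < t0" "measure \<mu> {..t0} = 1 - a" "measure \<mu> {..t1} = 1 - a / 2" "measure \<mu> {..t2} = 1 - a / 4"
    using cdf_attains[of "1 - a"] cdf_attains[of "1 - a / 2"] cdf_attains[of "1 - a / 4"] assms by auto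
  have mono: "s < t" if "measure \<mu> {..s} < measure \<mu> {..t}" for s t
  proof (rule ccontr)
    assume "\<not> s < t"
    then have "measure \<mu> {..t} \<le> measure \<mu> {..s}" by (intro mu.finite_measure_mono) auto
    with that show False by simp
  qed
  have lt: "t0 < t1" "t1 < t2" by (rule mono, use t assms in simp)+
  have "measure \<mu> {t1<..t2} = measure \<mu> {..t2} - measure \<mu> {..t1}"
  proof -
    have eq: "{t1<..t2} = {..t2} - {..t1}" by auto
    show ?thesis unfolding eq using lt by (intro mu.finite_measure_Diff) auto
  qed
  then show ?thesis using t assms lt by (intro exI[of _ t0] exI[of _ t1] exI[of _ t2]) (simp add: cdf_gt)
qed

lemma nn_integral_weight: "e \<in> E \<Longrightarrow> (\<integral>\<^sup>+ \<omega>. ennreal (\<omega> e) \<partial>\<P>) = (\<integral>\<^sup>+ t. ennreal t \<partial>\<mu>)"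
  by (subst (2) PiM_component[symmetric, of e]) (simp_all add: nn_integral_distr)

end

context layered_fpp
begin

text \<open>Weights are nonnegative only almost surely, so \<open>ennreal\<close> of a sum is
  handled by subadditivity. Counting vertices instead of edges avoids a subtraction in the
  induction.\<close>

lemma nn_integral_pw:
  "set (path_edges l p) \<subseteq> E \<Longrightarrow> (\<integral>\<^sup>+ \<omega>. ennreal (pw \<omega> p) \<partial>\<P>) \<le> of_nat (length p) * (\<integral>\<^sup>+ t. ennreal t \<partial>\<mu>)"
proof (induction p rule: induct_list012)
  case (3 u v p)
  then have e: "l u v \<in> E" "set (path_edges l (v # p)) \<subseteq> E" by auto
  have "(\<integral>\<^sup>+ \<omega>. ennreal (pw \<omega> (u # v # p)) \<partial>\<P>) \<le> (\<integral>\<^sup>+ \<omega>. ennreal (\<omega> (l u v)) + ennreal (pw \<omega> (v # p)) \<partial>\<P>)"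
    by (intro nn_integral_mono) (simp add: ennreal_add_le)
  also have "\<dots> = (\<integral>\<^sup>+ \<omega>. ennreal (\<omega> (l u v)) \<partial>\<P>) + (\<integral>\<^sup>+ \<omega>. ennreal (pw \<omega> (v # p)) \<partial>\<P>)"
    using e by (intro nn_integral_add measurable_compose[OF _ measurable_ennreal] measurable_weight measurable_pw)
  also have "\<dots> \<le> (\<integral>\<^sup>+ t. ennreal t \<partial>\<mu>) + of_nat (length (v # p)) * (\<integral>\<^sup>+ t. ennreal t \<partial>\<mu>)"
    using 3 e by (intro add_mono) (simp_all add: nn_integral_weight)
  also have "\<dots> = of_nat (length (u # v # p)) * (\<integral>\<^sup>+ t. ennreal t \<partial>\<mu>)"
    by (simp add: distrib_right)
  finally show ?case .
qed auto

lemma nn_integral_dn_act: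
  assumes "y \<in> carrier G"
  shows "(\<integral>\<^sup>+ \<omega>. dn \<omega> (y, k) \<partial>\<P>) = (\<integral>\<^sup>+ \<omega>. dn \<omega> (\<one>, k) \<partial>\<P>)"
proof -
  have "(\<integral>\<^sup>+ \<omega>. dn \<omega> (y, k) \<partial>\<P>) = (\<integral>\<^sup>+ \<omega>. dn (\<tau> y \<omega>) (\<one>, k) \<partial>\<P>)"
    using assms by (simp add: dn_\<tau>)
  also have "\<dots> = (\<integral>\<^sup>+ \<omega>. dn \<omega> (\<one>, k) \<partial>distr \<P> \<P> (\<tau> y))"
    by (rule nn_integral_distr[symmetric]) (use assms measurable_\<tau> measurable_dn in auto)
  finally show ?thesis using assms by (simp add: distr_\<tau>)
qed

text \<open>A single path to level 0 dominates the passage time, and its weight has finite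
  mean.\<close>

lemma nn_integral_dn_finite:
  assumes "(\<integral>\<^sup>+ t. ennreal t \<partial>\<mu>) < \<infinity>" "u \<in> V"
  shows "(\<integral>\<^sup>+ \<omega>. dn \<omega> u \<partial>\<P>) < \<infinity>"
proof -
  obtain p where p: "fpp_walk V E l p" "hd p = u" "snd (last p) = 0" using reach_level_0[OF assms(2)] by blast
  obtain q where q: "fpp_path V E l q" "hd q = hd p" "last q = last p"
    using loop_erase[where \<omega> = "\<lambda>_. 0", OF _ p(1)] by auto
  have "last q \<in> V" using q(1) last_in_set[of q] by (auto simp: fpp_path_def)
  then have "q \<in> paths_to_0 u" using p q by (cases "last q") (auto simp: paths_to_0_def level_def)
  then have "(\<integral>\<^sup>+ \<omega>. dn \<omega> u \<partial>\<P>) \<le> (\<integral>\<^sup>+ \<omega>. ennreal (pw \<omega> q) \<partial>\<P>)"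
    unfolding dn_def by (intro nn_integral_mono INF_lower)
  also have "\<dots> \<le> of_nat (length q) * (\<integral>\<^sup>+ t. ennreal t \<partial>\<mu>)" by (intro nn_integral_pw path_edges_E q)
  also have "\<dots> < \<infinity>" using assms(1) by (simp add: ennreal_mult_less_top of_nat_less_top)
  finally show ?thesis .
qed

end

context cayley_fpp
begin

lemma sets_hat_bad: "{\<omega>\<in>space (hat_measure G S \<mu>). hat_bad D J \<omega> u} \<in> sets (hat_measure G S \<mu>)"
  unfolding hat_bad_def hat_measure_def
proof (rule sets.sets_Collect_finite_Ex)
  fix \<pi> assume "\<pi> \<in> hat.kpaths u J"
  then have "(\<lambda>\<omega>. ennreal (path_weight Pair \<omega> \<pi>)) \<in> borel_measurable (Pi\<^sub>M (hat_edges G S) (\<lambda>_. \<mu>))"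
    by (intro measurable_compose[OF hat.measurable_pw measurable_ennreal] hat.path_edges_E) (simp add: hat.kpaths_def)
  then show "{\<omega> \<in> space (Pi\<^sub>M (hat_edges G S) (\<lambda>_. \<mu>)).
     hat.dn \<omega> u + ennreal D < ennreal (path_weight Pair \<omega> \<pi>) + hat.dn \<omega> (last \<pi>)} \<in> sets (Pi\<^sub>M (hat_edges G S) (\<lambda>_. \<mu>))"
    by (intro borel_measurable_less borel_measurable_add hat.measurable_dn) auto
qed (use hat.kpaths_card in auto)

lemma hat_bad_\<tau>:
  assumes "g \<in> carrier G" "u \<in> carrier G \<times> UNIV"
  shows "hat_bad D J (hat.\<tau> g \<omega>) u \<longleftrightarrow> hat_bad D J \<omega> (shift_vertex G g u)"
proof -
  have u: "fst u \<in> carrier G" using assms by auto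
  have "path_weight Pair (hat.\<tau> g \<omega>) \<pi> = path_weight Pair \<omega> (map (shift_vertex G g) \<pi>) \<and>
      hat.dn (hat.\<tau> g \<omega>) (last \<pi>) = hat.dn \<omega> (last (map (shift_vertex G g) \<pi>))" if "\<pi> \<in> hat.kpaths u J" for \<pi>
  proof -
    have \<pi>: "fpp_path (carrier G \<times> UNIV) (hat_edges G S) Pair \<pi>" "\<pi> \<noteq> []" using that by (auto simp: hat.kpaths_def)
    then have sub: "set \<pi> \<subseteq> carrier G \<times> UNIV" by (simp add: fpp_path_def)
    then have "fst ` set \<pi> \<subseteq> carrier G" by auto
    moreover have "fst (last \<pi>) \<in> carrier G" using subsetD[OF sub last_in_set[OF \<pi>(2)]] by auto
    ultimately show ?thesis using \<pi> assms(1) hat.path_edges_E[OF \<pi>(1)] by (simp add: hat.pw_\<tau> hat.dn_\<tau> last_map)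
  qed
  then show ?thesis unfolding hat_bad_def hat.kpaths_act[OF assms(1) u] hat.dn_\<tau>[OF assms(1) u] by simp
qed

text \<open>Markov's inequality for the excess of a detour over the passage time. The excess is
  almost surely nonnegative; its mean is at most the mean cost of \<open>J\<close> steps plus
  \<open>h k - h (k + J)\<close>, where \<open>h k\<close> is the mean of \<open>dn\<close> at level
  \<open>k\<close>, and hypothesis \<open>h\<close> bounds this difference by 1. A union bound over
  at most \<open>card S ^ J\<close> detours follows.\<close>

lemma prob_hat_bad:
  assumes m: "(\<integral>\<^sup>+ t. ennreal t \<partial>\<mu>) = ennreal m" "0 \<le> m" and D: "0 < D"
    and h: "(\<integral>\<^sup>+ \<omega>. hat.dn \<omega> (\<one>, k) \<partial>hat_measure G S \<mu>) \<le> (\<integral>\<^sup>+ \<omega>. hat.dn \<omega> (\<one>, k + J) \<partial>hat_measure G S \<mu>) + 1"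
  shows "hat.prob {\<omega>\<in>space (hat_measure G S \<mu>). hat_bad D J \<omega> (\<one>, k + J)} \<le>
    real (card S ^ J) * ((real (Suc J) * m + 1) / D)"
proof -
  let ?P = "hat_measure G S \<mu>"
  note [measurable] = hat.measurable_dn[folded hat_measure_def]
  let ?Y = "\<lambda>\<omega>. hat.dn \<omega> (\<one>, k + J)"
  let ?X = "\<lambda>\<pi> \<omega>. ennreal (path_weight Pair \<omega> \<pi>) + hat.dn \<omega> (last \<pi>)"
  let ?B = "\<lambda>\<pi>. {\<omega>\<in>space ?P. ?Y \<omega> + ennreal D < ?X \<pi> \<omega>}"
  have fin: "(\<integral>\<^sup>+ \<omega>. ?Y \<omega> \<partial>?P) < \<infinity>"
    using hat.nn_integral_dn_finite m by (simp add: hat_measure_def)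
  have single: "?B \<pi> \<in> sets ?P \<and> measure ?P (?B \<pi>) \<le> (real (Suc J) * m + 1) / D" if \<pi>: "\<pi> \<in> hat.kpaths (\<one>, k + J) J" for \<pi>
  proof -
    have \<pi>': "hwalk \<pi>" "hd \<pi> = (\<one>, k + J)" "\<pi> \<noteq> []" "length \<pi> = Suc J"
      using \<pi> by (auto simp: hat.kpaths_def fpp_path_walk)
    have pE: "set (path_edges Pair \<pi>) \<subseteq> hat_edges G S"
      using \<pi> hat.path_edges_E by (auto simp: hat.kpaths_def)
    obtain z where z: "last \<pi> = (z, k)" "z \<in> carrier G"
      using hwalk_level_last[OF \<pi>'(1)] \<pi>' last_in_set[OF \<pi>'(3)] by (cases "last \<pi>") (auto simp: fpp_walk_def)
    have mX1 [measurable]: "(\<lambda>\<omega>. ennreal (path_weight Pair \<omega> \<pi>)) \<in> borel_measurable ?P"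
      unfolding hat_measure_def by (intro measurable_compose[OF hat.measurable_pw measurable_ennreal] pE)
    have mX [measurable]: "?X \<pi> \<in> borel_measurable ?P" by measurable
    have mB [measurable]: "?B \<pi> \<in> sets ?P" by measurable
    \<comment> \<open>Markov's inequality in additive form: integrating this inequality and
      cancelling the finite integral of \<open>?Y\<close> replaces the subtraction that would define
      the excess.\<close>
    have "AE \<omega> in ?P. ?Y \<omega> + ennreal D * indicator (?B \<pi>) \<omega> \<le> ?X \<pi> \<omega>"
      using hat.AE_good[folded hat_measure_def]
    proof eventually_elim
      case (elim \<omega>)
      obtain q where q: "hat.geod \<omega> q" "hd q = (z, k)" using hat.good_geod[OF elim, of "(z, k)"] z by auto
      have qw: "hwalk q" "last q \<in> level G 0" using q(1) by (auto simp: geodesic_to_iff fpp_path_walk)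
      obtain q' where q': "q = (z, k) # q'" using q(2) qw(1) by (cases q) (auto simp: fpp_walk_def)
      define \<pi>1 where "\<pi>1 = butlast \<pi>"
      have \<pi>1: "\<pi> = \<pi>1 @ [(z, k)]" using append_butlast_last_id[OF \<pi>'(3)] z(1) by (simp add: \<pi>1_def)
      have "hwalk (\<pi>1 @ (z, k) # q')"
        using \<pi>'(1) qw(1) fpp_walk_append'[of _ _ Pair \<pi>1 "(z, k)" q'] by (simp add: \<pi>1 q')
      then have "\<pi>1 @ (z, k) # q' \<in> hat.paths_to_0 (\<one>, k + J)"
        using hwalk_path \<pi>'(2) qw(2) unfolding hat.paths_to_0_def \<pi>1 q' by (cases \<pi>1) auto
      then have "?Y \<omega> \<le> ennreal (path_weight Pair \<omega> (\<pi>1 @ (z, k) # q'))"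
        unfolding hat.dn_def by (rule INF_lower)
      also have "path_weight Pair \<omega> (\<pi>1 @ (z, k) # q') = path_weight Pair \<omega> \<pi> + path_weight Pair \<omega> q"
        unfolding \<pi>1 q' by (rule path_weight_append')
      also have "ennreal \<dots> \<le> ?X \<pi> \<omega>"
        using ennreal_add_le hat.dn_geod[OF q] z(1) by simp
      finally show ?case by (auto simp: indicator_def split: if_splits)
    qed
    then have "(\<integral>\<^sup>+ \<omega>. ?Y \<omega> + ennreal D * indicator (?B \<pi>) \<omega> \<partial>?P) \<le> (\<integral>\<^sup>+ \<omega>. ?X \<pi> \<omega> \<partial>?P)"
      by (rule nn_integral_mono_AE)
    also have "(\<integral>\<^sup>+ \<omega>. ?Y \<omega> + ennreal D * indicator (?B \<pi>) \<omega> \<partial>?P) = (\<integral>\<^sup>+ \<omega>. ?Y \<omega> \<partial>?P) + ennreal D * emeasure ?P (?B \<pi>)"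
      by (subst nn_integral_add) (measurable, simp add: nn_integral_cmult_indicator mB)
    also have "(\<integral>\<^sup>+ \<omega>. ?X \<pi> \<omega> \<partial>?P) = (\<integral>\<^sup>+ \<omega>. ennreal (path_weight Pair \<omega> \<pi>) \<partial>?P) + (\<integral>\<^sup>+ \<omega>. hat.dn \<omega> (last \<pi>) \<partial>?P)"
      by (intro nn_integral_add) measurable
    also have "\<dots> \<le> ennreal (real (Suc J) * m) + ((\<integral>\<^sup>+ \<omega>. ?Y \<omega> \<partial>?P) + 1)"
    proof (rule add_mono)
      have "(\<integral>\<^sup>+ \<omega>. ennreal (path_weight Pair \<omega> \<pi>) \<partial>?P) \<le> of_nat (Suc J) * ennreal m"
        using hat.nn_integral_pw[OF pE] m(1) \<pi>'(4) by (simp add: hat_measure_def)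
      also have "\<dots> = ennreal (real (Suc J) * m)"
        using m(2) by (simp only: ennreal_of_nat_eq_real_of_nat) (intro ennreal_mult[symmetric], auto)
      finally show "(\<integral>\<^sup>+ \<omega>. ennreal (path_weight Pair \<omega> \<pi>) \<partial>?P) \<le> ennreal (real (Suc J) * m)" .
      show "(\<integral>\<^sup>+ \<omega>. hat.dn \<omega> (last \<pi>) \<partial>?P) \<le> (\<integral>\<^sup>+ \<omega>. ?Y \<omega> \<partial>?P) + 1"
        using h hat.nn_integral_dn_act[OF z(2)] z(1) by (simp add: hat_measure_def)
    qed
    also have "\<dots> = (\<integral>\<^sup>+ \<omega>. ?Y \<omega> \<partial>?P) + ennreal (real (Suc J) * m + 1)"
      using m(2) by (simp add: ac_simps ennreal_plus)
    finally have "ennreal D * emeasure ?P (?B \<pi>) \<le> ennreal (real (Suc J) * m + 1)"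
      using fin by (subst (asm) ennreal_add_left_cancel_le) auto
    then have "ennreal (D * measure ?P (?B \<pi>)) \<le> ennreal (real (Suc J) * m + 1)"
      using D by (simp only: hat.P.emeasure_eq_measure[folded hat_measure_def] ennreal_mult measure_nonneg less_imp_le)
    then have "D * measure ?P (?B \<pi>) \<le> real (Suc J) * m + 1"
      using m(2) by (subst (asm) ennreal_le_iff) auto
    then show ?thesis using D mB by (simp add: field_simps)
  qed
  have "{\<omega>\<in>space ?P. hat_bad D J \<omega> (\<one>, k + J)} = (\<Union>\<pi>\<in>hat.kpaths (\<one>, k + J) J. ?B \<pi>)"
    by (auto simp: hat_bad_def)
  then have "measure ?P {\<omega>\<in>space ?P. hat_bad D J \<omega> (\<one>, k + J)} \<le> (\<Sum>\<pi>\<in>hat.kpaths (\<one>, k + J) J. measure ?P (?B \<pi>))"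
    using hat.kpaths_card single by (simp, intro measure_UNION_le) auto
  also have "\<dots> \<le> (\<Sum>\<pi>\<in>hat.kpaths (\<one>, k + J) J. (real (Suc J) * m + 1) / D)"
    using single by (intro sum_mono) blast
  also have "\<dots> = real (card (hat.kpaths (\<one>, k + J) J)) * ((real (Suc J) * m + 1) / D)" by simp
  also have "\<dots> \<le> real (card S ^ J) * ((real (Suc J) * m + 1) / D)"
    using hat.kpaths_card[of "(\<one>, k + J)" J] m(2) D by (intro mult_right_mono) (auto simp del: of_nat_power)
  finally show ?thesis by (simp add: hat_measure_def)
qed

section \<open>Raising the low tree edges: the loss in probability\<close>

abbreviation hat_level where "hat_level \<omega> x n \<equiv> {y\<in>carrier G. (y, n) \<in> hat.tree \<omega> x}"

lemma hat_tree_nb: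
  assumes nn: "\<forall>e\<in>hat_edges G S. 0 \<le> \<omega> e"
  shows "(z, n + j) \<in> hat.tree \<omega> x \<Longrightarrow> z \<in> (nb ^^ j) (hat_level \<omega> x n)"
proof (induction j arbitrary: z)
  case 0
  then show ?case using hat.tree_V[of "(z, n)" \<omega> x] by auto
next
  case (Suc j)
  then obtain p where p: "hat.geod \<omega> p" "hd p = (z, Suc (n + j))" "last p = (x, 0)"
    using geodesic_tree_iff[OF nn, of "(z, Suc (n + j))" "carrier G \<times> UNIV" Pair "level G 0" "(x, 0)"] by auto
  then have pw: "hwalk p" by (simp add: geodesic_to_iff fpp_path_walk)
  then obtain v p' where p': "p = (z, Suc (n + j)) # v # p'"
    using p by (cases p; cases "tl p") (auto simp: fpp_walk_def)
  obtain w k where v: "v = (w, k)" by (cases v)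
  have "k = n + j" "nbr w z" using pw unfolding p' v by (auto simp: fpp_walk_simps hat_edge_iff)
  moreover have "v \<in> hat.tree \<omega> x" using geodesic_in_tree[OF p(1)] p(3) p' by auto
  ultimately have "w \<in> (nb ^^ j) (hat_level \<omega> x n)" "nbr w z" using Suc.IH[of w] v by auto
  then have "z \<in> nb ((nb ^^ j) (hat_level \<omega> x n))" unfolding nb_def[of "(nb ^^ j) (hat_level \<omega> x n)"] by blast
  then show ?case by simp
qed

text \<open>All edges in the levels from \<open>n\<close> to \<open>n + M\<close> whose lower end
  can be reached by climbing from \<open>A\<close>. It depends on \<open>A\<close> only and contains
  every edge that may have to be raised.\<close>

definition cone :: "'a set \<Rightarrow> nat \<Rightarrow> nat \<Rightarrow> (('a \<times> nat) \<times> ('a \<times> nat)) set" where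
  "cone A n M = (\<Union>j<M. \<Union>z\<in>(nb ^^ j) A. (\<lambda>s. ((z \<otimes> s, Suc (n + j)), (z, n + j))) ` S)"

lemma cone_card:
  assumes A: "finite A" "card A \<le> K"
  shows "finite (cone A n M) \<and> card (cone A n M) \<le> M * (card S ^ M * K * card S)"
proof -
  let ?C = "\<lambda>j. \<Union>z\<in>(nb ^^ j) A. (\<lambda>s. ((z \<otimes> s, Suc (n + j)), (z, n + j))) ` S"
  have C: "finite (?C j) \<and> card (?C j) \<le> card S ^ M * K * card S" if "j < M" for j
  proof -
    have "card (?C j) \<le> (\<Sum>z\<in>(nb ^^ j) A. card ((\<lambda>s. ((z \<otimes> s, Suc (n + j)), (z, n + j))) ` S))"
      using nb_pow_finite[OF A(1)] by (intro card_UN_le) auto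
    also have "\<dots> \<le> (\<Sum>z\<in>(nb ^^ j) A. card S)" using generators(1) by (intro sum_mono card_image_le)
    also have "\<dots> = card ((nb ^^ j) A) * card S" by simp
    also have "\<dots> \<le> card S ^ M * K * card S"
    proof (intro mult_right_mono)
      have "card ((nb ^^ j) A) \<le> card S ^ j * card A" using nb_pow_finite[OF A(1)] by blast
      also have "\<dots> \<le> card S ^ M * K"
        using that A(2) card_S_pos by (intro mult_mono power_increasing) auto
      finally show "card ((nb ^^ j) A) \<le> card S ^ M * K" .
    qed auto
    finally show ?thesis using nb_pow_finite[OF A(1)] generators(1) by auto
  qed
  have "card (cone A n M) \<le> (\<Sum>j<M. card (?C j))" unfolding cone_def by (intro card_UN_le) auto
  also have "\<dots> \<le> (\<Sum>j<M. card S ^ M * K * card S)" using C by (intro sum_mono) auto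
  finally have "card (cone A n M) \<le> M * (card S ^ M * K * card S)" by simp
  moreover have "finite (cone A n M)" unfolding cone_def using C by auto
  ultimately show ?thesis by blast
qed

lemma low_tree_edges_cone:
  assumes nn: "\<forall>e\<in>hat_edges G S. 0 \<le> \<omega> e"
  shows "low_tree_edges \<omega> x n M t0 \<subseteq> cone (hat_level \<omega> x n) n M"
proof
  fix e assume e: "e \<in> low_tree_edges \<omega> x n M t0"
  obtain u v where uv: "e = (u, v)" by (cases e)
  obtain z k where v: "v = (z, k)" by (cases v)
  have k: "n \<le> k" "k < n + M" "(z, k) \<in> hat.tree \<omega> x" "(u, v) \<in> hat_edges G S"
    using e by (auto simp: low_tree_edges_def uv v)
  define j where "j = k - n"
  have j: "k = n + j" "j < M" using k by (auto simp: j_def)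
  have "z \<in> (nb ^^ j) (hat_level \<omega> x n)" using hat_tree_nb[OF nn] k j by simp
  moreover have "snd u = Suc k" "nbr z (fst u)" using k(4) by (auto simp: hat_edge_iff v)
  then obtain s where "s \<in> S" "u = (z \<otimes> s, Suc k)" by (cases u) (auto simp: cayley_nbr_def)
  ultimately show "e \<in> cone (hat_level \<omega> x n) n M"
    unfolding cone_def uv v using j by blast
qed

lemma sets_low_tree_edges:
  "{\<omega>\<in>space (hat_measure G S \<mu>). low_tree_edges \<omega> x n M t0 = F} \<in> sets (hat_measure G S \<mu>)"
proof (cases "F \<subseteq> hat_edges G S")
  case True
  let ?c = "\<lambda>\<omega> e. fst e \<in> hat.tree \<omega> x \<and> snd e \<in> hat.tree \<omega> x \<and> n \<le> snd (snd e) \<and> snd (snd e) < n + M \<and> \<omega> e \<le> t0"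
  have m: "{\<omega>\<in>space (hat_measure G S \<mu>). ?c \<omega> e} \<in> sets (hat_measure G S \<mu>)" if "e \<in> hat_edges G S" for e
    unfolding hat_measure_def
    by (intro sets.sets_Collect_conj hat.sets_tree sets.sets_Collect_const borel_measurable_le hat.measurable_weight that) auto
  have "low_tree_edges \<omega> x n M t0 = F \<longleftrightarrow>
      (\<forall>e\<in>hat_edges G S. (?c \<omega> e \<and> e \<in> F) \<or> (\<not> ?c \<omega> e \<and> e \<notin> F))" for \<omega>
    using True unfolding low_tree_edges_def by (auto 0 3)
  then have "{\<omega>\<in>space (hat_measure G S \<mu>). low_tree_edges \<omega> x n M t0 = F} =
    {\<omega>\<in>space (hat_measure G S \<mu>). \<forall>e\<in>hat_edges G S. (?c \<omega> e \<and> e \<in> F) \<or> (\<not> ?c \<omega> e \<and> e \<notin> F)}" by presburger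
  also have "\<dots> \<in> sets (hat_measure G S \<mu>)"
  proof (rule sets.sets_Collect_countable_All'[OF _ countable_hat_edges])
    fix e assume e: "e \<in> hat_edges G S"
    show "{\<omega>\<in>space (hat_measure G S \<mu>). (?c \<omega> e \<and> e \<in> F) \<or> (\<not> ?c \<omega> e \<and> e \<notin> F)} \<in> sets (hat_measure G S \<mu>)"
    proof (cases "e \<in> F")
      case True
      then show ?thesis using m[OF e] by (simp only: simp_thms not_True_eq_False)
    next
      case False
      then show ?thesis using sets.sets_Collect_neg[OF m[OF e]] by (simp only: simp_thms not_False_eq_True)
    qed
  qed
  finally show ?thesis .
next
  case False
  then have "{\<omega>\<in>space (hat_measure G S \<mu>). low_tree_edges \<omega> x n M t0 = F} = {}"
    by (auto simp: low_tree_edges_def)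
  then show ?thesis by (simp only: sets.empty_sets)
qed

text \<open>For fixed level set \<open>A\<close> and fixed raised set \<open>F\<close>, resampling
  costs at most \<open>q ^ ?N\<close>. The target event does not remember \<open>F\<close>, so
  adding up the subsets of the cone costs another \<open>2 ^ ?N\<close>. The level sets
  \<open>A\<close> are remembered and cost nothing.\<close>

lemma prob_hat_cut_off:
  assumes t: "0 \<le> t0" "t0 < t1" and D: "0 \<le> D" "D < real r * (t1 - t0)" and J: "J = 2 * K"
    and q: "q = measure \<mu> {t1<..}"
    and H: "H = {\<omega>\<in>space (hat_measure G S \<mu>). hat.good \<omega> \<and> (\<exists>y\<in>carrier G. (y, n + M + J) \<in> hat.tree \<omega> x) \<and>
      level_size G n (hat.tree \<omega> x) \<le> of_nat K \<and> level_size G (n + M) (hat.tree \<omega> x) \<le> of_nat K \<and>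
      \<not> (\<exists>y\<in>carrier G. (y, n + M + J) \<in> hat.tree \<omega> x \<and> hat_bad D J \<omega> (y, n + M + J)) \<and>
      \<not> (\<exists>y\<in>carrier G. (y, n + M + J) \<in> hat.tree \<omega> x \<and> hat.few_edges {t0<..} (r + J) (J + M) \<omega> (y, n + M + J))}"
  shows "hat.prob H * (q / 2) ^ (M * (card S ^ M * K * card S)) \<le>
    hat.prob {\<omega>\<in>space (hat_measure G S \<mu>). (\<exists>y\<in>carrier G. (y, n) \<in> hat.tree \<omega> x) \<and>
      \<not> (\<exists>y\<in>carrier G. (y, n + M + J) \<in> hat.tree \<omega> x)}"
proof -
  let ?P = "hat_measure G S \<mu>" and ?N = "M * (card S ^ M * K * card S)"
  define I where "I = {A. A \<noteq> {} \<and> finite A \<and> A \<subseteq> carrier G \<and> card A \<le> K}"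
  define X where "X A = {\<omega>\<in>space ?P. \<omega> \<in> H \<and> hat_level \<omega> x n = A}" for A
  define Y where "Y A = {\<omega>\<in>space ?P. hat_level \<omega> x n = A \<and> \<not> (\<exists>y\<in>carrier G. (y, n + M + J) \<in> hat.tree \<omega> x)}" for A
  define XF where "XF A F = {\<omega>\<in>space ?P. \<omega> \<in> X A \<and> low_tree_edges \<omega> x n M t0 = F}" for A F
  have q01: "0 \<le> q" "q \<le> 1" using hat.mu.prob_le_1 by (auto simp: q)
  have mH: "H \<in> sets ?P"
    unfolding H hat_measure_def
    by (intro sets.sets_Collect_conj sets.sets_Collect_neg hat.sets_good hat.sets_reach hat.sets_level_size_le
        sets.sets_Collect_countable_Ex' hat.sets_tree countable_carrier hat.sets_few_edges
        sets_hat_bad[unfolded hat_measure_def]) auto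
  have HS: "{\<omega>\<in>space ?P. \<omega> \<in> H} \<in> sets ?P"
  proof -
    have "{\<omega>\<in>space ?P. \<omega> \<in> H} = H" unfolding H by blast
    then show ?thesis using mH by simp
  qed
  have mX: "X A \<in> sets ?P" for A
    unfolding X_def
    by (intro sets.sets_Collect_conj HS hat.sets_tree_level_eq[folded hat_measure_def])
  have mY: "Y A \<in> sets ?P" for A
    unfolding Y_def hat_measure_def
    by (intro sets.sets_Collect_conj sets.sets_Collect_neg hat.sets_tree_level_eq hat.sets_reach)
  have mXF: "XF A F \<in> sets ?P" for A F
  proof -
    have "{\<omega>\<in>space ?P. \<omega> \<in> X A} = X A" unfolding X_def by blast
    then show ?thesis unfolding XF_def using mX[of A]
      by (intro sets.sets_Collect_conj sets_low_tree_edges) simp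
  qed
  have step: "hat.prob (X A) * (q / 2) ^ ?N \<le> hat.prob (Y A)" if A: "A \<in> I" for A
  proof -
    have cone: "finite (cone A n M)" "card (cone A n M) \<le> ?N"
      using cone_card[of A K n M] A by (auto simp: I_def)
    have single: "hat.prob (XF A F) * q ^ ?N \<le> hat.prob (Y A)" if F: "F \<in> Pow (cone A n M)" for F
    proof (cases "XF A F = {}")
      case True
      then show ?thesis using q01 by simp
    next
      case False
      then have FE: "F \<subseteq> hat_edges G S" by (auto simp: XF_def low_tree_edges_def)
      show ?thesis
      proof (rule hat.prob_resample_bound[where B = "\<lambda>_. {t1<..}" and F = F])
        show "XF A F \<in> hat.events" "Y A \<in> hat.events" using mXF mY by (simp_all add: hat_measure_def)
        show "finite F" "F \<subseteq> hat_edges G S" "card F \<le> ?N"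
          using F cone FE finite_subset card_mono[OF cone(1), of F] by auto
        show "q \<le> measure \<mu> {t1<..}" by (simp add: q)
        fix \<omega> \<omega>' assume w: "\<omega> \<in> XF A F" "\<omega>' \<in> space (Pi\<^sub>M (hat_edges G S) (\<lambda>_. \<mu>))"
          and eq: "\<And>e. e \<in> hat_edges G S - F \<Longrightarrow> \<omega>' e = \<omega> e" and up: "\<And>e. e \<in> F \<Longrightarrow> \<omega>' e \<in> {t1<..}"
        have \<omega>: "hat.good \<omega>" "level_size G (n + M) (hat.tree \<omega> x) \<le> of_nat K"
          "hat_level \<omega> x n = A" "F = low_tree_edges \<omega> x n M t0"
          "\<And>y. y \<in> carrier G \<Longrightarrow> (y, n + M + J) \<in> hat.tree \<omega> x \<Longrightarrow> \<not> hat_bad D J \<omega> (y, n + M + J)"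
          "\<And>y. y \<in> carrier G \<Longrightarrow> (y, n + M + J) \<in> hat.tree \<omega> x \<Longrightarrow>
             \<not> hat.few_edges {t0<..} (r + J) (J + M) \<omega> (y, n + M + J)"
          using w(1) unfolding XF_def X_def H by blast+
        have eq': "\<forall>e\<in>hat_edges G S - F. \<omega>' e = \<omega> e" "\<forall>e\<in>F. t1 < \<omega>' e" using eq up by auto
        have ls: "finite (hat_level \<omega> x (n + M))" "card (hat_level \<omega> x (n + M)) \<le> K"
          using hat.level_size_le[OF \<omega>(2)] by auto
        have "\<not> (\<exists>y\<in>carrier G. (y, n + M + J) \<in> hat.tree \<omega>' x)"
          using hat_tree_cut_off[OF \<omega>(1) t D \<omega>(4) eq' ls J \<omega>(5,6)] by blast
        \<comment> \<open>Raised edges have their lower end at level \<open>n\<close> or above, so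
          the tree up to level \<open>n\<close> is the same. This keeps the events
          \<open>Y A\<close> apart for different \<open>A\<close>.\<close>
        moreover have "hat_level \<omega>' x n = hat_level \<omega> x n"
        proof -
          have "(y, n) \<in> hat.tree \<omega>' x \<longleftrightarrow> (y, n) \<in> hat.tree \<omega> x" for y
          proof (rule hat_tree_cong)
            show "\<forall>e\<in>hat_edges G S. 0 \<le> \<omega> e" by (rule hat.good_nonneg[OF \<omega>(1)])
            show "\<forall>e\<in>hat_edges G S. 0 \<le> \<omega>' e" by (rule hat_raise(2)[OF \<omega>(1) t \<omega>(4) eq'])
            show "\<omega>' (u, v) = \<omega> (u, v)" if "(u, v) \<in> hat_edges G S" "snd v < n" for u v
              using that eq'(1) by (auto simp: \<omega>(4) low_tree_edges_def)
          qed simp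
          then show ?thesis by simp
        qed
        ultimately show "\<omega>' \<in> Y A" using w(2) \<omega>(3) by (simp add: Y_def hat_measure_def)
      qed (use q01 in auto)
    qed
    have "X A = (\<Union>F\<in>Pow (cone A n M). XF A F)"
    proof -
      have "low_tree_edges \<omega> x n M t0 \<subseteq> cone A n M" if "\<omega> \<in> X A" for \<omega>
        using low_tree_edges_cone[OF hat.good_nonneg, of \<omega> x n M t0] that unfolding X_def H by blast
      moreover have "X A \<subseteq> space ?P" unfolding X_def by blast
      ultimately show ?thesis unfolding XF_def by blast
    qed
    then have "hat.prob (X A) \<le> (\<Sum>F\<in>Pow (cone A n M). hat.prob (XF A F))"
      using cone mXF by (simp add: hat_measure_def, intro measure_UNION_le) auto
    then have "hat.prob (X A) * q ^ ?N \<le> (\<Sum>F\<in>Pow (cone A n M). hat.prob (XF A F)) * q ^ ?N"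
      using q01 by (intro mult_right_mono) auto
    also have "\<dots> = (\<Sum>F\<in>Pow (cone A n M). hat.prob (XF A F) * q ^ ?N)" by (rule sum_distrib_right)
    also have "\<dots> \<le> (\<Sum>F\<in>Pow (cone A n M). hat.prob (Y A))" by (intro sum_mono single)
    also have "\<dots> = 2 ^ card (cone A n M) * hat.prob (Y A)" using cone by (simp add: card_Pow)
    also have "\<dots> \<le> 2 ^ ?N * hat.prob (Y A)" using cone by (intro mult_right_mono power_increasing) auto
    finally show ?thesis by (simp add: power_divide field_simps)
  qed
  have "hat.prob (\<Union>A\<in>I. X A) * (q / 2) ^ ?N \<le> hat.prob (\<Union>A\<in>I. Y A)"
  proof (rule hat.prob_UN_le[OF _ _ _ _ _ _ step])
    have "countable {A. finite A \<and> A \<subseteq> carrier G}" by (rule countable_Collect_finite_subset[OF countable_carrier])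
    then show "countable I" by (rule countable_subset[rotated]) (auto simp: I_def)
    show "X A \<in> hat.events" "Y A \<in> hat.events" for A using mX mY by (simp_all add: hat_measure_def)
    show "disjoint_family_on X I" "disjoint_family_on Y I" by (auto simp: disjoint_family_on_def X_def Y_def)
  qed (use q01 in auto)
  also have "(\<Union>A\<in>I. X A) = H"
  proof -
    have "hat_level \<omega> x n \<in> I" if w: "\<omega> \<in> H" for \<omega>
    proof -
      obtain y where y: "(y, n + M + J) \<in> hat.tree \<omega> x" using w unfolding H by blast
      have "\<exists>y\<in>carrier G. (y, n) \<in> hat.tree \<omega> x"
        using hat.tree_lower[OF _ y, of n] by (auto simp: hat_edge_iff)
      moreover have "finite (hat_level \<omega> x n)" "card (hat_level \<omega> x n) \<le> K"
        using hat.level_size_le[of n "hat.tree \<omega> x" K] w unfolding H by blast+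
      ultimately show ?thesis unfolding I_def by blast
    qed
    moreover have "H \<subseteq> space ?P" unfolding H by blast
    ultimately show ?thesis unfolding X_def by blast
  qed
  also have "hat.prob (\<Union>A\<in>I. Y A) \<le> hat.prob {\<omega>\<in>space ?P. (\<exists>y\<in>carrier G. (y, n) \<in> hat.tree \<omega> x) \<and>
      \<not> (\<exists>y\<in>carrier G. (y, n + M + J) \<in> hat.tree \<omega> x)}"
  proof (rule hat.finite_measure_mono)
    show "(\<Union>A\<in>I. Y A) \<subseteq> {\<omega>\<in>space ?P. (\<exists>y\<in>carrier G. (y, n) \<in> hat.tree \<omega> x) \<and>
      \<not> (\<exists>y\<in>carrier G. (y, n + M + J) \<in> hat.tree \<omega> x)}" by (auto simp: I_def Y_def)
    show "{\<omega>\<in>space ?P. (\<exists>y\<in>carrier G. (y, n) \<in> hat.tree \<omega> x) \<and>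
      \<not> (\<exists>y\<in>carrier G. (y, n + M + J) \<in> hat.tree \<omega> x)} \<in> hat.events"
      unfolding hat_measure_def by (intro sets.sets_Collect_conj sets.sets_Collect_neg hat.sets_reach)
  qed
  finally show ?thesis .
qed

end

text \<open>Otherwise \<open>h\<close> would lose more than 1 in every \<open>J\<close> steps beyond
  \<open>k0\<close>, which a finite nonnegative starting value does not allow.\<close>

lemma bounded_increment_exists:
  fixes h :: "nat \<Rightarrow> ennreal"
  assumes fin: "\<And>k. h k < \<infinity>" and J: "0 < J"
  shows "\<exists>k\<ge>k0. h k \<le> h (k + J) + 1"
proof (rule ccontr)
  assume no: "\<not> ?thesis"
  have gt: "h (k + J) + 1 < h k" if "k0 \<le> k" for k
    using no that by (meson not_le)
  have "h (k0 + i * J) + of_nat i \<le> h k0" for i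
  proof (induction i)
    case (Suc i)
    have "h (k0 + Suc i * J) + of_nat (Suc i) = h ((k0 + i * J) + J) + 1 + of_nat i" by (simp add: ac_simps)
    also have "\<dots> \<le> h (k0 + i * J) + of_nat i" using gt[of "k0 + i * J"] by (intro add_right_mono) auto
    finally show ?case using Suc by (rule order_trans)
  qed simp
  then have le: "of_nat i \<le> h k0" for i
    using order_trans[of "of_nat i" "h (k0 + i * J) + of_nat i" "h k0"] by simp
  obtain i where "h k0 < of_nat i" using ennreal_Ex_less_of_nat[of "h k0"] fin[of k0] by auto
  with le[of i] show False by simp
qed

section \<open>Almost sure finiteness of the directed tree\<close>

context layered_fpp
begin

lemma sets_reach_all: "{\<omega>\<in>space \<P>. \<forall>n. \<exists>y\<in>carrier G. (y, n) \<in> tree \<omega> x} \<in> sets \<P>"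
  by (rule sets.sets_Collect_countable_All[OF sets_reach])

lemma AE_tree_finite:
  assumes step: "\<And>u v. l u v \<in> E \<Longrightarrow> snd u \<le> Suc (snd v)"
    and null: "prob {\<omega>\<in>space \<P>. \<forall>n. \<exists>y\<in>carrier G. (y, n) \<in> tree \<omega> x} = 0"
  shows "AE \<omega> in \<P>. \<exists>n0. \<forall>n\<ge>n0. \<forall>y. (y, n) \<notin> tree \<omega> x"
proof -
  have "{\<omega>\<in>space \<P>. \<forall>n. \<exists>y\<in>carrier G. (y, n) \<in> tree \<omega> x} \<in> null_sets \<P>"
    using null sets_reach_all by (intro null_setsI) (simp_all add: P.emeasure_eq_measure)
  from AE_not_in[OF this] AE_space show ?thesis
  proof eventually_elim
    case (elim \<omega>)
    then obtain n0 where n0: "\<not> (\<exists>y\<in>carrier G. (y, n0) \<in> tree \<omega> x)" by blast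
    have "(y, n) \<notin> tree \<omega> x" if "n0 \<le> n" for n y
      using tree_lower[OF step, of "(y, n)" \<omega> x n0] n0 that by auto
    then show ?case by blast
  qed
qed

end

context cayley_fpp
begin

lemma hat_edge_level: "(u, v) \<in> hat_edges G S \<Longrightarrow> snd u \<le> Suc (snd v)"
  by (simp add: hat_edge_iff)

lemma hat_tree_finite:
  assumes mean: "integrable \<mu> (\<lambda>t. t)" and x: "x \<in> carrier G"
  shows "AE \<omega> in hat_measure G S \<mu>. \<exists>n0. \<forall>n\<ge>n0. \<forall>y. (y, n) \<notin> hat.tree \<omega> x"
proof -
  let ?P = "hat_measure G S \<mu>"
  define R where "R n = {\<omega>\<in>space ?P. \<exists>y\<in>carrier G. (y, n) \<in> hat.tree \<omega> x}" for n
  define I where "I = {\<omega>\<in>space ?P. \<forall>n. \<exists>y\<in>carrier G. (y, n) \<in> hat.tree \<omega> x}"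
  define \<delta> where "\<delta> = hat.prob I"
  have "\<delta> = 0"
  proof (rule ccontr)
    assume "\<delta> \<noteq> 0"
    then have \<delta>: "0 < \<delta>" by (simp add: \<delta>_def zero_less_measure_iff)
    have "(\<integral>\<^sup>+ t. ennreal t \<partial>\<mu>) \<le> (\<integral>\<^sup>+ t. ennreal (norm t) \<partial>\<mu>)" by (intro nn_integral_mono ennreal_leI) simp
    also have "\<dots> < \<infinity>" using mean by (simp add: integrable_iff_bounded)
    finally have mfin: "(\<integral>\<^sup>+ t. ennreal t \<partial>\<mu>) < \<infinity>" .
    define m where "m = enn2real (\<integral>\<^sup>+ t. ennreal t \<partial>\<mu>)"
    have m: "(\<integral>\<^sup>+ t. ennreal t \<partial>\<mu>) = ennreal m" "0 \<le> m" using mfin by (simp_all add: m_def)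
    define h where "h k = (\<integral>\<^sup>+ \<omega>. hat.dn \<omega> (\<one>, k) \<partial>?P)" for k
    have hfin: "h k < \<infinity>" for k
      unfolding h_def hat_measure_def using hat.nn_integral_dn_finite[OF mfin, of "(\<one>, k)"] by simp
    \<comment> \<open>The constants are fixed in the order \<open>K\<close>, \<open>J\<close>,
      \<open>D\<close>, \<open>r\<close>, \<open>M\<close>, \<open>n\<close>. Each of the
      exceptional events \<open>N1\<close> to \<open>N4\<close> gets probability at most
      \<open>\<delta> / 8\<close>, and \<open>N0\<close> is null, so \<open>H\<close> retains at
      least \<open>\<delta> / 2\<close>.\<close>
    obtain K :: nat where K: "8 / \<delta> < real K" using reals_Archimedean2 by blast
    have "0 < 8 / \<delta>" using \<delta> by simp
    then have "0 < real K" using K by linarith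
    then have K0: "0 < K" by simp
    then have K1: "1 / real K \<le> \<delta> / 8" using K \<delta> by (simp add: field_simps)
    define J where "J = 2 * K"
    define \<theta> where "\<theta> = 1 / (4 * real (card S))"
    have \<theta>: "0 < \<theta>" "4 * real (card S) * \<theta> \<le> 1" "\<theta> < 1" using card_S_pos by (auto simp: \<theta>_def divide_simps)
    obtain t0 t1 where t: "0 < t0" "t0 < t1" "measure \<mu> {t0<..} = \<theta>" "0 < measure \<mu> {t1<..}"
      using hat.upper_quantiles[OF \<theta>(1,3)] by blast
    define q where "q = measure \<mu> {t1<..}"
    \<comment> \<open>\<open>A / D\<close> is the bound from \<open>prob_hat_bad\<close>; the choice
      of \<open>D\<close> below turns it into \<open>\<delta> / 8\<close>.\<close>
    define A where "A = real (card S ^ J) * (real (Suc J) * m + 1)"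
    have A0: "0 < A" using card_S_pos m(2) by (simp add: A_def add_nonneg_pos)
    define D where "D = 8 * A / \<delta>"
    have D: "0 < D" using A0 \<delta> by (simp add: D_def)
    obtain r :: nat where "D / (t1 - t0) < real r" using reals_Archimedean2 by blast
    then have r: "D < real r * (t1 - t0)" using t by (simp add: divide_simps)
    \<comment> \<open>\<open>M\<close> has to be chosen after \<open>r\<close>: it makes paths of
      \<open>J + M\<close> edges long enough to contain \<open>r + J\<close> light ones.\<close>
    have "(\<lambda>M. (1/2) ^ M / \<theta> ^ (r + J)) \<longlonglongrightarrow> 0 / \<theta> ^ (r + J)"
      using \<theta> by (intro tendsto_divide LIMSEQ_realpow_zero tendsto_const) auto
    then have "eventually (\<lambda>M. (1/2) ^ M / \<theta> ^ (r + J) < \<delta> / 8) sequentially"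
      using \<delta> by (intro order_tendstoD) auto
    then obtain M where "\<And>k. M \<le> k \<Longrightarrow> (1/2) ^ k / \<theta> ^ (r + J) < \<delta> / 8" by (auto simp: eventually_sequentially)
    then have M: "(1/2) ^ (J + M) / \<theta> ^ (r + J) < \<delta> / 8" by simp
    define c where "c = (q / 2) ^ (M * (card S ^ M * K * card S))"
    have c: "0 < c" using t by (simp add: c_def q_def)
    define X where "X n = {\<omega>\<in>space ?P. (\<exists>y\<in>carrier G. (y, n) \<in> hat.tree \<omega> x) \<and>
      \<not> (\<exists>y\<in>carrier G. (y, n + M + J) \<in> hat.tree \<omega> x)}" for n
    have lower: "\<exists>y\<in>carrier G. (y, n) \<in> hat.tree \<omega> x" if "(y', k) \<in> hat.tree \<omega> x" "n \<le> k" for y' n k \<omega>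
      using hat.tree_lower[OF hat_edge_level that(1), of n] that(2) by simp
    \<comment> \<open>A tree reaching all levels never satisfies the second condition of
      \<open>X n\<close>; a tree missing some level fails the first one from that level on.\<close>
    have "(\<lambda>n. hat.prob (X n)) \<longlonglongrightarrow> 0"
    proof (rule hat.prob_tendsto_0)
      show "X n \<in> hat.events" for n
        unfolding X_def hat_measure_def by (intro sets.sets_Collect_conj sets.sets_Collect_neg hat.sets_reach)
      have "\<exists>n0. \<forall>n\<ge>n0. \<omega> \<notin> X n" for \<omega>
      proof (cases "\<forall>n. \<exists>y\<in>carrier G. (y, n) \<in> hat.tree \<omega> x")
        case True
        then show ?thesis unfolding X_def by blast
      next
        case False
        then obtain n0 where "\<not> (\<exists>y\<in>carrier G. (y, n0) \<in> hat.tree \<omega> x)" by blast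
        then have "\<omega> \<notin> X n" if "n0 \<le> n" for n using lower[OF _ that] unfolding X_def by blast
        then show ?thesis by blast
      qed
      then show "AE \<omega> in Pi\<^sub>M (hat_edges G S) (\<lambda>_. \<mu>). \<exists>n0. \<forall>n\<ge>n0. \<omega> \<notin> X n" by simp
    qed
    then have "eventually (\<lambda>n. hat.prob (X n) < \<delta> / 4 * c) sequentially"
      using \<delta> c by (intro order_tendstoD) auto
    then obtain n0 where n0: "\<And>n. n0 \<le> n \<Longrightarrow> hat.prob (X n) < \<delta> / 4 * c" by (auto simp: eventually_sequentially)
    have "0 < J" using K0 by (simp add: J_def)
    from bounded_increment_exists[of h, OF hfin this, of "n0 + M"]
    obtain k where k: "n0 + M \<le> k" "h k \<le> h (k + J) + 1" by blast
    \<comment> \<open>The controlled increment at \<open>k\<close> concerns detours ending at level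
      \<open>k\<close>, so this has to be the upper level \<open>n + M\<close> of the raised
      zone.\<close>
    define n where "n = k - M"
    have n: "n0 \<le> n" "k = n + M" using k by (auto simp: n_def)
    define H where "H = {\<omega>\<in>space ?P. hat.good \<omega> \<and> (\<exists>y\<in>carrier G. (y, n + M + J) \<in> hat.tree \<omega> x) \<and>
      level_size G n (hat.tree \<omega> x) \<le> of_nat K \<and> level_size G (n + M) (hat.tree \<omega> x) \<le> of_nat K \<and>
      \<not> (\<exists>y\<in>carrier G. (y, n + M + J) \<in> hat.tree \<omega> x \<and> hat_bad D J \<omega> (y, n + M + J)) \<and>
      \<not> (\<exists>y\<in>carrier G. (y, n + M + J) \<in> hat.tree \<omega> x \<and> hat.few_edges {t0<..} (r + J) (J + M) \<omega> (y, n + M + J))}"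
    define N0 where "N0 = {\<omega>\<in>space ?P. \<not> hat.good \<omega>}"
    define N1 where "N1 = {\<omega>\<in>space ?P. \<not> level_size G n (hat.tree \<omega> x) \<le> of_nat K}"
    define N2 where "N2 = {\<omega>\<in>space ?P. \<not> level_size G (n + M) (hat.tree \<omega> x) \<le> of_nat K}"
    define N3 where "N3 = {\<omega>\<in>space ?P. \<exists>y\<in>carrier G. (y, n + M + J) \<in> hat.tree \<omega> x \<and> hat_bad D J \<omega> (y, n + M + J)}"
    define N4 where "N4 = {\<omega>\<in>space ?P. \<exists>y\<in>carrier G. (y, n + M + J) \<in> hat.tree \<omega> x \<and>
        hat.few_edges {t0<..} (r + J) (J + M) \<omega> (y, n + M + J)}"
    have mN: "N0 \<in> hat.events" "N1 \<in> hat.events" "N2 \<in> hat.events" "N3 \<in> hat.events" "N4 \<in> hat.events"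
      unfolding N0_def N1_def N2_def N3_def N4_def hat_measure_def
      by (intro sets.sets_Collect_conj sets.sets_Collect_neg hat.sets_good hat.sets_level_size_le
        sets.sets_Collect_countable_Ex' hat.sets_tree countable_carrier hat.sets_few_edges
        sets_hat_bad[unfolded hat_measure_def]; simp)+
    have mH: "H \<in> hat.events"
      unfolding H_def hat_measure_def
      by (intro sets.sets_Collect_conj sets.sets_Collect_neg hat.sets_good hat.sets_reach hat.sets_level_size_le
        sets.sets_Collect_countable_Ex' hat.sets_tree countable_carrier hat.sets_few_edges
        sets_hat_bad[unfolded hat_measure_def]) auto
    have p0: "hat.prob N0 = 0"
    proof -
      have "hat.prob N0 = 0 \<longleftrightarrow> (AE \<omega> in Pi\<^sub>M (hat_edges G S) (\<lambda>_. \<mu>). \<omega> \<notin> N0)"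
        using mN(1) by (rule hat.prob_eq_0)
      moreover have "AE \<omega> in Pi\<^sub>M (hat_edges G S) (\<lambda>_. \<mu>). \<omega> \<notin> N0"
        using hat.AE_good by eventually_elim (simp add: N0_def)
      ultimately show ?thesis by blast
    qed
    have p1: "hat.prob N1 \<le> \<delta> / 8"
      using hat.prob_level_size_le[of n x K] x K0 K1 unfolding N1_def hat_measure_def by simp
    have p2: "hat.prob N2 \<le> \<delta> / 8"
      using hat.prob_level_size_le[of "n + M" x K] x K0 K1 unfolding N2_def hat_measure_def by simp
    have p3: "hat.prob N3 \<le> \<delta> / 8"
    proof -
      have "hat.prob N3 \<le> hat.prob {\<omega>\<in>space ?P. hat_bad D J \<omega> (\<one>, n + M + J)}"
        unfolding N3_def hat_measure_def
        by (rule hat.prob_tree_Q_le[OF sets_hat_bad[unfolded hat_measure_def] hat_bad_\<tau> _ x]) auto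
      also have "\<dots> \<le> real (card S ^ J) * ((real (Suc J) * m + 1) / D)"
        using k(2) unfolding n(2) h_def by (rule prob_hat_bad[OF m D])
      also have "\<dots> = A / D" by (simp add: A_def)
      also have "\<dots> = \<delta> / 8" using A0 \<delta> by (simp add: D_def)
      finally show ?thesis .
    qed
    have p4: "hat.prob N4 \<le> \<delta> / 8"
    proof (rule order_trans[OF _ less_imp_le[OF M]])
      show "hat.prob N4 \<le> (1/2) ^ (J + M) / \<theta> ^ (r + J)"
        using hat.prob_tree_few_edges[of "{t0<..}" \<theta> "n + M + J" x "r + J" "J + M"] t \<theta> x
        unfolding N4_def hat_measure_def by simp
    qed
    have "I \<subseteq> H \<union> (N0 \<union> (N1 \<union> (N2 \<union> (N3 \<union> N4))))"
      unfolding I_def H_def N0_def N1_def N2_def N3_def N4_def by blast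
    then have "\<delta> \<le> hat.prob (H \<union> (N0 \<union> (N1 \<union> (N2 \<union> (N3 \<union> N4)))))"
      unfolding \<delta>_def using mH mN by (intro hat.finite_measure_mono) auto
    also have "\<dots> \<le> hat.prob H + (hat.prob N0 + (hat.prob N1 + (hat.prob N2 + (hat.prob N3 + hat.prob N4))))"
      using mH mN by (intro order_trans[OF measure_Un_le] add_left_mono sets.Un order_refl) auto
    finally have pH: "\<delta> / 2 \<le> hat.prob H" using p0 p1 p2 p3 p4 by linarith
    have "hat.prob H * c \<le> hat.prob (X n)"
      unfolding c_def X_def using t D r
      by (intro prob_hat_cut_off[where r = r and D = D and ?t0.0 = t0 and ?t1.0 = t1]) (auto simp: J_def q_def H_def)
    moreover have "\<delta> / 2 * c \<le> hat.prob H * c" using pH c by (intro mult_right_mono) auto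
    moreover have "\<delta> / 4 * c < \<delta> / 2 * c" using \<delta> c by (intro mult_strict_right_mono) auto
    ultimately show False using n0[OF n(1)] by linarith
  qed
  then have "hat.prob {\<omega>\<in>space ?P. \<forall>n. \<exists>y\<in>carrier G. (y, n) \<in> hat.tree \<omega> x} = 0" by (simp add: \<delta>_def I_def)
  then show ?thesis
    using hat.AE_tree_finite[OF hat_edge_level] unfolding hat_measure_def by blast
qed

end

subsection \<open>The undirected graph\<close>

text \<open>An upper bound for the passage time, witnessed by a walk. Such bounds add up under
  concatenation, without infima or loop erasure.\<close>

definition conn :: "'v set \<Rightarrow> 'e set \<Rightarrow> ('v \<Rightarrow> 'v \<Rightarrow> 'e) \<Rightarrow> ('e \<Rightarrow> real) \<Rightarrow> 'v \<Rightarrow> 'v \<Rightarrow> real \<Rightarrow> bool" where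
  "conn V E l \<omega> u v c \<longleftrightarrow> (\<exists>t. fpp_walk V E l t \<and> hd t = u \<and> last t = v \<and> path_weight l \<omega> t \<le> c)"

lemma conn_refl: "u \<in> V \<Longrightarrow> 0 \<le> c \<Longrightarrow> conn V E l \<omega> u u c"
  unfolding conn_def by (intro exI[of _ "[u]"]) (simp add: fpp_walk_simps)

lemma conn_edge: "u \<in> V \<Longrightarrow> v \<in> V \<Longrightarrow> l u v \<in> E \<Longrightarrow> \<omega> (l u v) \<le> c \<Longrightarrow> conn V E l \<omega> u v c"
  unfolding conn_def by (intro exI[of _ "[u, v]"]) (simp add: fpp_walk_simps)

lemma conn_trans:
  assumes "conn V E l \<omega> u v c" "conn V E l \<omega> v w d"
  shows "conn V E l \<omega> u w (c + d)"
proof -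
  obtain t1 where t1: "fpp_walk V E l t1" "hd t1 = u" "last t1 = v" "path_weight l \<omega> t1 \<le> c"
    using assms(1) by (auto simp: conn_def)
  obtain t2 where t2: "fpp_walk V E l t2" "hd t2 = v" "last t2 = w" "path_weight l \<omega> t2 \<le> d"
    using assms(2) by (auto simp: conn_def)
  have ne: "t1 \<noteq> []" "t2 \<noteq> []" using t1 t2 by (auto simp: fpp_walk_def)
  define a where "a = butlast t1"
  have a: "t1 = a @ [v]" using append_butlast_last_id[OF ne(1)] t1(3) by (simp add: a_def)
  obtain b where b: "t2 = v # b" using ne(2) t2(2) by (cases t2) auto
  have "fpp_walk V E l (a @ v # b)"
    using t1(1) t2(1) fpp_walk_append'[of V E l a v b] by (simp add: a b)
  moreover have "hd (a @ v # b) = u" using t1(2) a by (cases a) auto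
  moreover have "last (a @ v # b) = w" using t2(3) b by simp
  moreover have "path_weight l \<omega> (a @ v # b) \<le> c + d"
    using t1(4) t2(4) path_weight_append'[of l \<omega> a v b] by (simp add: a b)
  ultimately show ?thesis unfolding conn_def by blast
qed

lemma conn_mono: "conn V E l \<omega> u v c \<Longrightarrow> c \<le> d \<Longrightarrow> conn V E l \<omega> u v d"
  unfolding conn_def by (blast intro: order_trans)

context cayley_fpp
begin

abbreviation bl :: "'a \<times> nat \<Rightarrow> 'a \<times> nat \<Rightarrow> ('a \<times> nat) set" where "bl u v \<equiv> {u, v}"

lemma bar_edge_iff: "{u, v} \<in> bar_edges G S \<longleftrightarrow> fst u \<in> carrier G \<and> fst v \<in> carrier G \<and>
   (nbr (fst u) (fst v) \<and> snd u = snd v \<and> 1 \<le> snd u \<or> fst u = fst v \<and> (snd u = Suc (snd v) \<or> snd v = Suc (snd u)))"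
proof
  assume "{u, v} \<in> bar_edges G S"
  then obtain x y m n where e: "{u, v} = {(x, m), (y, n)}" "x \<in> carrier G" "y \<in> carrier G"
     "nbr x y \<and> m = n \<and> 1 \<le> n \<or> x = y \<and> \<bar>int m - int n\<bar> = 1" unfolding bar_edges_def by blast
  have "nbr x y \<Longrightarrow> nbr y x" by (rule nbr_sym)
  with e show "fst u \<in> carrier G \<and> fst v \<in> carrier G \<and>
   (nbr (fst u) (fst v) \<and> snd u = snd v \<and> 1 \<le> snd u \<or> fst u = fst v \<and> (snd u = Suc (snd v) \<or> snd v = Suc (snd u)))"
    by (auto simp: doubleton_eq_iff)
next
  assume r: "fst u \<in> carrier G \<and> fst v \<in> carrier G \<and>
   (nbr (fst u) (fst v) \<and> snd u = snd v \<and> 1 \<le> snd u \<or> fst u = fst v \<and> (snd u = Suc (snd v) \<or> snd v = Suc (snd u)))"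
  then have "nbr (fst u) (fst v) \<and> snd u = snd v \<and> 1 \<le> snd v \<or> fst u = fst v \<and> \<bar>int (snd u) - int (snd v)\<bar> = 1"
    by auto
  then show "{u, v} \<in> bar_edges G S" unfolding bar_edges_def using r
    by (intro CollectI exI[of _ "fst u"] exI[of _ "fst v"] exI[of _ "snd u"] exI[of _ "snd v"]) simp
qed

lemma bar_edge_cases:
  assumes "e \<in> bar_edges G S"
  shows "\<exists>u v. fst u \<in> carrier G \<and> fst v \<in> carrier G \<and> e = {u, v}"
proof -
  obtain x m y n where "e = {(x, m), (y, n)}" "x \<in> carrier G" "y \<in> carrier G"
    using assms unfolding bar_edges_def by blast
  then show ?thesis by (intro exI[of _ "(x, m)"] exI[of _ "(y, n)"]) simp
qed

lemma countable_bar_edges: "countable (bar_edges G S)"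
proof (rule countable_subset)
  show "bar_edges G S \<subseteq> (\<lambda>(u, v). {u, v}) ` ((carrier G \<times> UNIV) \<times> (carrier G \<times> UNIV))"
  proof
    fix e assume "e \<in> bar_edges G S"
    from bar_edge_cases[OF this] obtain u v where "fst u \<in> carrier G" "fst v \<in> carrier G" "e = {u, v}" by blast
    then show "e \<in> (\<lambda>(u, v). {u, v}) ` ((carrier G \<times> UNIV) \<times> (carrier G \<times> UNIV))"
      by (intro image_eqI[of _ _ "(u, v)"]) (auto simp: mem_Times_iff)
  qed
  show "countable ((\<lambda>(u, v). {u, v}) ` ((carrier G \<times> (UNIV :: nat set)) \<times> (carrier G \<times> (UNIV :: nat set))))"
    by (intro countable_image countable_SIGMA countable_carrier) auto
qed

text \<open>The column below a vertex leads to level 0 and stays inside \<open>L\<close> because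
  \<open>L\<close> is closed downwards. A vertex has at most \<open>card S\<close> horizontal and
  two vertical edges.\<close>

lemma bar_layered:
  assumes L: "0 \<in> L" "\<And>m n. n \<in> L \<Longrightarrow> m \<le> n \<Longrightarrow> m \<in> L"
  shows "layered_fpp (bar_edges G S) \<mu> G L bl (\<lambda>g e. shift_vertex G g ` e) (card S + 2)"
proof -
  interpret iid_weights "bar_edges G S" \<mu>
    using countable_bar_edges real_distribution_mu non_atomic_mu nonneg_mu by (rule iid_weights.intro)
  show ?thesis
  proof unfold_locales
    show "countable (carrier G)" by (rule countable_carrier)
    show "0 \<in> L" by (rule L)
    show "0 < card S + 2" by simp
    show "finite {v. {u, v} \<in> bar_edges G S} \<and> card {v. {u, v} \<in> bar_edges G S} \<le> card S + 2" for u
    proof -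
      \<comment> \<open>At level 0 truncated subtraction merely puts \<open>u\<close> itself into
        this superset of its neighbours.\<close>
      let ?U = "(\<lambda>y. (y, snd u)) ` {y. nbr (fst u) y} \<union> {(fst u, Suc (snd u)), (fst u, snd u - 1)}"
      have sub: "{v. {u, v} \<in> bar_edges G S} \<subseteq> ?U"
      proof
        fix v assume "v \<in> {v. {u, v} \<in> bar_edges G S}"
        then show "v \<in> ?U" by (cases v) (auto simp: bar_edge_iff)
      qed
      have fin: "finite ?U" using nbr_finite[of "fst u"] by auto
      have "card ?U \<le> card ((\<lambda>y. (y, snd u)) ` {y. nbr (fst u) y}) + card {(fst u, Suc (snd u)), (fst u, snd u - 1)}"
        by (rule card_Un_le)
      also have "\<dots> \<le> card S + 2"
      proof (rule add_mono)
        show "card ((\<lambda>y. (y, snd u)) ` {y. nbr (fst u) y}) \<le> card S"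
          using nbr_finite[of "fst u"] card_image_le le_trans by blast
        show "card {(fst u, Suc (snd u)), (fst u, snd u - 1)} \<le> 2" by (simp add: card_insert_if)
      qed
      finally show ?thesis using card_mono[OF fin sub] finite_subset[OF sub fin] by linarith
    qed
    show "shift_vertex G g ` {u, v} = {shift_vertex G g u, shift_vertex G g v}" for g u v by simp
    show "shift_vertex G g ` e \<in> bar_edges G S" if g: "g \<in> carrier G" "e \<in> bar_edges G S" for g e
    proof -
      obtain u v where e: "e = {u, v}" using bar_edge_cases[OF g(2)] by blast
      then have "{shift_vertex G g u, shift_vertex G g v} \<in> bar_edges G S"
        using g nbr_mult[OF g(1), of "fst u" "fst v"] by (auto simp: bar_edge_iff shift_vertex_def)
      then show ?thesis by (simp add: e)
    qed
    show "\<exists>u v. fst u \<in> carrier G \<and> fst v \<in> carrier G \<and> e = {u, v}" if "e \<in> bar_edges G S" for e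
      using that by (rule bar_edge_cases)
    show "\<exists>p. fpp_walk (carrier G \<times> L) (bar_edges G S) bl p \<and> hd p = u \<and> snd (last p) = 0"
      if uL: "u \<in> carrier G \<times> L" for u
    proof -
      obtain y n where u: "u = (y, n)" "y \<in> carrier G" "n \<in> L" using uL by (cases u) auto
      have "\<exists>p. fpp_walk (carrier G \<times> L) (bar_edges G S) bl p \<and> hd p = (y, n) \<and> snd (last p) = 0"
        using u(3)
      proof (induction n)
        case 0
        then show ?case using u(2) by (intro exI[of _ "[(y, 0)]"]) (simp add: fpp_walk_simps)
      next
        case (Suc n)
        then have "n \<in> L" using L(2) by auto
        from Suc.IH[OF this] obtain p where p: "fpp_walk (carrier G \<times> L) (bar_edges G S) bl p"
           "hd p = (y, n)" "snd (last p) = 0" by blast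
        then obtain p' where p': "p = (y, n) # p'" by (cases p) (auto simp: fpp_walk_def)
        then show ?case using p Suc(2) u(2)
          by (intro exI[of _ "(y, Suc n) # p"]) (auto simp: fpp_walk_simps bar_edge_iff)
      qed
      then show ?thesis using u by simp
    qed
  qed
qed

sublocale bar: layered_fpp "bar_edges G S" \<mu> G UNIV bl "\<lambda>g e. shift_vertex G g ` e" "card S + 2"
  by (rule bar_layered) auto

text \<open>A path to some point outside \<open>A\<close> is cut at its first exit and its loops are
  erased. All vertices but the last are then distinct elements of \<open>A\<close>, which leaves at
  most \<open>K\<close> edges.\<close>

lemma exit_path:
  assumes A: "finite A" "card A \<le> K" "A \<subseteq> carrier G" "b \<in> A"
  shows "\<exists>g. g \<noteq> [] \<and> hd g = b \<and> last g \<notin> A \<and> successively nbr g \<and> set (butlast g) \<subseteq> A \<and> length g \<le> Suc K"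
proof -
  have "\<not> carrier G \<subseteq> A" using infinite_carrier finite_subset[OF _ A(1)] by blast
  then obtain z0 where z0: "z0 \<in> carrier G" "z0 \<notin> A" by blast
  have "nbr\<^sup>*\<^sup>* b z0" using A z0 by (intro connected) auto
  from walk_exists[OF this] obtain g0 where g0: "g0 \<noteq> []" "hd g0 = b" "last g0 = z0" "successively nbr g0" by blast
  have "\<exists>z\<in>set g0. z \<notin> A" using z0(2) last_in_set[OF g0(1)] g0(3) by blast
  from split_list_first_prop[OF this] obtain ys z zs where
    s: "g0 = ys @ z # zs" "z \<notin> A" "\<forall>y\<in>set ys. \<not> y \<notin> A" by blast
  have ys: "ys \<noteq> []"
  proof
    assume "ys = []"
    then have "b = z" using s(1) g0(2) by simp
    then show False using s(2) A(4) by blast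
  qed
  let ?E = "{(u, v). nbr u v}"
  have "fpp_walk (carrier G) ?E Pair (ys @ [z])"
  proof -
    have "successively nbr (ys @ [z])" using g0(4) unfolding s(1) successively_append_iff by (auto simp: ys)
    moreover have "z \<in> carrier G"
      using g0(4) ys nbr_carrier(2) unfolding s(1) successively_append_iff by auto
    ultimately show ?thesis using s(3) A(3) by (auto simp: fpp_walk_def)
  qed
  \<comment> \<open>Weights 0 satisfy the sign condition; only the loop erasure itself is of
    interest.\<close>
  from loop_erase[where \<omega> = "\<lambda>_. 0", OF _ this] obtain q where q: "fpp_path (carrier G) ?E Pair q"
    "hd q = hd (ys @ [z])" "last q = z" "set q \<subseteq> set (ys @ [z])" by auto
  have qne: "q \<noteq> []" using q(1) by (simp add: fpp_path_def)
  have eq: "butlast q @ [z] = q" using append_butlast_last_id[OF qne] q(3) by simp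
  have dist: "distinct (butlast q @ [z])" using q(1) unfolding eq fpp_path_def by blast
  have sub: "set (butlast q) \<subseteq> A"
  proof
    fix y assume y: "y \<in> set (butlast q)"
    then have "y \<in> set (ys @ [z])" using q(4) in_set_butlastD[OF y] by blast
    moreover have "y \<noteq> z" using y dist by auto
    ultimately show "y \<in> A" using s(3) by auto
  qed
  have "length (butlast q) = card (set (butlast q))" using dist by (simp add: distinct_card)
  also have "\<dots> \<le> K" using card_mono[OF A(1) sub] A(2) by linarith
  finally have "length q \<le> Suc K" by (simp add: length_butlast)
  moreover have "hd q = b" using q(2) ys g0(2) s(1) by simp
  moreover have "successively nbr q" using q(1) by (simp add: fpp_path_def)
  ultimately show ?thesis using qne sub q(3) s(2) by blast
qed

end

section \<open>Last exits, projections and the undirected cut-off\<close>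

lemma geodesic_to_subgraph:
  assumes "geodesic_to V E l \<omega> A q" "set q \<subseteq> V'" "V' \<subseteq> V"
  shows "geodesic_to V' E l \<omega> A q"
  using assms unfolding geodesic_to_iff fpp_path_def by blast

lemma path_weight_gt:
  assumes "successively (\<lambda>u v. s < \<omega> (l u v)) p" "2 \<le> length p"
  shows "s * (real (length p) - 1) < path_weight l \<omega> p"
proof -
  have ge: "successively (\<lambda>u v. s < \<omega> (l u v)) p \<Longrightarrow> p \<noteq> [] \<Longrightarrow> s * (real (length p) - 1) \<le> path_weight l \<omega> p" for p
  proof (induction p rule: induct_list012)
    case (3 u v p)
    then have "s * (real (length (v # p)) - 1) \<le> path_weight l \<omega> (v # p)" "s < \<omega> (l u v)" by auto
    then show ?case by (simp add: algebra_simps)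
  qed auto
  obtain u v p' where p: "p = u # v # p'" using assms(2) by (cases p; cases "tl p") auto
  have "s * (real (length (v # p')) - 1) \<le> path_weight l \<omega> (v # p')" "s < \<omega> (l u v)"
    using ge[of "v # p'"] assms(1) p by auto
  then show ?thesis unfolding p by (simp add: algebra_simps)
qed

lemma successively_between:
  "cs \<noteq> [] \<Longrightarrow> \<forall>c\<in>set cs. C c \<Longrightarrow> successively (\<lambda>u v. C u \<or> C v) (q # cs @ [r])"
proof (induction cs arbitrary: q)
  case (Cons c cs)
  then show ?case by (cases "cs = []") auto
qed simp

lemma successively_conj:
  "successively P xs \<Longrightarrow> successively Q xs \<Longrightarrow> successively (\<lambda>u v. P u v \<and> Q u v) xs"
  by (induction xs rule: induct_list012) auto

context cayley_fpp
begin

abbreviation bV where "bV \<equiv> carrier G \<times> (UNIV :: nat set)"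
abbreviation BE where "BE \<equiv> bar_edges G S"
abbreviation bconn where "bconn \<omega> u v c \<equiv> conn bV BE bl \<omega> u v c"
abbreviation bwalk where "bwalk \<equiv> fpp_walk bV BE bl"
abbreviation trunc_tree where
  "trunc_tree n \<omega> x \<equiv> geodesic_tree (carrier G \<times> {..n}) BE bl \<omega> (level G 0) (x, 0)"

text \<open>The last step from above level \<open>n\<close> changes the level, so it runs vertically
  down one column.\<close>

lemma last_exit:
  assumes w: "fpp_walk V BE bl p" and hd: "n < snd (hd p)" and last: "snd (last p) = 0"
  shows "\<exists>ys a zs. p = ys @ (a, Suc n) # (a, n) # zs \<and> (\<forall>z\<in>set ((a, n) # zs). snd z \<le> n)"
proof -
  have ne: "p \<noteq> []" using w by (simp add: fpp_walk_def)
  have "\<exists>v\<in>set p. n < snd v" using hd hd_in_set[OF ne] by blast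
  from split_list_last_prop[OF this] obtain ys u zs where
    p: "p = ys @ u # zs" "n < snd u" "\<forall>z\<in>set zs. \<not> n < snd z" by blast
  have "zs \<noteq> []" using p last by auto
  then obtain v zs' where zs: "zs = v # zs'" by (cases zs) auto
  have "{u, v} \<in> BE" using w unfolding p(1) zs fpp_walk_def successively_append_iff by auto
  moreover have "snd v \<le> n" using p(3) zs by auto
  ultimately have "fst u = fst v" "snd v = n" "snd u = Suc n" using p(2) by (auto simp: bar_edge_iff)
  then have "u = (fst v, Suc n)" "v = (fst v, n)" by (metis prod.collapse)+
  then have "p = ys @ (fst v, Suc n) # (fst v, n) # zs'" using p(1) zs by simp
  moreover have "\<forall>z\<in>set ((fst v, n) # zs'). snd z \<le> n" using p(3) zs \<open>v = (fst v, n)\<close> by auto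
  ultimately show ?thesis by blast
qed

text \<open>After its last descent to level \<open>n\<close> the geodesic stays in the truncated
  graph, where it has fewer competitors and remains optimal. The set \<open>L\<close> is general
  because both the full graph and graphs truncated at a higher level are needed.\<close>

lemma last_exit_geodesic:
  assumes nn: "\<forall>e\<in>BE. 0 \<le> \<omega> e" and g: "geodesic_to (carrier G \<times> L) BE bl \<omega> (level G 0) p"
    and L: "{..n} \<subseteq> L" and p: "n < snd (hd p)" "last p = (x, 0)"
  shows "\<exists>ys a zs. p = ys @ (a, Suc n) # (a, n) # zs \<and> a \<in> carrier G \<and> (a, n) \<in> trunc_tree n \<omega> x"
proof -
  have pw: "fpp_walk (carrier G \<times> L) BE bl p" using g by (simp add: geodesic_to_iff fpp_path_walk)
  obtain ys a zs where
    ps: "p = ys @ (a, Suc n) # (a, n) # zs" and low: "\<forall>z\<in>set ((a, n) # zs). snd z \<le> n"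
    using last_exit[OF pw p(1)] p(2) by auto
  have sub: "set ((a, n) # zs) \<subseteq> carrier G \<times> L" using pw unfolding ps fpp_walk_def by auto
  have "geodesic_to (carrier G \<times> L) BE bl \<omega> (level G 0) ((a, n) # zs)"
    using geodesic_to_suffix[OF nn, where ?p1.0 = "ys @ [(a, Suc n)]" and ?p2.0 = "(a, n) # zs"] g ps by simp
  moreover have "set ((a, n) # zs) \<subseteq> carrier G \<times> {..n}" using sub low by (auto simp: subset_iff)
  moreover have "carrier G \<times> {..n} \<subseteq> carrier G \<times> L" using L by auto
  ultimately have "geodesic_to (carrier G \<times> {..n}) BE bl \<omega> (level G 0) ((a, n) # zs)"
    by (rule geodesic_to_subgraph)
  moreover have "last ((a, n) # zs) = (x, 0)" using p(2) ps by simp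
  ultimately have "(a, n) \<in> trunc_tree n \<omega> x" unfolding geodesic_tree_iff[OF nn]
    by (intro exI[of _ "(a, n) # zs"]) simp
  moreover have "a \<in> carrier G" using sub by auto
  ultimately show ?thesis using ps by blast
qed

text \<open>Vertical steps vanish under projection to level \<open>n\<close>, and horizontal ones
  cost at most \<open>s\<close> since they touch \<open>A\<close>. The net descent is at most the
  number of vertical steps, so it may be deducted; this credit later pays for a descent through a
  light column.\<close>

lemma conn_projection:
  assumes good: "\<And>a b. a \<in> A \<Longrightarrow> nbr a b \<Longrightarrow> \<omega> {(a, n), (b, n)} \<le> s" and s: "0 \<le> s" and n: "1 \<le> n"
  shows "bwalk w \<Longrightarrow> successively (\<lambda>u v. fst u \<in> A \<or> fst v \<in> A) w \<Longrightarrow>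
    bconn \<omega> (fst (hd w), n) (fst (last w), n)
      (s * (real (length w) - 1) - s * (real (snd (hd w)) - real (snd (last w))))"
proof (induction w rule: induct_list012)
  case 1
  then show ?case by (simp add: fpp_walk_def)
next
  case (2 u)
  then show ?case by (auto intro!: conn_refl simp: fpp_walk_simps)
next
  case (3 u v p)
  have e: "{u, v} \<in> BE" and w: "bwalk (v # p)" using 3(3) by (simp_all add: fpp_walk_simps)
  let ?c = "s * (real (length (v # p)) - 1) - s * (real (snd v) - real (snd (last (v # p))))"
  have IH: "bconn \<omega> (fst v, n) (fst (last (v # p)), n) ?c"
    using "3.IH"(2)[OF w] 3(4) by simp
  have "bconn \<omega> (fst u, n) (fst (last (v # p)), n) (s - s * (real (snd u) - real (snd v)) + ?c)"
  proof (cases "fst u = fst v")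
    case True
    then have "snd u = snd v \<or> snd u = Suc (snd v) \<or> snd v = Suc (snd u)" using e by (auto simp: bar_edge_iff)
    then have "s * (real (snd u) - real (snd v)) \<le> s * 1" by (intro mult_left_mono s) auto
    then show ?thesis unfolding True by (intro conn_mono[OF IH]) simp
  next
    case False
    then have uv: "nbr (fst u) (fst v)" "snd u = snd v" "fst u \<in> carrier G" "fst v \<in> carrier G"
      using e by (auto simp: bar_edge_iff)
    have "fst u \<in> A \<or> fst v \<in> A" using 3(4) by simp
    then have "\<omega> {(fst u, n), (fst v, n)} \<le> s"
    proof
      assume "fst v \<in> A"
      from good[OF this nbr_sym[OF uv(1)]] show ?thesis by (simp add: insert_commute)
    qed (rule good[OF _ uv(1)])
    then have "bconn \<omega> (fst u, n) (fst v, n) s"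
      using uv n by (intro conn_edge) (auto simp: bar_edge_iff)
    from conn_trans[OF this IH] show ?thesis using uv(2) by simp
  qed
  then show ?case by (simp add: algebra_simps)
qed

lemma conn_column:
  assumes z: "z \<in> carrier G" and w: "\<And>k. n \<le> k \<Longrightarrow> k < n + M \<Longrightarrow> \<omega> {(z, k), (z, Suc k)} \<le> s"
  shows "j \<le> M \<Longrightarrow> bconn \<omega> (z, n + j) (z, n) (s * real j)"
proof (induction j)
  case 0
  then show ?case using z by (auto intro!: conn_refl)
next
  case (Suc j)
  have "bconn \<omega> (z, n + Suc j) (z, n + j) s"
    using w[of "n + j"] Suc(2) z by (intro conn_edge) (auto simp: bar_edge_iff insert_commute)
  from conn_trans[OF this Suc.IH] Suc(2) show ?case by (simp add: algebra_simps)
qed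

text \<open>Both directions are used: outwards at level \<open>n + M\<close> and back at level
  \<open>n\<close>.\<close>

lemma conn_along:
  assumes j: "1 \<le> j" and c: "\<And>a b. a \<in> A \<Longrightarrow> nbr a b \<Longrightarrow> \<omega> {(a, j), (b, j)} \<le> c"
  shows "successively nbr g \<Longrightarrow> set (butlast g) \<subseteq> A \<Longrightarrow> g \<noteq> [] \<Longrightarrow> set g \<subseteq> carrier G \<Longrightarrow>
    bconn \<omega> (hd g, j) (last g, j) (c * (real (length g) - 1)) \<and> bconn \<omega> (last g, j) (hd g, j) (c * (real (length g) - 1))"
proof (induction g rule: induct_list012)
  case (2 y)
  then show ?case by (auto intro!: conn_refl)
next
  case (3 y z g)
  have yz: "y \<in> A" "nbr y z" "y \<in> carrier G" "z \<in> carrier G" using 3 by auto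
  have w: "\<omega> {(y, j), (z, j)} \<le> c" by (rule c[OF yz(1,2)])
  have "set (butlast (z # g)) \<subseteq> A" using 3(4) by auto
  then have IH: "bconn \<omega> (z, j) (last (z # g), j) (c * (real (length (z # g)) - 1))"
    "bconn \<omega> (last (z # g), j) (z, j) (c * (real (length (z # g)) - 1))"
    using 3 by auto
  have e1: "bconn \<omega> (y, j) (z, j) c" using yz w j by (intro conn_edge) (auto simp: bar_edge_iff)
  have e2: "bconn \<omega> (z, j) (y, j) c"
    using yz w j nbr_sym[OF yz(2)] by (intro conn_edge) (auto simp: bar_edge_iff insert_commute)
  show ?case using conn_trans[OF e1 IH(1)] conn_trans[OF IH(2) e2] by (simp add: algebra_simps)
qed simp

text \<open>
  A geodesic to \<open>x\<close> from above level \<open>n + M\<close> finally descends through the columns over \<open>A\<close>,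
  where all edges are heavy. Its last stretch inside these columns starts at a light column
  next to \<open>A\<close>, at level \<open>n\<close>, or at level \<open>n + M\<close>; each time the projection to level \<open>n\<close>,
  reached through a light column if necessary, is a shorter connection.
\<close>

lemma bar_tree_cut_off:
  assumes pos: "\<forall>e\<in>BE. 0 < \<omega> e" and n: "1 \<le> n" and M: "2 \<le> M"
    and A: "A = {y\<in>carrier G. (y, n) \<in> trunc_tree n \<omega> x}" "finite A" "card A \<le> K"
    and s: "0 < s" "s < s1" "0 \<le> s2" "real K * (s2 + s) < real M * (s1 - s)"
    and good: "\<And>a b. a \<in> A \<Longrightarrow> nbr a b \<Longrightarrow> \<omega> {(a, n), (b, n)} \<le> s"
    and vert: "\<And>a k. a \<in> A \<Longrightarrow> n \<le> k \<Longrightarrow> k < n + M \<Longrightarrow> s1 < \<omega> {(a, k), (a, Suc k)}"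
    and horiz: "\<And>a b k. a \<in> A \<Longrightarrow> nbr a b \<Longrightarrow> n < k \<Longrightarrow> k \<le> n + M \<Longrightarrow>
       s1 < \<omega> {(a, k), (b, k)} \<and> \<omega> {(a, k), (b, k)} \<le> s2"
    and light: "\<And>z k. z \<in> nb A - A \<Longrightarrow> n \<le> k \<Longrightarrow> k < n + M \<Longrightarrow> \<omega> {(z, k), (z, Suc k)} \<le> s"
    and k: "n + M \<le> k"
  shows "(y, k) \<notin> bar.tree \<omega> x"
proof
  assume "(y, k) \<in> bar.tree \<omega> x"
  have nn: "\<forall>e\<in>BE. 0 \<le> \<omega> e" using pos by (simp add: less_imp_le)
  obtain p where p: "bar.geod \<omega> p" "hd p = (y, k)" "last p = (x, 0)"
    using \<open>(y, k) \<in> bar.tree \<omega> x\<close> unfolding geodesic_tree_iff[OF nn] by blast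
  have pw: "bwalk p" using p(1) by (simp add: geodesic_to_iff fpp_path_walk)
  have "n < snd (hd p)" using p k M by auto
  from last_exit_geodesic[OF nn p(1) _ this p(3)] obtain ys a zs where
    ps: "p = ys @ (a, Suc n) # (a, n) # zs" and "a \<in> carrier G" "(a, n) \<in> trunc_tree n \<omega> x" by blast
  then have aA: "a \<in> A" using A(1) by blast
  \<comment> \<open>The inner vertices of the columns over \<open>A\<close>: every edge at such a
    vertex is heavy.\<close>
  define C where "C v \<longleftrightarrow> fst v \<in> A \<and> n < snd v \<and> snd v < n + M" for v :: "'a \<times> nat"
  let ?p' = "ys @ [(a, Suc n)]"
  have hdp': "hd ?p' = (y, k)" using p(2) ps by (cases ys) auto
  have "\<exists>v\<in>set ?p'. \<not> C v"
  proof (rule bexI)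
    show "\<not> C (hd ?p')" unfolding hdp' C_def using k by simp
    show "hd ?p' \<in> set ?p'" by (rule hd_in_set) simp
  qed
  \<comment> \<open>\<open>q\<close> is where the geodesic enters the columns for its final descent.
    It exists because the start, at level at least \<open>n + M\<close>, does not satisfy
    \<open>C\<close>.\<close>
  from split_list_last_prop[OF this] obtain ws q cs where
    split: "?p' = ws @ q # cs" "\<not> C q" "\<forall>c\<in>set cs. \<not> \<not> C c" by blast
  have Ca: "C (a, Suc n)" using aA M by (simp add: C_def)
  have cs: "cs \<noteq> []"
  proof
    assume "cs = []"
    then have "q = (a, Suc n)" using split(1) by simp
    then show False using split(2) Ca by simp
  qed
  let ?\<sigma> = "q # cs @ [(a, n)]"
  have p\<sigma>: "p = ws @ ?\<sigma> @ zs" using ps split(1) by (metis append.assoc append_Cons append_Nil)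
  have seg: "path_weight bl \<omega> ?\<sigma> \<le> c" if qc: "bconn \<omega> q (a, n) c" for c
  proof -
    obtain t where t: "bwalk t" "hd t = q" "last t = (a, n)" "path_weight bl \<omega> t \<le> c"
      using qc by (auto simp: conn_def)
    have "path_weight bl \<omega> ?\<sigma> \<le> path_weight bl \<omega> t"
      using p(1) t unfolding p\<sigma> by (intro geodesic_to_segment[OF nn, where t = t]) auto
    then show ?thesis using t(4) by simp
  qed
  have \<sigma>w: "bwalk ?\<sigma>" using pw unfolding p\<sigma> fpp_walk_def successively_append_iff by auto
  have Cs: "successively (\<lambda>u v. C u \<or> C v) ?\<sigma>" using cs split(3) by (intro successively_between) auto
  have heavy: "s1 < \<omega> {v, w}" if "{v, w} \<in> BE" "C w" for v w
  proof -
    obtain b j where w: "w = (b, j)" by (cases w)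
    have b: "b \<in> A" "n < j" "j < n + M" using that(2) by (auto simp: C_def w)
    from that(1) consider "nbr (fst v) b" "snd v = j" | "fst v = b" "snd v = Suc j" | "fst v = b" "j = Suc (snd v)"
      by (auto simp: bar_edge_iff w)
    then show ?thesis
    proof cases
      case 1
      then have "v = (fst v, j)" by (cases v) auto
      then show ?thesis using horiz[OF b(1) nbr_sym[OF 1(1)] b(2)] b(3) w by (simp add: insert_commute)
    next
      case 2
      then have "v = (b, Suc j)" by (cases v) auto
      then show ?thesis using vert[OF b(1), of j] b w by (simp add: insert_commute)
    next
      case 3
      then have "v = (b, j - 1)" by (cases v) auto
      then show ?thesis using vert[OF b(1), of "j - 1"] b w by simp
    qed
  qed
  have "successively (\<lambda>u v. s1 < \<omega> (bl u v)) ?\<sigma>"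
  proof (rule successively_mono[OF successively_conj[OF _ Cs]])
    show "successively (\<lambda>u v. {u, v} \<in> BE) ?\<sigma>" using \<sigma>w by (simp add: fpp_walk_def)
    fix u v assume uv: "{u, v} \<in> BE \<and> (C u \<or> C v)"
    show "s1 < \<omega> {u, v}"
    proof (cases "C v")
      case False
      then have "C u" "{v, u} \<in> BE" using uv by (auto simp: insert_commute)
      from heavy[OF this(2,1)] show ?thesis by (simp add: insert_commute)
    qed (use heavy uv in blast)
  qed
  from path_weight_gt[where l = bl and \<omega> = \<omega> and s = s1, OF this] have gt: "s1 * (real (length ?\<sigma>) - 1) < path_weight bl \<omega> ?\<sigma>" by simp
  let ?len = "real (length ?\<sigma>) - 1"
  have len: "0 \<le> ?len" by simp
  have "successively (\<lambda>u v. fst u \<in> A \<or> fst v \<in> A) ?\<sigma>"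
    by (rule successively_mono[OF Cs]) (auto simp: C_def)
  then have proj: "bconn \<omega> (fst q, n) (a, n) (s * ?len - s * (real (snd q) - real n))"
    using conn_projection[where A = A and \<omega> = \<omega> and n = n and s = s and w = "?\<sigma>"] good s(1) n \<sigma>w by simp
  have sl: "s * ?len \<le> s1 * ?len" using s len by (intro mult_right_mono) auto
  obtain b j where c1: "hd cs = (b, j)" by (cases "hd cs")
  have "C (hd cs)" using cs split(3) hd_in_set[OF cs] by blast
  then have b: "b \<in> A" "n < j" "j < n + M" by (auto simp: C_def c1)
  have cb: "b \<in> carrier G" using b(1) A(1) by blast
  obtain cs' where "cs = (b, j) # cs'" using cs c1 by (cases cs) auto
  then have "{q, (b, j)} \<in> BE" using \<sigma>w by (auto simp: fpp_walk_simps)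
  then consider "nbr (fst q) b" "snd q = j" | "fst q = b" "snd q = Suc j \<or> j = Suc (snd q)"
    by (auto simp: bar_edge_iff)
  then show False
  proof cases
    \<comment> \<open>Entry from a light column next to \<open>A\<close>: the descent in it to level
      \<open>n\<close> costs exactly the credit in \<open>proj\<close>, so the total is at most
      \<open>s * ?len\<close>, less than the heavy weight of the segment.\<close>
    case 1
    then have z: "fst q \<notin> A" using split(2) b by (auto simp: C_def)
    have q: "q = (fst q, n + (j - n))" using 1 b by (cases q) auto
    have zn: "fst q \<in> nb A - A" using z nbr_sym[OF 1(1)] b(1) by (auto simp: nb_def)
    have "bconn \<omega> (fst q, n + (j - n)) (fst q, n) (s * real (j - n))"
      using light[OF zn] nbr_carrier(1)[OF 1(1)] b by (intro conn_column[where M = M]) auto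
    from conn_trans[OF this proj] have "bconn \<omega> q (a, n) (s * real (j - n) + (s * ?len - s * (real (snd q) - real n)))"
      using q by simp
    then have "bconn \<omega> q (a, n) (s * ?len)"
      using 1(2) b(2) by (elim conn_mono) (simp add: of_nat_diff algebra_simps)
    from seg[OF this] show False using gt sl by linarith
  next
    case 2
    then have "\<not> (n < snd q \<and> snd q < n + M)" using split(2) b(1) by (simp add: C_def)
    then consider "snd q = n" | "snd q = n + M" using 2 b by linarith
    then show False
    proof cases
      case 1
      then have "q = (fst q, n)" by (cases q) auto
      then have "bconn \<omega> q (a, n) (s * ?len)" using proj 1 by simp
      from seg[OF this] show False using gt sl by linarith
    next
      \<comment> \<open>Entry from the top: leave \<open>A\<close> along level \<open>n + M\<close>,
        go down a light column, return along level \<open>n\<close>, then follow the projection. The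
        extra cost is at most \<open>K * (s2 + s)\<close>, which is less than the gain
        \<open>M * (s1 - s)\<close>.\<close>
      case top: 2
      have q: "q = (b, n + M)" using 2 top by (cases q) auto
      obtain g where g: "g \<noteq> []" "hd g = b" "last g \<notin> A" "successively nbr g" "set (butlast g) \<subseteq> A" "length g \<le> Suc K"
        using exit_path[OF A(2,3) _ b(1)] A(1) by blast
      define z where "z = last g"
      have gl: "butlast g @ [z] = g" using g(1) by (simp add: z_def)
      have gb: "butlast g \<noteq> []"
      proof
        assume "butlast g = []"
        then have "g = [z]" using gl by simp
        then show False using g(2,3) b(1) by simp
      qed
      have "nbr (last (butlast g)) z" using g(4) gb by (subst (asm) gl[symmetric]) (simp add: successively_append_iff)
      moreover have "last (butlast g) \<in> A" using g(5) last_in_set[OF gb] by blast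
      ultimately have zn: "z \<in> nb A - A" "z \<in> carrier G" using g(3) nbr_carrier(2) by (auto simp: nb_def z_def)
      have gc: "set g \<subseteq> carrier G"
      proof -
        have "set g = set (butlast g) \<union> {z}" by (subst gl[symmetric]) simp
        then show ?thesis using g(5) A(1) zn(2) by auto
      qed
      have up: "bconn \<omega> (b, n + M) (z, n + M) (s2 * real K)"
      proof -
        have "bconn \<omega> (hd g, n + M) (last g, n + M) (s2 * (real (length g) - 1))"
          using conn_along[of "n + M" A \<omega> s2 g] horiz n M g(1,4,5) gc by auto
        then show ?thesis unfolding g(2) z_def[symmetric]
          by (elim conn_mono) (use s(3) g(6) in \<open>auto intro!: mult_left_mono\<close>)
      qed
      have bk: "bconn \<omega> (z, n) (b, n) (s * real K)"
      proof -
        have "bconn \<omega> (last g, n) (hd g, n) (s * (real (length g) - 1))"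
          using conn_along[of n A \<omega> s g] good n g(1,4,5) gc by auto
        then show ?thesis unfolding g(2) z_def[symmetric]
          by (elim conn_mono) (use s(1) g(6) in \<open>auto intro!: mult_left_mono\<close>)
      qed
      have down: "bconn \<omega> (z, n + M) (z, n) (s * real M)"
        using light[OF zn(1)] zn(2) by (intro conn_column[where M = M]) auto
      have pr: "bconn \<omega> (b, n) (a, n) (s * ?len - s * real M)" using proj q by simp
      \<comment> \<open>The bound in \<open>pr\<close> dominates the weight of a walk and so is
        nonnegative. This shows that the segment has at least \<open>M\<close> edges.\<close>
      have "0 \<le> s * ?len - s * real M"
      proof -
        obtain t where "bwalk t" "path_weight bl \<omega> t \<le> s * ?len - s * real M" using pr by (auto simp: conn_def)
        then show ?thesis using path_weight_nonneg[OF nn, of bV bl t] by linarith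
      qed
      then have "s * real M \<le> s * ?len" by simp
      then have lM: "real M \<le> ?len" using s(1) by simp
      from conn_trans[OF conn_trans[OF conn_trans[OF up down] bk] pr]
      have "bconn \<omega> q (a, n) (s2 * real K + s * real K + s * ?len)" unfolding q by (elim conn_mono) simp
      from seg[OF this] gt have "s1 * ?len < real K * (s2 + s) + s * ?len" by (simp add: algebra_simps)
      then have "(s1 - s) * ?len < real K * (s2 + s)" by (simp add: algebra_simps)
      moreover have "(s1 - s) * real M \<le> (s1 - s) * ?len" using lM s(2) by (intro mult_left_mono) auto
      ultimately show False using s(4) by (simp add: mult.commute)
    qed
  qed
qed

end

lemma geodesic_tree_cong:
  assumes "\<And>p e. fpp_path V E l p \<Longrightarrow> e \<in> set (path_edges l p) \<Longrightarrow> \<omega>' e = \<omega> e"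
  shows "geodesic_tree V E l \<omega>' A r = geodesic_tree V E l \<omega> A r"
proof -
  have "path_weight l \<omega>' p = path_weight l \<omega> p" if "fpp_path V E l p" for p
    using assms[OF that] by (rule path_weight_cong)
  then have "geodesic_to V E l \<omega>' A p \<longleftrightarrow> geodesic_to V E l \<omega> A p" for p
    unfolding geodesic_to_iff by (auto 4 3)
  then show ?thesis unfolding geodesic_tree_def by simp
qed

section \<open>Truncated trees and resampling above level \<open>n\<close>\<close>

context cayley_fpp
begin

abbreviation bP where "bP \<equiv> Pi\<^sub>M BE (\<lambda>_. \<mu>)"
abbreviation bshift where "bshift \<equiv> \<lambda>g (e :: ('a \<times> nat) set). shift_vertex G g ` e"

lemma trunc_layered: "layered_fpp BE \<mu> G {..n} bl bshift (card S + 2)"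
  by (rule bar_layered) auto

lemma sets_trunc: "{\<omega>\<in>space bP. u \<in> trunc_tree n \<omega> x} \<in> sets bP"
  by (rule layered_fpp.sets_tree[OF trunc_layered])

lemma sets_trunc_level_eq: "{\<omega>\<in>space bP. {y\<in>carrier G. (y, k) \<in> trunc_tree n \<omega> x} = A} \<in> sets bP"
  by (rule layered_fpp.sets_tree_level_eq[OF trunc_layered])

lemma sets_trunc_size: "{\<omega>\<in>space bP. level_size G k (trunc_tree n \<omega> x) \<le> of_nat K} \<in> sets bP"
  by (rule layered_fpp.sets_level_size_le[OF trunc_layered])

lemma sets_trunc_reach: "{\<omega>\<in>space bP. \<exists>y\<in>carrier G. (y, k) \<in> trunc_tree n \<omega> x} \<in> sets bP"
  by (rule layered_fpp.sets_reach[OF trunc_layered])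

text \<open>The truncated graph is also invariant under translations, so the top level of its tree
  has mean size 1 and is almost surely finite.\<close>

lemma AE_trunc_finite:
  assumes x: "x \<in> carrier G"
  shows "AE \<omega> in bP. \<forall>n. finite {y\<in>carrier G. (y, n) \<in> trunc_tree n \<omega> x}"
proof -
  have "AE \<omega> in bP. finite {y\<in>carrier G. (y, n) \<in> trunc_tree n \<omega> x}" for n
  proof -
    interpret tr: layered_fpp BE \<mu> G "{..n}" bl bshift "card S + 2" by (rule trunc_layered)
    have "AE \<omega> in bP. level_size G n (trunc_tree n \<omega> x) \<noteq> \<infinity>"
      using tr.nn_integral_level_size[of n x] x
      by (intro nn_integral_PInf_AE tr.measurable_level_size) simp_all
    then show ?thesis
    proof eventually_elim
      case (elim \<omega>)
      then obtain K where "level_size G n (trunc_tree n \<omega> x) < of_nat K"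
        using ennreal_Ex_less_of_nat by (auto simp: less_top)
      then show ?case using tr.level_size_le[of n "trunc_tree n \<omega> x" K] by (simp add: less_imp_le)
    qed
  qed
  then show ?thesis by (simp add: AE_all_countable)
qed

lemma bar_reach_trunc:
  assumes nn: "\<forall>e\<in>BE. 0 \<le> \<omega> e" and y: "(y, Suc n) \<in> bar.tree \<omega> x"
  shows "\<exists>a\<in>carrier G. (a, n) \<in> trunc_tree n \<omega> x"
proof -
  obtain p where p: "bar.geod \<omega> p" "hd p = (y, Suc n)" "last p = (x, 0)"
    using y unfolding geodesic_tree_iff[OF nn] by blast
  then show ?thesis using last_exit_geodesic[OF nn p(1), of n x] by auto
qed

text \<open>Let the full tree end at level \<open>h\<close>. A geodesic of the graph truncated at
  \<open>n\<close> from level \<open>n\<close> to \<open>x\<close> makes its last descent to level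
  \<open>h\<close> over one of finitely many points \<open>a\<close>. Once \<open>n\<close> exceeds
  the height of the full geodesics from \<open>(a, Suc h)\<close>, truncation does not matter for
  these starting points, and \<open>(a, Suc h)\<close> would belong to the full tree.\<close>

lemma trunc_eventually_empty:
  assumes good: "bar.good \<omega>" and h: "\<And>y k. h < k \<Longrightarrow> (y, k) \<notin> bar.tree \<omega> x"
    and fin: "finite {y\<in>carrier G. (y, h) \<in> trunc_tree h \<omega> x}"
  shows "\<exists>n0. \<forall>n\<ge>n0. \<not> (\<exists>y\<in>carrier G. (y, n) \<in> trunc_tree n \<omega> x)"
proof -
  note nn = bar.good_nonneg[OF good]
  define B where "B = {y\<in>carrier G. (y, h) \<in> trunc_tree h \<omega> x}"
  have "\<forall>b\<in>B. \<exists>p. bar.geod \<omega> p \<and> hd p = (b, Suc h)"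
    using bar.good_geod[OF good] by (auto simp: B_def)
  from bchoice[OF this] obtain \<gamma> where \<gamma>: "\<And>b. b \<in> B \<Longrightarrow> bar.geod \<omega> (\<gamma> b) \<and> hd (\<gamma> b) = (b, Suc h)" by blast
  \<comment> \<open>A sum as a crude bound for the maximal level visited by the finitely many
    geodesics \<open>\<gamma> b\<close>.\<close>
  define n0 where "n0 = Suc h + (\<Sum>b\<in>B. \<Sum>v\<in>set (\<gamma> b). snd v)"
  have n0: "snd v \<le> n0" if "b \<in> B" "v \<in> set (\<gamma> b)" for b v
  proof -
    have "snd v \<le> (\<Sum>v\<in>set (\<gamma> b). snd v)" using that by (intro member_le_sum) auto
    also have "\<dots> \<le> (\<Sum>b\<in>B. \<Sum>v\<in>set (\<gamma> b). snd v)"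
      using that fin by (intro member_le_sum) (auto simp: B_def)
    finally show ?thesis by (simp add: n0_def)
  qed
  have "\<not> (\<exists>y\<in>carrier G. (y, n) \<in> trunc_tree n \<omega> x)" if n: "n0 \<le> n" for n
  proof
    assume "\<exists>y\<in>carrier G. (y, n) \<in> trunc_tree n \<omega> x"
    then obtain y p where p: "geodesic_to (carrier G \<times> {..n}) BE bl \<omega> (level G 0) p" "hd p = (y, n)" "last p = (x, 0)"
      unfolding geodesic_tree_iff[OF nn] by blast
    have hn: "h < n" using n by (simp add: n0_def)
    obtain ys a zs where a: "p = ys @ (a, Suc h) # (a, h) # zs" "a \<in> carrier G" "(a, h) \<in> trunc_tree h \<omega> x"
      using last_exit_geodesic[OF nn p(1), of h x] p(2,3) hn by auto
    then have aB: "a \<in> B" by (simp add: B_def)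
    let ?p = "(a, Suc h) # (a, h) # zs"
    have gp: "geodesic_to (carrier G \<times> {..n}) BE bl \<omega> (level G 0) ?p"
      using geodesic_to_suffix[OF nn, where ?p1.0 = ys and ?p2.0 = ?p] p(1) a(1) by simp
    have g\<gamma>: "bar.geod \<omega> (\<gamma> a)" "hd (\<gamma> a) = (a, Suc h)" using \<gamma>[OF aB] by auto
    have "set (\<gamma> a) \<subseteq> carrier G \<times> {..n}"
    proof
      fix v assume v: "v \<in> set (\<gamma> a)"
      then have "fst v \<in> carrier G" using bar.geod_path[OF g\<gamma>(1)] by (auto simp: fpp_path_def)
      then show "v \<in> carrier G \<times> {..n}" using n0[OF aB v] n by (cases v) auto
    qed
    then have "fpp_path (carrier G \<times> {..n}) BE bl (\<gamma> a)" using bar.geod_path[OF g\<gamma>(1)] by (simp add: fpp_path_def)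
    then have le: "path_weight bl \<omega> ?p \<le> path_weight bl \<omega> (\<gamma> a)"
      using gp g\<gamma> by (simp add: geodesic_to_iff)
    have "(a, Suc h) \<in> bar.tree \<omega> x"
    proof (rule geodesic_tree_walkI[OF nn])
      have "fpp_walk (carrier G \<times> {..n}) BE bl ?p" using gp by (simp only: geodesic_to_iff fpp_path_walk)
      then show "fpp_walk bV BE bl ?p" unfolding fpp_walk_def by blast
      show "hd ?p = (a, Suc h)" "last ?p = (x, 0)" using p(3) a(1) by auto
      show "(x, 0) \<in> level G 0" using p by (auto simp: geodesic_to_iff)
      fix q assume "fpp_path bV BE bl q" "hd q = (a, Suc h)" "last q \<in> level G 0"
      then have "path_weight bl \<omega> (\<gamma> a) \<le> path_weight bl \<omega> q" using g\<gamma> by (simp add: geodesic_to_iff)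
      with le show "path_weight bl \<omega> ?p \<le> path_weight bl \<omega> q" by linarith
    qed
    then show False using h[of "Suc h" a] by simp
  qed
  then show ?thesis by blast
qed

text \<open>The projection runs along the horizontal edges at \<open>A\<close> in level
  \<open>n\<close>. They belong to the truncated graph and must not be resampled, so their lightness
  is secured in probability. Requiring an edge of \<open>BE\<close> excludes level 0, which has no
  horizontal edges.\<close>

definition edge_bad :: "real \<Rightarrow> (('a \<times> nat) set \<Rightarrow> real) \<Rightarrow> 'a \<times> nat \<Rightarrow> bool" where
  "edge_bad s \<omega> u \<longleftrightarrow> (\<exists>b\<in>{b. nbr (fst u) b}. {u, (b, snd u)} \<in> BE \<and> s < \<omega> {u, (b, snd u)})"

lemma sets_edge_bad: "{\<omega>\<in>space bP. edge_bad s \<omega> u} \<in> sets bP"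
  unfolding edge_bad_def
proof (rule sets.sets_Collect_finite_Ex)
  fix b
  show "{\<omega>\<in>space bP. {u, (b, snd u)} \<in> BE \<and> s < \<omega> {u, (b, snd u)}} \<in> sets bP"
  proof (cases "{u, (b, snd u)} \<in> BE")
    case True
    then show ?thesis using borel_measurable_less[OF borel_measurable_const bar.measurable_weight[OF True], of s] by simp
  qed simp
qed (use nbr_finite in blast)

lemma edge_bad_\<tau>:
  assumes g: "g \<in> carrier G" and u: "fst u \<in> carrier G"
  shows "edge_bad s (bar.\<tau> g \<omega>) u \<longleftrightarrow> edge_bad s \<omega> (shift_vertex G g u)"
proof -
  have eq: "{b. nbr (g \<otimes> fst u) b} = (\<lambda>b. g \<otimes> b) ` {b. nbr (fst u) b}"
    using g u generators(2) by (auto simp: nbr_set image_image m_assoc subset_iff intro!: image_eqI)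
  have "{u, (b, snd u)} \<in> BE \<and> s < bar.\<tau> g \<omega> {u, (b, snd u)} \<longleftrightarrow>
     {shift_vertex G g u, (g \<otimes> b, snd u)} \<in> BE \<and> s < \<omega> {shift_vertex G g u, (g \<otimes> b, snd u)}" if "nbr (fst u) b" for b
    using bar.edge_act[OF g u, of "(b, snd u)"] nbr_carrier(2)[OF that] by (simp add: bar.\<tau>_def)
  then show ?thesis unfolding edge_bad_def by (simp add: eq)
qed

lemma prob_edge_bad: "bar.prob {\<omega>\<in>space bP. edge_bad s \<omega> u} \<le> real (card S) * measure \<mu> {s<..}"
proof -
  let ?B = "\<lambda>b. {\<omega>\<in>space bP. {u, (b, snd u)} \<in> BE \<and> s < \<omega> {u, (b, snd u)}}"
  have B: "?B b \<in> sets bP \<and> bar.prob (?B b) \<le> measure \<mu> {s<..}" for b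
  proof (cases "{u, (b, snd u)} \<in> BE")
    case True
    have "?B b = {\<omega>\<in>space bP. \<omega> {u, (b, snd u)} \<in> {s<..}}" using True by auto
    moreover have "{\<omega>\<in>space bP. \<omega> {u, (b, snd u)} \<in> {s<..}} \<in> sets bP"
      using borel_measurable_less[OF borel_measurable_const bar.measurable_weight[OF True], of s] by simp
    moreover have "emeasure bP {\<omega>\<in>space bP. \<omega> {u, (b, snd u)} \<in> {s<..}} = emeasure \<mu> {s<..}"
      by (rule bar.emeasure_PiM_Collect_single[OF True]) simp
    ultimately show ?thesis by (simp add: measure_def)
  qed simp
  have fin: "finite {b. nbr (fst u) b}" using nbr_finite by blast
  have "{\<omega>\<in>space bP. edge_bad s \<omega> u} = (\<Union>b\<in>{b. nbr (fst u) b}. ?B b)" by (auto simp: edge_bad_def)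
  then have "bar.prob {\<omega>\<in>space bP. edge_bad s \<omega> u} \<le> (\<Sum>b\<in>{b. nbr (fst u) b}. bar.prob (?B b))"
    using B fin by (simp only:, intro measure_UNION_le) auto
  also have "\<dots> \<le> (\<Sum>b\<in>{b. nbr (fst u) b}. measure \<mu> {s<..})" using B by (intro sum_mono) blast
  also have "\<dots> \<le> real (card S) * measure \<mu> {s<..}"
    using nbr_finite[of "fst u"] by (simp add: mult_right_mono)
  finally show ?thesis .
qed

text \<open>Horizontal edges are included only from level \<open>n + 1\<close> on, vertical ones
  from the edge leaving level \<open>n\<close>: every listed edge has an end above level
  \<open>n\<close>, so the truncated tree does not see it.\<close>

definition heavy_edges :: "'a set \<Rightarrow> nat \<Rightarrow> nat \<Rightarrow> ('a \<times> nat) set set" where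
  "heavy_edges A n M = (\<lambda>(a, k). {(a, k), (a, Suc k)}) ` (A \<times> {n..<n + M}) \<union>
     (\<Union>a\<in>A. (\<lambda>(b, k). {(a, k), (b, k)}) ` ({b. nbr a b} \<times> {n<..n + M}))"

definition light_edges :: "'a set \<Rightarrow> nat \<Rightarrow> nat \<Rightarrow> ('a \<times> nat) set set" where
  "light_edges A n M = (\<lambda>(z, k). {(z, k), (z, Suc k)}) ` ((nb A - A) \<times> {n..<n + M})"

lemma heavy_light_edges:
  assumes A: "finite A" "card A \<le> K" "A \<subseteq> carrier G"
  shows "finite (heavy_edges A n M \<union> light_edges A n M)"
    "card (heavy_edges A n M \<union> light_edges A n M) \<le> K * M + K * (card S * M) + card S * K * M"
    "heavy_edges A n M \<union> light_edges A n M \<subseteq> BE"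
    "heavy_edges A n M \<inter> light_edges A n M = {}"
    "\<And>e. e \<in> heavy_edges A n M \<union> light_edges A n M \<Longrightarrow> \<exists>v\<in>e. n < snd v"
proof -
  have f1: "finite {b. nbr a b}" "card {b. nbr a b} \<le> card S" for a using nbr_finite by blast+
  have f2: "finite (nb A)" "card (nb A) \<le> card S * card A" using nb_finite[OF A(1)] by blast+
  show "finite (heavy_edges A n M \<union> light_edges A n M)"
    using A(1) f1 f2 by (auto simp: heavy_edges_def light_edges_def)
  have "card ((\<lambda>(a, k). {(a, k), (a, Suc k)}) ` (A \<times> {n..<n + M})) \<le> card (A \<times> {n..<n + M})"
    using A(1) by (intro card_image_le) auto
  also have "\<dots> \<le> K * M" using A(2) by (simp add: card_cartesian_product)
  finally have c1: "card ((\<lambda>(a, k). {(a, k), (a, Suc k)}) ` (A \<times> {n..<n + M})) \<le> K * M" .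
  have "card (\<Union>a\<in>A. (\<lambda>(b, k). {(a, k), (b, k)}) ` ({b. nbr a b} \<times> {n<..n + M})) \<le>
    (\<Sum>a\<in>A. card ((\<lambda>(b, k). {(a, k), (b, k)}) ` ({b. nbr a b} \<times> {n<..n + M})))"
    by (rule card_UN_le[OF A(1)])
  also have "\<dots> \<le> (\<Sum>a\<in>A. card S * M)"
  proof (rule sum_mono)
    fix a
    have "card ((\<lambda>(b, k). {(a, k), (b, k)}) ` ({b. nbr a b} \<times> {n<..n + M})) \<le> card ({b. nbr a b} \<times> {n<..n + M})"
      using f1 by (intro card_image_le) auto
    also have "\<dots> \<le> card S * M" using f1(2)[of a] by (simp add: card_cartesian_product)
    finally show "card ((\<lambda>(b, k). {(a, k), (b, k)}) ` ({b. nbr a b} \<times> {n<..n + M})) \<le> card S * M" .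
  qed
  also have "\<dots> \<le> K * (card S * M)" using A(2) by simp
  finally have c2: "card (\<Union>a\<in>A. (\<lambda>(b, k). {(a, k), (b, k)}) ` ({b. nbr a b} \<times> {n<..n + M})) \<le> K * (card S * M)" .
  have "card (light_edges A n M) \<le> card ((nb A - A) \<times> {n..<n + M})"
    unfolding light_edges_def using f2 by (intro card_image_le) auto
  also have "\<dots> \<le> card (nb A) * M" using f2 by (simp add: card_cartesian_product card_mono)
  also have "\<dots> \<le> card S * K * M" using f2(2) A(2) by (meson mult_le_mono order_trans order_refl)
  finally have c3: "card (light_edges A n M) \<le> card S * K * M" .
  have "card (heavy_edges A n M) \<le> K * M + K * (card S * M)"
    unfolding heavy_edges_def using c1 c2 by (intro order_trans[OF card_Un_le] add_mono)
  then show "card (heavy_edges A n M \<union> light_edges A n M) \<le> K * M + K * (card S * M) + card S * K * M"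
    using c3 by (intro order_trans[OF card_Un_le] add_mono)
  show "heavy_edges A n M \<union> light_edges A n M \<subseteq> BE"
  proof
    fix e assume "e \<in> heavy_edges A n M \<union> light_edges A n M"
    then consider a k where "a \<in> A \<union> nb A" "e = {(a, k), (a, Suc k)}"
      | a b k where "a \<in> A" "nbr a b" "n < k" "e = {(a, k), (b, k)}"
      by (auto simp: heavy_edges_def light_edges_def)
    then show "e \<in> BE"
    proof cases
      case 1
      then have "a \<in> carrier G" using A(3) nb_carrier by blast
      then show ?thesis using 1 by (simp add: bar_edge_iff)
    next
      case 2
      then show ?thesis using nbr_carrier[OF 2(2)] by (simp add: bar_edge_iff)
    qed
  qed
  show "heavy_edges A n M \<inter> light_edges A n M = {}"
    by (auto simp: heavy_edges_def light_edges_def doubleton_eq_iff)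
  show "\<exists>v\<in>e. n < snd v" if "e \<in> heavy_edges A n M \<union> light_edges A n M" for e
    using that by (auto simp: heavy_edges_def light_edges_def)
qed

text \<open>The resampled edges are determined by \<open>A\<close>, and \<open>A\<close> comes from
  the truncated tree, which the resampling does not alter. So one application of
  \<open>prob_resample_bound\<close> per \<open>A\<close> suffices, without a union over edge
  sets.\<close>

lemma prob_bar_cut_off:
  assumes n: "1 \<le> n" and M: "2 \<le> M"
    and s: "0 < s" "s < s1" "s1 < s2" "real K * (s2 + s) < real M * (s1 - s)"
    and q: "0 \<le> q" "q \<le> 1" "q \<le> measure \<mu> {0<..s}" "q \<le> measure \<mu> {s1<..s2}"
    and H: "H = {\<omega>\<in>space bP. bar.good \<omega> \<and> (\<exists>y\<in>carrier G. (y, n) \<in> trunc_tree n \<omega> x) \<and>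
      level_size G n (trunc_tree n \<omega> x) \<le> of_nat K \<and>
      \<not> (\<exists>y\<in>carrier G. (y, n) \<in> trunc_tree n \<omega> x \<and> edge_bad s \<omega> (y, n))}"
  shows "bar.prob H * q ^ (K * M + K * (card S * M) + card S * K * M) \<le>
    bar.prob {\<omega>\<in>space bP. (\<exists>y\<in>carrier G. (y, n) \<in> trunc_tree n \<omega> x) \<and>
      \<not> (\<exists>y\<in>carrier G. (y, n + M) \<in> bar.tree \<omega> x)}"
proof -
  let ?N = "K * M + K * (card S * M) + card S * K * M"
  define lev where "lev \<omega> = {y\<in>carrier G. (y, n) \<in> trunc_tree n \<omega> x}" for \<omega>
  define I where "I = {A. A \<noteq> {} \<and> finite A \<and> A \<subseteq> carrier G \<and> card A \<le> K}"
  define X where "X A = {\<omega>\<in>space bP. \<omega> \<in> H \<and> lev \<omega> = A}" for A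
  define Y where "Y A = {\<omega>\<in>space bP. lev \<omega> = A \<and> \<not> (\<exists>y\<in>carrier G. (y, n + M) \<in> bar.tree \<omega> x)}" for A
  have mH: "H \<in> sets bP"
    unfolding H
    by (intro sets.sets_Collect_conj sets.sets_Collect_neg bar.sets_good sets_trunc_reach sets_trunc_size
        sets.sets_Collect_countable_Ex' sets_trunc countable_carrier sets_edge_bad)
  have "{\<omega>\<in>space bP. \<omega> \<in> H} = H" unfolding H by blast
  then have HS: "{\<omega>\<in>space bP. \<omega> \<in> H} \<in> sets bP" using mH by simp
  have mX: "X A \<in> bar.events" for A
    unfolding X_def lev_def by (intro sets.sets_Collect_conj HS sets_trunc_level_eq)
  have mY: "Y A \<in> bar.events" for A
    unfolding Y_def lev_def by (intro sets.sets_Collect_conj sets.sets_Collect_neg sets_trunc_level_eq bar.sets_reach)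
  have step: "bar.prob (X A) * q ^ ?N \<le> bar.prob (Y A)" if A: "A \<in> I" for A
  proof -
    let ?F = "heavy_edges A n M \<union> light_edges A n M"
    have A': "finite A" "card A \<le> K" "A \<subseteq> carrier G" using A by (auto simp: I_def)
    note F = heavy_light_edges[OF A', where n = n and M = M]
    show ?thesis
    \<comment> \<open>Light weights are drawn from \<open>{0<..s}\<close> rather than
      \<open>{..s}\<close>, so that all weights stay positive.\<close>
    proof (rule bar.prob_resample_bound[where F = ?F and B = "\<lambda>e. if e \<in> light_edges A n M then {0<..s} else {s1<..s2}"])
      show "X A \<in> bar.events" "Y A \<in> bar.events" by (rule mX, rule mY)
      fix \<omega> \<omega>' assume w: "\<omega> \<in> X A" "\<omega>' \<in> space bP" and eq: "\<And>e. e \<in> BE - ?F \<Longrightarrow> \<omega>' e = \<omega> e"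
        and B: "\<And>e. e \<in> ?F \<Longrightarrow> \<omega>' e \<in> (if e \<in> light_edges A n M then {0<..s} else {s1<..s2})"
      have \<omega>: "bar.good \<omega>" "lev \<omega> = A"
        "\<And>y. y \<in> carrier G \<Longrightarrow> (y, n) \<in> trunc_tree n \<omega> x \<Longrightarrow> \<not> edge_bad s \<omega> (y, n)"
        using w(1) unfolding X_def H by blast+
      have light: "0 < \<omega>' e \<and> \<omega>' e \<le> s" if "e \<in> light_edges A n M" for e using B[of e] that by auto
      have heavy: "s1 < \<omega>' e \<and> \<omega>' e \<le> s2" if e: "e \<in> heavy_edges A n M" for e
      proof -
        have "e \<notin> light_edges A n M" using e F(4) by blast
        then show ?thesis using B[of e] e by simp
      qed
      have pos: "\<forall>e\<in>BE. 0 < \<omega>' e"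
      proof
        fix e assume e: "e \<in> BE"
        consider "e \<in> light_edges A n M" | "e \<in> heavy_edges A n M" | "e \<in> BE - ?F" using e by blast
        then show "0 < \<omega>' e"
        proof cases
          case 3
          then show ?thesis using eq[OF 3] \<omega>(1) e by (simp add: bar.good_def)
        qed (use light heavy s in force)+
      qed
      \<comment> \<open>Paths of the truncated graph avoid all resampled edges, as each of these has
        an end above level \<open>n\<close>.\<close>
      have "trunc_tree n \<omega>' x = trunc_tree n \<omega> x"
      proof (rule geodesic_tree_cong)
        fix p e assume p: "fpp_path (carrier G \<times> {..n}) BE bl p" and e: "e \<in> set (path_edges bl p)"
        have "set (path_edges bl p) \<subseteq> BE" using p by (intro path_edges_in) (simp add: fpp_path_def)
        then have "e \<in> BE" using e by blast
        moreover obtain p1 u v p2 where "p = p1 @ u # v # p2" "e = {u, v}" using e by (rule path_edgesE)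
        then have "\<not> (\<exists>v\<in>e. n < snd v)" using p by (auto simp: fpp_path_def)
        then have "e \<notin> ?F" using F(5) by blast
        ultimately show "\<omega>' e = \<omega> e" using eq by blast
      qed
      then have lev': "A = {y\<in>carrier G. (y, n) \<in> trunc_tree n \<omega>' x}" using \<omega>(2) by (simp add: lev_def)
      have "(y, n + M) \<notin> bar.tree \<omega>' x" for y
      proof (rule bar_tree_cut_off[OF pos n M lev' A'(1,2) s(1,2) _ s(4)])
        show "0 \<le> s2" using s by simp
        show "\<omega>' {(a, n), (b, n)} \<le> s" if ab: "a \<in> A" "nbr a b" for a b
        proof -
          have e: "{(a, n), (b, n)} \<in> BE" using ab n nbr_carrier[OF ab(2)] by (simp add: bar_edge_iff)
          have "\<not> (\<exists>v\<in>{(a, n), (b, n)}. n < snd v)" by simp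
          then have "{(a, n), (b, n)} \<notin> ?F" using F(5) by blast
          then have "\<omega>' {(a, n), (b, n)} = \<omega> {(a, n), (b, n)}" using eq e by blast
          moreover have "\<not> edge_bad s \<omega> (a, n)" using \<omega>(2,3) ab(1) by (auto simp: lev_def)
          ultimately show ?thesis using ab(2) e by (auto simp: edge_bad_def not_less)
        qed
        show "s1 < \<omega>' {(a, k), (a, Suc k)}" if "a \<in> A" "n \<le> k" "k < n + M" for a k
          using heavy[of "{(a, k), (a, Suc k)}"] that by (force simp: heavy_edges_def)
        show "s1 < \<omega>' {(a, k), (b, k)} \<and> \<omega>' {(a, k), (b, k)} \<le> s2"
          if abk: "a \<in> A" "nbr a b" "n < k" "k \<le> n + M" for a b k
        proof (rule heavy)
          have "{(a, k), (b, k)} = (\<lambda>(b, k). {(a, k), (b, k)}) (b, k)" by simp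
          moreover have "(b, k) \<in> {b. nbr a b} \<times> {n<..n + M}" using abk by simp
          ultimately show "{(a, k), (b, k)} \<in> heavy_edges A n M" unfolding heavy_edges_def using abk(1) by blast
        qed
        show "\<omega>' {(z, k), (z, Suc k)} \<le> s" if "z \<in> nb A - A" "n \<le> k" "k < n + M" for z k
          using light[of "{(z, k), (z, Suc k)}"] that by (force simp: light_edges_def)
      qed simp
      then show "\<omega>' \<in> Y A" using w(2) lev' by (simp add: Y_def lev_def)
    qed (use F q in auto)
  qed
  have "bar.prob (\<Union>A\<in>I. X A) * q ^ ?N \<le> bar.prob (\<Union>A\<in>I. Y A)"
  proof (rule bar.prob_UN_le[OF _ _ _ _ _ _ step])
    show "X A \<in> bar.events" "Y A \<in> bar.events" for A by (rule mX, rule mY)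
    have "countable {A. finite A \<and> A \<subseteq> carrier G}" by (rule countable_Collect_finite_subset[OF countable_carrier])
    then show "countable I" by (rule countable_subset[rotated]) (auto simp: I_def)
    show "disjoint_family_on X I" "disjoint_family_on Y I" by (auto simp: disjoint_family_on_def X_def Y_def)
  qed (use q in auto)
  also have "(\<Union>A\<in>I. X A) = H"
  proof -
    have "lev \<omega> \<in> I" if w: "\<omega> \<in> H" for \<omega>
    proof -
      have "finite (lev \<omega>)" "card (lev \<omega>) \<le> K"
        using bar.level_size_le[of n "trunc_tree n \<omega> x" K] w unfolding H lev_def by blast+
      moreover have "lev \<omega> \<noteq> {}" using w unfolding H lev_def by blast
      moreover have "lev \<omega> \<subseteq> carrier G" unfolding lev_def by blast
      ultimately show ?thesis unfolding I_def by blast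
    qed
    moreover have "H \<subseteq> space bP" unfolding H by blast
    ultimately show ?thesis unfolding X_def by blast
  qed
  also have "bar.prob (\<Union>A\<in>I. Y A) \<le> bar.prob {\<omega>\<in>space bP. (\<exists>y\<in>carrier G. (y, n) \<in> trunc_tree n \<omega> x) \<and>
      \<not> (\<exists>y\<in>carrier G. (y, n + M) \<in> bar.tree \<omega> x)}"
  proof (rule bar.finite_measure_mono)
    show "(\<Union>A\<in>I. Y A) \<subseteq> {\<omega>\<in>space bP. (\<exists>y\<in>carrier G. (y, n) \<in> trunc_tree n \<omega> x) \<and>
      \<not> (\<exists>y\<in>carrier G. (y, n + M) \<in> bar.tree \<omega> x)}" unfolding I_def Y_def lev_def by blast
    show "{\<omega>\<in>space bP. (\<exists>y\<in>carrier G. (y, n) \<in> trunc_tree n \<omega> x) \<and>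
      \<not> (\<exists>y\<in>carrier G. (y, n + M) \<in> bar.tree \<omega> x)} \<in> bar.events"
      by (intro sets.sets_Collect_conj sets.sets_Collect_neg sets_trunc_reach bar.sets_reach)
  qed
  finally show ?thesis .
qed

section \<open>Almost sure finiteness of the undirected tree\<close>

lemma measure_pos_part: "measure \<mu> {0<..s} = measure \<mu> {..s}"
proof (rule hat.mu.finite_measure_eq_AE)
  have "AE t in \<mu>. t \<noteq> 0" using non_atomic_mu[of 0] by (intro AE_I[of _ _ "{0}"]) auto
  then show "AE t in \<mu>. t \<in> {0<..s} \<longleftrightarrow> t \<in> {..s}" using nonneg_mu by eventually_elim auto
qed auto

lemma bar_edge_level: "{u, v} \<in> BE \<Longrightarrow> snd u \<le> Suc (snd v)"
  by (auto simp: bar_edge_iff)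

lemma bar_tree_finite:
  assumes x: "x \<in> carrier G"
  shows "AE \<omega> in bP. \<exists>n0. \<forall>n\<ge>n0. \<forall>y. (y, n) \<notin> bar.tree \<omega> x"
proof -
  define I where "I = {\<omega>\<in>space bP. \<forall>n. \<exists>y\<in>carrier G. (y, n) \<in> bar.tree \<omega> x}"
  define \<delta> where "\<delta> = bar.prob I"
  have "\<delta> = 0"
  proof (rule ccontr)
    assume "\<delta> \<noteq> 0"
    then have \<delta>: "0 < \<delta>" by (simp add: \<delta>_def zero_less_measure_iff)
    have \<delta>1: "\<delta> \<le> 1" unfolding \<delta>_def by (rule bar.prob_le_1)
    obtain K :: nat where K: "4 / \<delta> < real K" using reals_Archimedean2 by blast
    have "0 < 4 / \<delta>" using \<delta> by simp
    then have "0 < real K" using K by linarith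
    then have K0: "0 < K" by simp
    then have K1: "1 / real K \<le> \<delta> / 4" using K \<delta> by (simp add: field_simps)
    \<comment> \<open>Chosen so that the union bound over the at most \<open>card S\<close>
      horizontal edges at a vertex gives \<open>\<delta> / 4\<close>.\<close>
    define \<alpha> where "\<alpha> = \<delta> / (4 * real (card S))"
    have cS: "1 \<le> real (card S)" using card_S_pos by simp
    then have \<alpha>: "0 < \<alpha>" "real (card S) * \<alpha> = \<delta> / 4" using \<delta> by (auto simp: \<alpha>_def)
    have "\<alpha> \<le> real (card S) * \<alpha>" using cS \<alpha>(1) by simp
    then have \<alpha>1: "\<alpha> < 1" using \<alpha> \<delta>1 by linarith
    obtain s s1 s2 where s: "0 < s" "s < s1" "s1 < s2" "measure \<mu> {s<..} = \<alpha>" "0 < measure \<mu> {s1<..s2}"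
      using bar.upper_quantiles[OF \<alpha>(1) \<alpha>1] by blast
    have low: "0 < measure \<mu> {0<..s}" using bar.cdf_gt[of s] s(4) \<alpha>1 by (simp add: measure_pos_part)
    define q where "q = min (measure \<mu> {0<..s}) (measure \<mu> {s1<..s2})"
    have q: "0 < q" "q \<le> 1" using low s(5) by (auto simp: q_def min_def)
    \<comment> \<open>The zone is made so high that the gain along heavy columns exceeds the cost of
      the horizontal excursions at its top and bottom.\<close>
    obtain M0 :: nat where "real K * (s2 + s) / (s1 - s) < real M0" using reals_Archimedean2 by blast
    then have M0: "real K * (s2 + s) < real M0 * (s1 - s)" using s by (simp add: divide_simps)
    define M where "M = M0 + 2"
    have "real M0 * (s1 - s) \<le> real M * (s1 - s)" using s by (intro mult_right_mono) (auto simp: M_def)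
    then have M: "2 \<le> M" "real K * (s2 + s) < real M * (s1 - s)" using M0 by (auto simp: M_def)
    define c where "c = q ^ (K * M + K * (card S * M) + card S * K * M)"
    have c: "0 < c" using q by (simp add: c_def)
    define X where "X n = {\<omega>\<in>space bP. (\<exists>y\<in>carrier G. (y, n) \<in> trunc_tree n \<omega> x) \<and>
      \<not> (\<exists>y\<in>carrier G. (y, n + M) \<in> bar.tree \<omega> x)}" for n
    \<comment> \<open>If the full tree reaches all levels, the second condition of
      \<open>X n\<close> always fails; if not, \<open>trunc_eventually_empty\<close> makes the first
      one fail for large \<open>n\<close>.\<close>
    have "(\<lambda>n. bar.prob (X n)) \<longlonglongrightarrow> 0"
    proof (rule bar.prob_tendsto_0)
      show "X n \<in> bar.events" for n
        unfolding X_def by (intro sets.sets_Collect_conj sets.sets_Collect_neg sets_trunc_reach bar.sets_reach)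
      show "AE \<omega> in bP. \<exists>n0. \<forall>n\<ge>n0. \<omega> \<notin> X n"
        using bar.AE_good AE_trunc_finite[OF x]
      proof eventually_elim
        case (elim \<omega>)
        show ?case
        proof (cases "\<forall>n. \<exists>y\<in>carrier G. (y, n) \<in> bar.tree \<omega> x")
          case True
          then show ?thesis unfolding X_def by blast
        next
          case False
          then obtain h where h: "\<not> (\<exists>y\<in>carrier G. (y, h) \<in> bar.tree \<omega> x)" by blast
          have "(y, k) \<notin> bar.tree \<omega> x" if "h < k" for y k
            using bar.tree_lower[OF bar_edge_level, of "(y, k)" \<omega> x h] h that by auto
          moreover have "finite {y\<in>carrier G. (y, h) \<in> trunc_tree h \<omega> x}" using elim(2) by blast
          ultimately have "\<exists>n0. \<forall>n\<ge>n0. \<not> (\<exists>y\<in>carrier G. (y, n) \<in> trunc_tree n \<omega> x)"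
            by (rule trunc_eventually_empty[OF elim(1)])
          then show ?thesis unfolding X_def by blast
        qed
      qed
    qed
    then have "eventually (\<lambda>n. bar.prob (X n) < \<delta> / 4 * c) sequentially"
      using \<delta> c by (intro order_tendstoD) auto
    then obtain n0 where n0: "\<And>n. n0 \<le> n \<Longrightarrow> bar.prob (X n) < \<delta> / 4 * c" by (auto simp: eventually_sequentially)
    \<comment> \<open>The successor guarantees level at least 1, where horizontal edges
      exist.\<close>
    define n where "n = Suc n0"
    have n: "1 \<le> n" "n0 \<le> n" by (auto simp: n_def)
    interpret tr: layered_fpp BE \<mu> G "{..n}" bl bshift "card S + 2" by (rule trunc_layered)
    define H where "H = {\<omega>\<in>space bP. bar.good \<omega> \<and> (\<exists>y\<in>carrier G. (y, n) \<in> trunc_tree n \<omega> x) \<and>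
      level_size G n (trunc_tree n \<omega> x) \<le> of_nat K \<and>
      \<not> (\<exists>y\<in>carrier G. (y, n) \<in> trunc_tree n \<omega> x \<and> edge_bad s \<omega> (y, n))}"
    define N0 where "N0 = {\<omega>\<in>space bP. \<not> bar.good \<omega>}"
    define N1 where "N1 = {\<omega>\<in>space bP. \<not> level_size G n (trunc_tree n \<omega> x) \<le> of_nat K}"
    define N2 where "N2 = {\<omega>\<in>space bP. \<exists>y\<in>carrier G. (y, n) \<in> trunc_tree n \<omega> x \<and> edge_bad s \<omega> (y, n)}"
    have mN: "H \<in> bar.events" "N0 \<in> bar.events" "N1 \<in> bar.events" "N2 \<in> bar.events"
      unfolding H_def N0_def N1_def N2_def
      by (intro sets.sets_Collect_conj sets.sets_Collect_neg bar.sets_good sets_trunc_reach sets_trunc_size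
        sets.sets_Collect_countable_Ex' sets_trunc countable_carrier sets_edge_bad)+
    have p0: "bar.prob N0 = 0"
    proof -
      have "bar.prob N0 = 0 \<longleftrightarrow> (AE \<omega> in bP. \<omega> \<notin> N0)" using mN(2) by (rule bar.prob_eq_0)
      moreover have "AE \<omega> in bP. \<omega> \<notin> N0" using bar.AE_good by eventually_elim (simp add: N0_def)
      ultimately show ?thesis by blast
    qed
    have p1: "bar.prob N1 \<le> \<delta> / 4"
      using tr.prob_level_size_le[of n x K] x K0 K1 unfolding N1_def by simp
    have p2: "bar.prob N2 \<le> \<delta> / 4"
    proof -
      have "bar.prob N2 \<le> bar.prob {\<omega>\<in>space bP. edge_bad s \<omega> (\<one>, n)}"
        unfolding N2_def
        by (rule tr.prob_tree_Q_le[OF sets_edge_bad _ _ x]) (auto intro!: edge_bad_\<tau>)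
      also have "\<dots> \<le> real (card S) * measure \<mu> {s<..}" by (rule prob_edge_bad)
      also have "\<dots> = \<delta> / 4" using s(4) \<alpha>(2) by simp
      finally show ?thesis .
    qed
    have "I \<subseteq> H \<union> (N0 \<union> (N1 \<union> N2))"
    proof
      fix \<omega> assume w: "\<omega> \<in> I"
      \<comment> \<open>A full tree that reaches level \<open>n + 1\<close> descends to level
        \<open>n\<close> for the last time inside the truncated tree.\<close>
      have "\<exists>y\<in>carrier G. (y, n) \<in> trunc_tree n \<omega> x" if "bar.good \<omega>"
        using bar_reach_trunc[OF bar.good_nonneg[OF that]] w unfolding I_def by blast
      then show "\<omega> \<in> H \<union> (N0 \<union> (N1 \<union> N2))" using w unfolding I_def H_def N0_def N1_def N2_def by blast
    qed
    then have "\<delta> \<le> bar.prob (H \<union> (N0 \<union> (N1 \<union> N2)))"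
      unfolding \<delta>_def using mN by (intro bar.finite_measure_mono) auto
    also have "\<dots> \<le> bar.prob H + (bar.prob N0 + (bar.prob N1 + bar.prob N2))"
      using mN by (intro order_trans[OF measure_Un_le] add_left_mono sets.Un order_refl) auto
    finally have pH: "\<delta> / 2 \<le> bar.prob H" using p0 p1 p2 by linarith
    have "bar.prob H * c \<le> bar.prob (X n)"
      unfolding c_def X_def
      by (rule prob_bar_cut_off[OF n(1) M(1) s(1-3) M(2) _ _ _ _ H_def]) (use q in \<open>auto simp: q_def\<close>)
    moreover have "\<delta> / 2 * c \<le> bar.prob H * c" using pH c by (intro mult_right_mono) auto
    moreover have "\<delta> / 4 * c < \<delta> / 2 * c" using \<delta> c by (intro mult_strict_right_mono) auto
    ultimately show False using n0[OF n(2)] by linarith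
  qed
  then have "bar.prob {\<omega>\<in>space bP. \<forall>n. \<exists>y\<in>carrier G. (y, n) \<in> bar.tree \<omega> x} = 0" by (simp add: \<delta>_def I_def)
  then show ?thesis by (rule bar.AE_tree_finite[OF bar_edge_level, rotated])
qed

end

theorem theorem1p2:
  fixes G :: "('a, 'b) monoid_scheme" and S :: "'a set" and \<mu> :: "real measure" and x :: 'a
  assumes "group G" and "infinite (carrier G)"
    and "symmetric_generating_set G S"
    and "real_distribution \<mu>"
    and non_atomic: "\<And>a. emeasure \<mu> {a} = 0"
    and nonneg_support: "AE t in \<mu>. 0 \<le> t"
    and finite_mean: "integrable \<mu> (\<lambda>t. t)"
    and "x \<in> carrier G"
  shows "(\<integral>\<^sup>+ \<omega>. max_level_size G (hat_tree G S \<omega> x) \<partial>hat_measure G S \<mu>) = \<infinity>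
       \<and> (\<integral>\<^sup>+ \<omega>. max_level_size G (bar_tree G S \<omega> x) \<partial>bar_measure G S \<mu>) = \<infinity>"
proof -
  interpret cayley_fpp G S \<mu>
    using assms by (intro cayley_fpp.intro cayley_fpp_axioms.intro)
  show ?thesis
    using hat.nn_integral_max_level_size[OF refl \<open>x \<in> carrier G\<close>] hat_tree_finite[OF finite_mean \<open>x \<in> carrier G\<close>]
      bar.nn_integral_max_level_size[OF refl \<open>x \<in> carrier G\<close> bar_tree_finite[OF \<open>x \<in> carrier G\<close>]]
    unfolding hat_measure_def bar_measure_def hat_tree_def bar_tree_def level_vertices_def by blast
qed

end
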